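(* Let $K$ be a non-archimedean locally compact field with residue field of characteristic $p$, let $d\ge1$, $G=\mathrm{GL}_{d+1}(K)$, let $X$ be the Bruhat-Tits building of $\mathrm{PGL}_{d+1}/K$, and let $n>1$ be an integer. Let $V$ be a smooth representation of $G$ on a (not necessarily free) $\mathbb{Z}[\frac1p]$-module which is generated, as a $G$-representation, by its $U^{(n)}$-fixed vectors. Then the chain complex $C_\bullet(X,\underline{V})$ is a resolution of $V$, i.e. the augmented complex $$\cdots\to C_1(X,\underline{V})\xrightarrow{\partial}C_0(X,\underline{V})=\bigoplus_{x\in X^0}V^{U_x}\to V\to0,$$ with augmentation the sum of the inclusions $V^{U_x}\subset V$, is exact.
   Context: $\mathcal{O}_K$ is the ring of integers of $K$, $\pi$ a prime element. Vertices of $X$ are the homothety classes $[L]$ of lattices $L$ (free $\mathcal{O}_K$-submodules of rank $d+1$) in $K^{d+1}$; $k$-simplices are the sets $\{[L_0],\ldots,[L_k]\}$ arising from lattice chains $\pi L_k\subsetneq L_0\subsetneq\cdots\subsetneq L_k$. $X^j$ is the set of $j$-simplices. $U=U^{(n)}=\{g\in\mathrm{GL}_{d+1}(\mathcal{O}_K): g\equiv1\bmod\pi^n\}$ is the principal congruence subgroup of level $n$. For a vertex $x=g([\mathcal{O}_K^{d+1}])$, $g\in G$, put $U_x=U_x^{(n)}=gUg^{-1}$; for a simplex $\tau=\{x_1,\ldots,x_k\}$ let $U_\tau$ be the subgroup of $G$ generated by $U_{x_1}\cup\cdots\cup U_{x_k}$. Since $U_\sigma\subset U_\tau$ for $\sigma\subset\tau$,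 the groups $V^{U_\tau}=\{v\in V: gv=v\text{ for all }g\in U_\tau\}$ with the inclusions $V^{U_\tau}\subset V^{U_\sigma}$ ($\sigma\subset\tau$) as transition maps $r^\tau_\sigma$ form a homological coefficient system $\underline{V}$ on $X$. $C_k(X,\underline{V})=\bigoplus_{\tau\in X^k}V^{U_\tau}$, with boundary $\partial:C_{k+1}(X,\underline{V})\to C_k(X,\underline{V})$, $(\partial c)_\tau=\sum_{\tau'\supset\tau}[\tau':\tau]\,r^{\tau'}_\tau(c_{\tau'})$, the sum being over $(k+1)$-simplices $\tau'$ containing $\tau$, with $[\tau':\tau]=\pm1$ the incidence numbers with respect to a fixed labelling of $X$ by vertex types. *)

theory Defs
  imports "HOL-Analysis.Analysis" "HOL-Algebra.Generated_Groups"
begin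

text \<open>
  A non-archimedean locally compact field: its topology is given by a nontrivial
  (hence non-discrete) ultrametric absolute value, and it is locally compact.
\<close>

class nonarch_lc_field = field + metric_space +
  fixes absv :: "'a \<Rightarrow> real"
  assumes dist_absv: "dist x y = absv (x - y)"
    and absv_mult: "absv (x * y) = absv x * absv y"
    and absv_ultrametric: "absv (x + y) \<le> max (absv x) (absv y)"
    and absv_nontrivial: "\<exists>x. x \<noteq> 0 \<and> absv x \<noteq> 1"
    and locally_compact: "\<exists>U C. open U \<and> x \<in> U \<and> U \<subseteq> C \<and> compact C"

definition integers :: "'k::nonarch_lc_field set"
  where "integers = {a. absv a \<le> 1}"

definition prime_element :: "'k::nonarch_lc_field \<Rightarrow> bool"
  where "prime_element \<pi> \<longleftrightarrow>
    \<pi> \<in> integers \<and> \<pi> \<noteq> 0 \<and> inverse \<pi> \<notin> integers \<and>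
    (\<forall>a\<in>integers. \<forall>b\<in>integers. (\<exists>c\<in>integers. a * b = \<pi> * c) \<longrightarrow>
       (\<exists>c\<in>integers. a = \<pi> * c) \<or> (\<exists>c\<in>integers. b = \<pi> * c))"

text \<open>
  The residue field is the quotient of the integers by the maximal ideal of elements of
  absolute value less than 1, so \<open>of_nat m\<close> vanishes in it iff \<open>absv (of_nat m) < 1\<close>;
  the condition below is the one that defines \<open>CHAR\<close> in the library.
\<close>

definition residue_char :: "'k::nonarch_lc_field itself \<Rightarrow> nat \<Rightarrow> bool"
  where "residue_char _ p \<longleftrightarrow> (\<forall>m. absv (of_nat m :: 'k) < 1 \<longleftrightarrow> p dvd m)"


section \<open>The building\<close>

definition is_lattice :: "('k::nonarch_lc_field ^ 'n) set \<Rightarrow> bool"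
  where "is_lattice L \<longleftrightarrow> (\<exists>b :: 'n \<Rightarrow> 'k ^ 'n.
    (\<forall>a. (\<forall>i. a i \<in> integers) \<and> (\<Sum>i\<in>UNIV. a i *s b i) = 0 \<longrightarrow> (\<forall>i. a i = 0)) \<and>
    L = {(\<Sum>i\<in>UNIV. a i *s b i) | a. \<forall>i. a i \<in> integers})"

definition homothety_class :: "('k::nonarch_lc_field ^ 'n) set \<Rightarrow> ('k ^ 'n) set set"
  where "homothety_class L = {(\<lambda>v. c *s v) ` L | c. c \<noteq> 0}"

text \<open>\<open>simplices \<pi> k\<close> is the set of \<open>k\<close>-simplices; each simplex is the set of its vertices.\<close>

definition simplices ::
    "'k::nonarch_lc_field \<Rightarrow> nat \<Rightarrow> ('k ^ 'n) set set set set"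
  where "simplices \<pi> k = {(\<lambda>i. homothety_class (L i)) ` {..k} | L.
    (\<forall>i\<le>k. is_lattice (L i)) \<and> (\<lambda>v. \<pi> *s v) ` L k \<subset> L 0 \<and> (\<forall>i<k. L i \<subset> L (Suc i))}"

text \<open>
  A labelling of the vertices by types \<open>0, \<dots>, d\<close> (where \<open>CARD('n) = d + 1\<close>): distinct vertices of
  a simplex have distinct types. Up to a permutation of the types this is the map sending the
  vertex of \<open>g\<close> times the standard lattice to the valuation of \<open>det g\<close> modulo \<open>d + 1\<close>.
\<close>

definition labelling ::
    "'k::nonarch_lc_field \<Rightarrow> (('k ^ 'n) set set \<Rightarrow> nat) \<Rightarrow> bool"
  where "labelling \<pi> lab \<longleftrightarrow>
    (\<forall>k. \<forall>\<tau>\<in>simplices \<pi> k. inj_on lab \<tau> \<and> lab ` \<tau> \<subseteq> {..<CARD('n)})"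

text \<open>
  Incidence number of \<open>\<tau>'\<close> with its facet \<open>\<tau>\<close>: if the vertices of \<open>\<tau>'\<close>, ordered by label, are
  \<open>x\<^sub>0, \<dots>, x\<^sub>k\<close> and \<open>\<tau>\<close> arises by omitting \<open>x\<^sub>j\<close>, it is \<open>(-1)^j\<close>.
\<close>

definition incidence :: "('x \<Rightarrow> nat) \<Rightarrow> 'x set \<Rightarrow> 'x set \<Rightarrow> int"
  where "incidence lab \<tau>' \<tau> = (- 1) ^ card {y \<in> \<tau>'. lab y < lab (the_elem (\<tau>' - \<tau>))}"


section \<open>The groups\<close>

definition GL :: "('k::nonarch_lc_field ^ 'n ^ 'n) monoid"
  where "GL = \<lparr>carrier = {g. invertible g}, monoid.mult = (**), one = mat 1\<rparr>"

definition principal_congruence ::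
    "'k::nonarch_lc_field \<Rightarrow> nat \<Rightarrow> ('k ^ 'n ^ 'n) set"
  where "principal_congruence \<pi> n = {g. invertible g \<and>
    (\<forall>i j. g $ i $ j \<in> integers \<and> matrix_inv g $ i $ j \<in> integers) \<and>
    (\<forall>i j. \<exists>c\<in>integers. (g - mat 1) $ i $ j = \<pi> ^ n * c)}"

definition standard_lattice :: "('k::nonarch_lc_field ^ 'n) set"
  where "standard_lattice = {v. \<forall>i. v $ i \<in> integers}"

definition translate ::
    "'k::nonarch_lc_field ^ 'n ^ 'n \<Rightarrow> ('k ^ 'n) set set \<Rightarrow> ('k ^ 'n) set set"
  where "translate g x = (\<lambda>L. (\<lambda>v. g *v v) ` L) ` x"

text \<open>
  The conjugate of the congruence subgroup by \<open>g\<close> depends only on the vertex \<open>x\<close> that \<open>g\<close> carries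
  the standard vertex to; taking all such \<open>g\<close> at once avoids choosing one.
\<close>

definition vertex_group ::
    "'k::nonarch_lc_field \<Rightarrow> nat \<Rightarrow> ('k ^ 'n) set set \<Rightarrow> ('k ^ 'n ^ 'n) set"
  where "vertex_group \<pi> n x = {g ** u ** matrix_inv g | g u.
    invertible g \<and> x = translate g (homothety_class standard_lattice) \<and>
    u \<in> principal_congruence \<pi> n}"

definition simplex_group ::
    "'k::nonarch_lc_field \<Rightarrow> nat \<Rightarrow> ('k ^ 'n) set set set \<Rightarrow> ('k ^ 'n ^ 'n) set"
  where "simplex_group \<pi> n \<tau> = generate GL (\<Union>x\<in>\<tau>. vertex_group \<pi> n x)"


section \<open>Representations\<close>

definition Z_inv :: "nat \<Rightarrow> rat set"
  where "Z_inv p = {of_int a / of_nat p ^ k | a k. True}"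

text \<open>
  A module over the subring \<open>Z_inv p\<close> of the rationals; \<open>scl r\<close> is meaningless for other \<open>r\<close>.
\<close>

locale Z_inv_module =
  fixes p :: nat and scl :: "rat \<Rightarrow> 'v::ab_group_add \<Rightarrow> 'v"
  assumes scl_add_right: "r \<in> Z_inv p \<Longrightarrow> scl r (v + w) = scl r v + scl r w"
    and scl_add_left: "r \<in> Z_inv p \<Longrightarrow> s \<in> Z_inv p \<Longrightarrow> scl (r + s) v = scl r v + scl s v"
    and scl_scl: "r \<in> Z_inv p \<Longrightarrow> s \<in> Z_inv p \<Longrightarrow> scl r (scl s v) = scl (r * s) v"
    and scl_one: "scl 1 v = v"

locale smooth_representation = Z_inv_module p scl
  for p :: nat and scl :: "rat \<Rightarrow> 'v::ab_group_add \<Rightarrow> 'v" +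
  fixes \<rho> :: "'k::nonarch_lc_field ^ 'n ^ 'n \<Rightarrow> 'v \<Rightarrow> 'v"
  assumes rep_one: "\<rho> (mat 1) v = v"
    and rep_mult: "invertible g \<Longrightarrow> invertible h \<Longrightarrow> \<rho> (g ** h) v = \<rho> g (\<rho> h v)"
    and rep_add: "invertible g \<Longrightarrow> \<rho> g (v + w) = \<rho> g v + \<rho> g w"
    and rep_scl: "invertible g \<Longrightarrow> r \<in> Z_inv p \<Longrightarrow> \<rho> g (scl r v) = scl r (\<rho> g v)"
    and smooth: "openin (top_of_set {g. invertible g}) {g. invertible g \<and> \<rho> g v = v}"

definition fixed_vectors :: "('g \<Rightarrow> 'v \<Rightarrow> 'v) \<Rightarrow> 'g set \<Rightarrow> 'v set"
  where "fixed_vectors \<rho> H = {v. \<forall>g\<in>H. \<rho> g v = v}"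

definition subrepresentation ::
    "nat \<Rightarrow> (rat \<Rightarrow> 'v \<Rightarrow> 'v) \<Rightarrow>
     ('k::nonarch_lc_field ^ 'n ^ 'n \<Rightarrow> 'v \<Rightarrow> 'v::ab_group_add) \<Rightarrow> 'v set \<Rightarrow> bool"
  where "subrepresentation p scl \<rho> W \<longleftrightarrow>
    0 \<in> W \<and> (\<forall>v\<in>W. \<forall>w\<in>W. v + w \<in> W) \<and> (\<forall>r\<in>Z_inv p. \<forall>v\<in>W. scl r v \<in> W) \<and>
    (\<forall>g. invertible g \<longrightarrow> (\<forall>v\<in>W. \<rho> g v \<in> W))"

definition generated_by ::
    "nat \<Rightarrow> (rat \<Rightarrow> 'v \<Rightarrow> 'v) \<Rightarrow>
     ('k::nonarch_lc_field ^ 'n ^ 'n \<Rightarrow> 'v \<Rightarrow> 'v::ab_group_add) \<Rightarrow> 'v set \<Rightarrow> bool"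
  where "generated_by p scl \<rho> S \<longleftrightarrow> \<Inter>{W. subrepresentation p scl \<rho> W \<and> S \<subseteq> W} = UNIV"


section \<open>The chain complex\<close>

definition coeff_chains ::
    "'k::nonarch_lc_field \<Rightarrow> nat \<Rightarrow> ('k ^ 'n ^ 'n \<Rightarrow> 'v::ab_group_add \<Rightarrow> 'v) \<Rightarrow> nat \<Rightarrow>
     (('k ^ 'n) set set set \<Rightarrow> 'v) set"
  where "coeff_chains \<pi> n \<rho> k = {c. finite {\<tau>. c \<tau> \<noteq> 0} \<and>
    (\<forall>\<tau>\<in>simplices \<pi> k. c \<tau> \<in> fixed_vectors \<rho> (simplex_group \<pi> n \<tau>)) \<and>
    (\<forall>\<tau>. \<tau> \<notin> simplices \<pi> k \<longrightarrow> c \<tau> = 0)}"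

text \<open>
  \<open>boundary \<pi> lab scl k\<close> maps \<open>(k+1)\<close>-chains to \<open>k\<close>-chains. The sum is restricted to the support
  of \<open>c\<close> so that its index set is visibly finite; the transition maps are inclusions, hence
  invisible.
\<close>

definition boundary ::
    "'k::nonarch_lc_field \<Rightarrow> (('k ^ 'n) set set \<Rightarrow> nat) \<Rightarrow>
     (rat \<Rightarrow> 'v \<Rightarrow> 'v) \<Rightarrow> nat \<Rightarrow>
     (('k ^ 'n) set set set \<Rightarrow> 'v::ab_group_add) \<Rightarrow> ('k ^ 'n) set set set \<Rightarrow> 'v"
  where "boundary \<pi> lab scl k c \<tau> =
    (if \<tau> \<in> simplices \<pi> k
     then \<Sum>\<tau>' | \<tau>' \<in> simplices \<pi> (Suc k) \<and> \<tau> \<subseteq> \<tau>' \<and> c \<tau>' \<noteq> 0.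
            scl (of_int (incidence lab \<tau>' \<tau>)) (c \<tau>')
     else 0)"

definition augmentation ::
    "'k::nonarch_lc_field \<Rightarrow> (('k ^ 'n) set set set \<Rightarrow> 'v::ab_group_add) \<Rightarrow> 'v"
  where "augmentation \<pi> c = (\<Sum>\<tau> | \<tau> \<in> simplices \<pi> 0 \<and> c \<tau> \<noteq> 0. c \<tau>)"

end

theory Submission
  imports Defs "HOL-Algebra.Sylow" "HOL-Algebra.Multiplicative_Group"
begin

text \<open>
  For a lattice \<open>L\<close> let \<open>e\<^sub>L\<close> be the idempotent averaging over the congruence subgroup
  \<open>U\<^sub>L = {g. (g - 1) L \<subseteq> \<pi>^n L}\<close>, a pro-\<open>p\<close> group; its image is the coefficient group of the vertex
  \<open>[L]\<close>. Because \<open>n > 1\<close>, \<open>e\<^sub>L\<close> and \<open>e\<^sub>M\<close> commute if \<open>\<pi> L \<subseteq> M\<close> and \<open>\<pi> M \<subseteq> L\<close>. If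
  \<open>\<pi> M \<subseteq> L\<close> then \<open>U\<^bsub>L + M\<^esub> \<subseteq> U\<^sub>L U\<^sub>M\<close>, hence \<open>e\<^sub>L e\<^bsub>L + M\<^esub> e\<^sub>M = e\<^sub>L e\<^sub>M\<close>.

  Every vertex has a unique representative \<open>L\<close> contained in the standard lattice \<open>L\<^sub>0\<close> but not in
  \<open>\<pi> L\<^sub>0\<close>; order the vertices by inclusion of these representatives. A cycle is supported on a
  finite set of vertices closed under passing to larger vertices, and a minimal vertex \<open>[L]\<close> of
  this set can be removed from the support. Indeed its link in the set consists of the chains of
  lattices \<open>N\<close> with \<open>L \<subset> N \<subseteq> L\<^sub>0 \<inter> \<pi>\<^sup>-\<^sup>1 L\<close>, which are closed under sums, and the link complex with
  values in the image of \<open>e\<^sub>L\<close> is exact: decompose it by the commuting idempotents \<open>e\<^sub>N\<close>; as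
  \<open>e\<^sub>N e\<^bsub>N'\<^esub> = e\<^sub>N e\<^bsub>N'\<^esub> e\<^bsub>N + N'\<^esub>\<close>, each summand is the complex of a cone. In degree \<open>0\<close> one needs
  that \<open>e\<^sub>L e\<^sub>M\<close> factors through the link for every other vertex \<open>[M]\<close> of the set: scale \<open>M\<close> so that
  \<open>\<pi> M \<subseteq> L\<close> but \<open>M\<close> is not contained in \<open>L\<close>, and take \<open>N = L + M\<close>.
\<close>

section \<open>Augmented chain complexes over a finite vertex set\<close>

text \<open>Invertibility of \<open>p\<close> enters because the finite quotients of
  \<open>U\<^sub>L\<close> by deeper congruence subgroups have orders dividing powers of
  \<open>p\<close>, so that averages over them exist; smoothness makes these averages agree at all
  deep levels. The bound \<open>n > 1\<close> enters through adjacency: if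
  \<open>\<pi> L \<subseteq> M\<close> and \<open>\<pi> M \<subseteq> L\<close>, then for
  \<open>u\<close> in \<open>U\<^sub>M\<close> the map \<open>u - 1\<close> sends
  \<open>\<pi> L\<close> into \<open>\<pi>^n M\<close>, hence \<open>L\<close> into
  \<open>\<pi>^(n-1) M \<subseteq> \<pi>^(n-2) L\<close>. So \<open>U\<^sub>M\<close> stabilizes
  \<open>L\<close> and normalizes \<open>U\<^sub>L\<close>, which makes the idempotents commute. The
  obstacle is that the full link of a vertex is a spherical building with homology of its own.
  Normalized representatives break the symmetry: the neighbours of a minimal vertex are all
  represented by lattices larger than its own, and such lattices have joins. The empty set is
  treated as a simplex of dimension -1 with coefficients in the whole of V, so that augmentation and
  boundary become one operator and exactness in all degrees one statement.\<close>

definition signed :: "nat \<Rightarrow> 'v::ab_group_add \<Rightarrow> 'v"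
  where "signed k v = (if even k then v else - v)"

lemma signed_zero [simp]: "signed k 0 = 0"
  and signed_0 [simp]: "signed 0 v = v"
  and signed_Suc [simp]: "signed (Suc k) v = - signed k v"
  and signed_signed: "signed k (signed l v) = signed (k + l) v"
  and signed_self [simp]: "signed k (signed k v) = v"
  and signed_eq_0 [simp]: "signed k v = 0 \<longleftrightarrow> v = 0"
  and signed_add: "signed k (v + w) = signed k v + signed k w"
  and signed_minus: "signed k (- v) = - signed k v"
  and signed_diff: "signed k (v - w) = signed k v - signed k w"
  by (auto simp: signed_def)

lemma signed_sum: "signed k (sum f A) = (\<Sum>a\<in>A. signed k (f a))"
  by (simp add: signed_def sum_negf)

text \<open>The sign exponent for \<open>y\<close> outside \<open>\<tau>\<close>: the place that
  \<open>y\<close> takes among the vertices of \<open>insert y \<tau>\<close> ordered by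
  label.\<close>

definition label_pos :: "('x \<Rightarrow> nat) \<Rightarrow> 'x \<Rightarrow> 'x set \<Rightarrow> nat"
  where "label_pos lab y \<tau> = card {z \<in> \<tau>. lab z < lab y}"

lemma label_pos_empty [simp]: "label_pos lab y {} = 0"
  by (simp add: label_pos_def)

lemma label_pos_insert:
  assumes "finite \<tau>" "x \<notin> \<tau>"
  shows "label_pos lab y (insert x \<tau>) = (if lab x < lab y then Suc (label_pos lab y \<tau>) else label_pos lab y \<tau>)"
proof -
  have "{z \<in> insert x \<tau>. lab z < lab y}
      = (if lab x < lab y then insert x {z \<in> \<tau>. lab z < lab y} else {z \<in> \<tau>. lab z < lab y})"
    by auto
  then show ?thesis
    using assms by (simp add: label_pos_def)
qed

text \<open>Cofaces are indexed by the vertex \<open>y\<close> added to \<open>\<tau>\<close>, and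
  all dimensions are treated at once. At \<open>{}\<close> the value is the sum of the vertex
  coefficients, so the augmentation is the differential into dimension -1. The finite set
  \<open>T\<close> keeps the sum finite.\<close>

definition bd :: "('x \<Rightarrow> nat) \<Rightarrow> 'x set \<Rightarrow> ('x set \<Rightarrow> 'v::ab_group_add) \<Rightarrow> 'x set \<Rightarrow> 'v"
  where "bd lab T c \<tau> = (\<Sum>y\<in>T - \<tau>. signed (label_pos lab y \<tau>) (c (insert y \<tau>)))"

definition cone_over :: "('x \<Rightarrow> nat) \<Rightarrow> 'x \<Rightarrow> ('x set \<Rightarrow> 'v::ab_group_add) \<Rightarrow> 'x set \<Rightarrow> 'v"
  where "cone_over lab x b \<tau> = (if x \<in> \<tau> then signed (label_pos lab x (\<tau> - {x})) (b (\<tau> - {x})) else 0)"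

text \<open>Together with \<open>link_part\<close> this splits a chain along the star of
  \<open>x\<close>; the sign in \<open>link_part\<close> undoes that in
  \<open>cone_over\<close>.\<close>

definition avoiding :: "'x \<Rightarrow> ('x set \<Rightarrow> 'v::ab_group_add) \<Rightarrow> 'x set \<Rightarrow> 'v"
  where "avoiding x c \<tau> = (if x \<in> \<tau> then 0 else c \<tau>)"

definition link_part :: "('x \<Rightarrow> nat) \<Rightarrow> 'x \<Rightarrow> ('x set \<Rightarrow> 'v::ab_group_add) \<Rightarrow> 'x set \<Rightarrow> 'v"
  where "link_part lab x c \<rho> = (if x \<in> \<rho> then 0 else signed (label_pos lab x \<rho>) (c (insert x \<rho>)))"

lemma bd_add: "bd lab T (\<lambda>\<tau>. b \<tau> + c \<tau>) \<tau> = bd lab T b \<tau> + bd lab T c \<tau>"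
  by (simp add: bd_def signed_add sum.distrib)

lemma bd_diff: "bd lab T (\<lambda>\<tau>. b \<tau> - c \<tau>) \<tau> = bd lab T b \<tau> - bd lab T c \<tau>"
  by (simp add: bd_def signed_diff sum_subtractf)

lemma bd_0: "bd lab T (\<lambda>\<tau>. 0) \<tau> = 0"
  by (simp add: bd_def)

lemma cone_bd_0: "bd lab T b = (\<lambda>_. 0) \<Longrightarrow> cone_over lab x (bd lab T b) = (\<lambda>_. 0)"
  by (simp add: cone_over_def fun_eq_iff)

lemma avoiding_add_cone: "c \<tau> = avoiding x c \<tau> + cone_over lab x (link_part lab x c) \<tau>"
  by (auto simp: avoiding_def cone_over_def link_part_def insert_absorb)

text \<open>Removing the apex \<open>x\<close> returns \<open>b\<close>. Removing another vertex
  \<open>y\<close> commutes with coning up to one sign: \<open>x\<close> and \<open>y\<close> have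
  different labels, so exactly one of them precedes the other, and exactly one of the two positions
  involved grows by one.\<close>

lemma bd_cone:
  assumes "finite T" "x \<in> T"
    and "\<And>\<tau>. b \<tau> \<noteq> 0 \<Longrightarrow> x \<notin> \<tau> \<and> \<tau> \<subseteq> T \<and> inj_on lab (insert x \<tau>)"
  shows "bd lab T (cone_over lab x b) \<tau> = b \<tau> - cone_over lab x (bd lab T b) \<tau>"
proof (cases "x \<in> \<tau>")
  case False
  have "bd lab T (cone_over lab x b) \<tau>
      = (\<Sum>y\<in>T - \<tau>. if y = x then signed (label_pos lab x \<tau>) (cone_over lab x b (insert x \<tau>)) else 0)"
    unfolding bd_def by (rule sum.cong) (use False in \<open>auto simp: cone_over_def\<close>)
  also have "\<dots> = b \<tau>"
    using assms(1,2) False by (simp add: cone_over_def)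
  finally show ?thesis
    using False by (simp add: cone_over_def)
next
  case True
  define \<rho> where "\<rho> = \<tau> - {x}"
  have \<rho>: "\<tau> = insert x \<rho>" "x \<notin> \<rho>"
    using True by (auto simp: \<rho>_def)
  have b0: "b \<tau> = 0"
    using assms(3) True by blast
  have "bd lab T (cone_over lab x b) \<tau>
      = (\<Sum>y\<in>T - \<tau>. - signed (label_pos lab x \<rho>) (signed (label_pos lab y \<rho>) (b (insert y \<rho>))))"
    unfolding bd_def
  proof (rule sum.cong [OF refl])
    fix y assume y: "y \<in> T - \<tau>"
    show "signed (label_pos lab y \<tau>) (cone_over lab x b (insert y \<tau>))
        = - signed (label_pos lab x \<rho>) (signed (label_pos lab y \<rho>) (b (insert y \<rho>)))"
    proof (cases "b (insert y \<rho>) = 0")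
      case True
      have "insert y \<tau> - {x} = insert y \<rho>"
        using y \<rho> by auto
      then show ?thesis
        using True by (simp add: cone_over_def)
    next
      case False
      then have *: "insert y \<rho> \<subseteq> T" "inj_on lab (insert x (insert y \<rho>))"
        using assms(3) [OF False] by (blast, blast)
      have fin: "finite \<rho>"
        using finite_subset [OF *(1) assms(1)] by simp
      have yn: "y \<notin> \<rho>" "y \<noteq> x"
        using y \<rho> by auto
      then have "lab x \<noteq> lab y"
        using *(2) by (auto simp: inj_on_def)
      moreover have "insert y \<tau> - {x} = insert y \<rho>"
        using y \<rho> by auto
      ultimately show ?thesis
        using fin yn \<rho>
        by (auto simp: cone_over_def label_pos_insert signed_signed signed_minus add.commute)
    qed
  qed
  also have "\<dots> = - signed (label_pos lab x \<rho>) (\<Sum>y\<in>T - \<tau>. signed (label_pos lab y \<rho>) (b (insert y \<rho>)))"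
    by (simp add: signed_sum sum_negf)
  \<comment> \<open>The two index sets differ by \<open>x\<close> alone, and \<open>b\<close>
    vanishes on simplices containing \<open>x\<close>.\<close>
  also have "(\<Sum>y\<in>T - \<tau>. signed (label_pos lab y \<rho>) (b (insert y \<rho>))) = bd lab T b \<rho>"
    unfolding bd_def
  proof (rule sum.mono_neutral_left)
    have "b (insert x \<rho>) = 0"
      using assms(3) [of "insert x \<rho>"] by blast
    then show "\<forall>y\<in>T - \<rho> - (T - \<tau>). signed (label_pos lab y \<rho>) (b (insert y \<rho>)) = 0"
      using \<rho> by auto
  qed (use assms(1) \<rho> in auto)
  finally show ?thesis
    using True b0 by (simp add: cone_over_def [of lab x _ \<tau>] \<rho>_def)
qed

lemma bd_eq_0_if_supp:
  assumes "\<And>\<tau>. c \<tau> \<noteq> 0 \<Longrightarrow> \<tau> = {}"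
  shows "bd lab T c \<tau> = 0"
  unfolding bd_def by (rule sum.neutral) (use assms in auto)

text \<open>Vertices are split off instead of cancelling faces in pairs. For the cone over
  \<open>c1\<close>, two uses of \<open>bd_cone\<close> give the boundary of \<open>c1\<close> minus
  itself plus the cone over its double boundary, so only chains on fewer vertices remain.\<close>

lemma bd_bd:
  fixes c :: "'x set \<Rightarrow> 'v::ab_group_add"
  assumes "finite T" "\<And>\<tau>. c \<tau> \<noteq> 0 \<Longrightarrow> \<tau> \<subseteq> T \<and> inj_on lab \<tau>"
  shows "bd lab T (bd lab T c) \<tau> = 0"
proof -
  \<comment> \<open>\<open>S\<close> carries the chain and shrinks, while the summation range
    \<open>T\<close> of the differential stays fixed.\<close>
  have main: "\<forall>(c :: 'x set \<Rightarrow> 'v) \<tau>. (\<forall>\<tau>. c \<tau> \<noteq> 0 \<longrightarrow> \<tau> \<subseteq> S \<and> inj_on lab \<tau>) \<longrightarrow> bd lab T (bd lab T c) \<tau> = 0"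
    if "S \<subseteq> T" for S
    using finite_subset [OF that assms(1)] that
  proof (induction S rule: finite_induct)
    case empty
    show ?case
    proof (intro allI impI)
      fix c :: "'x set \<Rightarrow> 'v" and \<tau>
      assume c: "\<forall>\<tau>. c \<tau> \<noteq> 0 \<longrightarrow> \<tau> \<subseteq> {} \<and> inj_on lab \<tau>"
      have "bd lab T c \<sigma> = 0" for \<sigma>
        by (rule bd_eq_0_if_supp) (use c in blast)
      then have "bd lab T c = (\<lambda>_. 0)"
        by (rule ext)
      then show "bd lab T (bd lab T c) \<tau> = 0"
        by (simp only: bd_0)
    qed
  next
    case (insert x S)
    show ?case
    proof (intro allI impI)
      fix c :: "'x set \<Rightarrow> 'v" and \<tau>
      assume c: "\<forall>\<tau>. c \<tau> \<noteq> 0 \<longrightarrow> \<tau> \<subseteq> insert x S \<and> inj_on lab \<tau>"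
      define c0 where "c0 = avoiding x c"
      define c1 where "c1 = link_part lab x c"
      have c0: "\<forall>\<tau>. c0 \<tau> \<noteq> 0 \<longrightarrow> \<tau> \<subseteq> S \<and> inj_on lab \<tau>"
        using c by (auto simp: c0_def avoiding_def)
      have c1': "x \<notin> \<tau> \<and> \<tau> \<subseteq> S \<and> inj_on lab (insert x \<tau>)" if "c1 \<tau> \<noteq> 0" for \<tau>
      proof -
        have "x \<notin> \<tau>" "c (insert x \<tau>) \<noteq> 0"
          using that by (auto simp: c1_def link_part_def split: if_splits)
        then show ?thesis
          using c by blast
      qed
      then have c1: "\<forall>\<tau>. c1 \<tau> \<noteq> 0 \<longrightarrow> \<tau> \<subseteq> S \<and> inj_on lab \<tau>"
        using inj_on_subset [OF _ subset_insertI] by blast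
      have x: "x \<in> T" "S \<subseteq> T"
        using insert.prems by auto
      have c_eq: "c = (\<lambda>\<tau>. c0 \<tau> + cone_over lab x c1 \<tau>)"
        unfolding c0_def c1_def by (rule ext) (rule avoiding_add_cone)
      have bc1: "bd lab T (cone_over lab x c1) \<tau> = c1 \<tau> - cone_over lab x (bd lab T c1) \<tau>" for \<tau>
      proof (rule bd_cone [OF assms(1) x(1)])
        fix \<tau> assume "c1 \<tau> \<noteq> 0"
        from c1' [OF this] show "x \<notin> \<tau> \<and> \<tau> \<subseteq> T \<and> inj_on lab (insert x \<tau>)"
          using x(2) by blast
      qed
      have bbc1: "bd lab T (cone_over lab x (bd lab T c1)) \<tau>
          = bd lab T c1 \<tau> - cone_over lab x (bd lab T (bd lab T c1)) \<tau>" for \<tau>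
      proof (rule bd_cone [OF assms(1) x(1)])
        fix \<tau> assume "bd lab T c1 \<tau> \<noteq> 0"
        then obtain y where y: "y \<in> T - \<tau>" "c1 (insert y \<tau>) \<noteq> 0"
          unfolding bd_def by (elim sum.not_neutral_contains_not_neutral) auto
        show "x \<notin> \<tau> \<and> \<tau> \<subseteq> T \<and> inj_on lab (insert x \<tau>)"
          using c1' [OF y(2)] x inj_on_subset [of lab "insert x (insert y \<tau>)" "insert x \<tau>"]
          by blast
      qed
      have z0: "bd lab T (bd lab T c0) \<tau> = 0" for \<tau>
        using insert.IH x(2) c0 by blast
      have z1: "bd lab T (bd lab T c1) = (\<lambda>_. 0)"
        by (rule ext) (use insert.IH x(2) c1 in blast)
      have "bd lab T c = (\<lambda>\<tau>. bd lab T c0 \<tau> + (c1 \<tau> - cone_over lab x (bd lab T c1) \<tau>))"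
        by (subst c_eq) (simp add: bd_add bc1 fun_eq_iff)
      then have "bd lab T (bd lab T c) \<tau> = bd lab T (bd lab T c0) \<tau>
          + (bd lab T c1 \<tau> - bd lab T (cone_over lab x (bd lab T c1)) \<tau>)"
        by (simp add: bd_add bd_diff)
      also have "\<dots> = 0"
        using z0 by (simp add: bbc1 z1 cone_bd_0) (simp add: cone_over_def)
      finally show "bd lab T (bd lab T c) \<tau> = 0" .
    qed
  qed
  show ?thesis
  proof (rule main [OF subset_refl, THEN spec, THEN spec, THEN mp])
    show "\<forall>\<tau>. c \<tau> \<noteq> 0 \<longrightarrow> \<tau> \<subseteq> T \<and> inj_on lab \<tau>"
      by (intro allI impI) (rule assms(2))
  qed
qed

text \<open>Antisymmetry is demanded on \<open>A\<close> only, because the order used later compares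
  chosen lattice representatives and separates points only among vertices.\<close>

lemma finite_has_maximal_on:
  fixes le :: "'x \<Rightarrow> 'x \<Rightarrow> bool"
  assumes "finite A" "A \<noteq> {}"
    and trans: "\<And>x y z. le x y \<Longrightarrow> le y z \<Longrightarrow> le x z"
    and antisym: "\<And>x y. x \<in> A \<Longrightarrow> y \<in> A \<Longrightarrow> le x y \<Longrightarrow> le y x \<Longrightarrow> x = y"
  shows "\<exists>z\<in>A. \<forall>y\<in>A. le z y \<longrightarrow> y = z"
  using assms(1,2) antisym
proof (induction A rule: finite_ne_induct)
  case (singleton x)
  then show ?case
    by simp
next
  case (insert x A)
  obtain z where z: "z \<in> A" "\<forall>y\<in>A. le z y \<longrightarrow> y = z"
    using insert.IH insert.prems by (meson insertCI)
  show ?case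
  proof (cases "le z x")
    case True
    have "y = x" if "y \<in> insert x A" "le x y" for y
    proof (cases "y = x")
      case False
      then have "y = z"
        using z(2) trans [OF True that(2)] that(1) by blast
      then show ?thesis
        using insert.prems [of x y] True that by simp
    qed simp
    then show ?thesis
      by blast
  next
    case False
    then show ?thesis
      using z by blast
  qed
qed

text \<open>
  On a module with commuting idempotents \<open>e y\<close>, split off the part where \<open>e z = 1\<close> for a maximal
  \<open>z\<close>: there every nonzero coefficient sits below \<open>z\<close>, so coning with apex \<open>z\<close> is a contraction.
  On the complement \<open>z\<close> may be discarded.
\<close>

lemma link_acyclic:
  fixes e :: "'x \<Rightarrow> 'v::ab_group_add \<Rightarrow> 'v" and le :: "'x \<Rightarrow> 'x \<Rightarrow> bool"
  assumes T: "finite T" "P \<subseteq> T"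
    and le: "\<And>x. le x x" "\<And>x y z. le x y \<Longrightarrow> le y z \<Longrightarrow> le x z"
      "\<And>x y. x \<in> T \<Longrightarrow> y \<in> T \<Longrightarrow> le x y \<Longrightarrow> le y x \<Longrightarrow> x = y"
    and inj: "\<And>\<tau>. \<tau> \<subseteq> P \<Longrightarrow> (\<forall>x\<in>\<tau>. \<forall>y\<in>\<tau>. le x y \<or> le y x) \<Longrightarrow> inj_on lab \<tau>"
    and e_add: "\<And>y v w. e y (v + w) = e y v + e y w"
    and W: "0 \<in> W" "\<And>v w. v \<in> W \<Longrightarrow> w \<in> W \<Longrightarrow> v - w \<in> W"
    and e_W: "\<And>y w. y \<in> P \<Longrightarrow> w \<in> W \<Longrightarrow> e y w \<in> W"
    and e_idem: "\<And>y w. y \<in> P \<Longrightarrow> w \<in> W \<Longrightarrow> e y (e y w) = e y w"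
    and e_comm: "\<And>y y' w. y \<in> P \<Longrightarrow> y' \<in> P \<Longrightarrow> w \<in> W \<Longrightarrow> e y (e y' w) = e y' (e y w)"
    and join: "\<And>y y'. y \<in> P \<Longrightarrow> y' \<in> P \<Longrightarrow> (\<forall>w\<in>W. e y (e y' w) = 0) \<or>
      (\<exists>z\<in>P. le y z \<and> le y' z \<and> (\<forall>w\<in>W. e z (e y (e y' w)) = e y (e y' w)))"
    and c: "\<And>\<tau>. c \<tau> \<in> W" "\<And>\<tau> y. y \<in> \<tau> \<Longrightarrow> e y (c \<tau>) = c \<tau>"
      "\<And>\<tau>. c \<tau> \<noteq> 0 \<Longrightarrow> \<tau> \<subseteq> P \<and> (\<forall>x\<in>\<tau>. \<forall>y\<in>\<tau>. le x y \<or> le y x)"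
      "c {} = 0" "bd lab T c = (\<lambda>_. 0)"
  shows "\<exists>b. (\<forall>\<tau>. b \<tau> \<in> W) \<and> (\<forall>\<tau>. \<forall>y\<in>\<tau>. e y (b \<tau>) = b \<tau>) \<and>
    (\<forall>\<tau>. b \<tau> \<noteq> 0 \<longrightarrow> \<tau> \<subseteq> P \<and> (\<forall>x\<in>\<tau>. \<forall>y\<in>\<tau>. le x y \<or> le y x)) \<and>
    b {} = 0 \<and> bd lab T b = c"
  using T(2) inj W e_W e_idem e_comm join c
proof (induction "card P" arbitrary: P W c rule: less_induct)
  case less
  note PT = less.prems(1) and inj = less.prems(2) and W = less.prems(3,4) and e_W = less.prems(5)
    and e_idem = less.prems(6) and e_comm = less.prems(7) and join = less.prems(8)
    and c = less.prems(9-13)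
  let ?ch = "\<lambda>\<tau>. \<forall>x\<in>\<tau>. \<forall>y\<in>\<tau>. le x y \<or> le y x"
  have e0: "e y 0 = 0" for y
    using e_add [of y 0 0] by simp
  have e_diff: "e y (v - w) = e y v - e y w" for y v w
    using e_add [of y "v - w" w] by (simp add: algebra_simps)
  have e_minus: "e y (- v) = - e y v" for y v
    using e_diff [of y 0 v] by (simp add: e0)
  have e_signed: "e y (signed k v) = signed k (e y v)" for y k v
    by (simp add: signed_def e_minus)
  have W_minus: "- v \<in> W" if "v \<in> W" for v
    using W(2) [OF W(1) that] by simp
  have W_add: "v + w \<in> W" if "v \<in> W" "w \<in> W" for v w
    using W(2) [OF that(1) W_minus [OF that(2)]] by simp
  have W_signed: "signed k v \<in> W" if "v \<in> W" for k v
    using that W_minus by (simp add: signed_def)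
  have finP: "finite P"
    using PT T(1) finite_subset by blast
  show ?case
  proof (cases "P = {}")
    case True
    have "c \<tau> = 0" for \<tau>
      using c(3) [of \<tau>] c(4) True by (cases "c \<tau> = 0") auto
    then have "bd lab T (\<lambda>_. 0) = c"
      by (simp add: bd_0 fun_eq_iff)
    then show ?thesis
      using W(1) e0 by (intro exI [of _ "\<lambda>_. 0"]) auto
  next
    case False
    have "x = y" if "x \<in> P" "y \<in> P" "le x y" "le y x" for x y
      using le(3) [OF _ _ that(3,4)] that(1,2) PT by blast
    then obtain z where z: "z \<in> P" "\<And>y. y \<in> P \<Longrightarrow> le z y \<Longrightarrow> y = z"
      using finite_has_maximal_on [OF finP False, of le] le(2) by metis
    have zT: "z \<in> T"
      using z(1) PT by blast
    define cz where "cz = (\<lambda>\<tau>. e z (c \<tau>))"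
    define c' where "c' = (\<lambda>\<tau>. c \<tau> - e z (c \<tau>))"
    \<comment> \<open>By \<open>join\<close>, \<open>y\<close> and \<open>z\<close> have a common
      upper bound in \<open>P\<close>, unless \<open>e z (e y w)\<close> vanishes on all of
      \<open>W\<close>; maximality forces that bound to be \<open>z\<close>.\<close>
    have below: "le y z" if "y \<in> \<tau>" "cz \<tau> \<noteq> 0" for \<tau> y
    proof -
      have "c \<tau> \<noteq> 0"
        using that(2) e0 by (auto simp: cz_def)
      then have y: "y \<in> P"
        using c(3) that(1) by blast
      have ne: "e z (e y (c \<tau>)) \<noteq> 0"
        using that c(2) by (simp add: cz_def)
      then show ?thesis
        using join [OF z(1) y] c(1) z(2) by metis
    qed
    have chz: "insert z \<tau> \<subseteq> P \<and> ?ch (insert z \<tau>)" if "cz \<tau> \<noteq> 0" for \<tau>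
    proof -
      have "c \<tau> \<noteq> 0"
        using that e0 by (auto simp: cz_def)
      then show ?thesis
        using c(3) z(1) below [OF _ that] le(1) by blast
    qed
    have bdcz: "bd lab T cz \<tau> = 0" for \<tau>
    proof -
      have "bd lab T cz \<tau> = e z (bd lab T c \<tau>)"
      proof -
        have e_sum: "e z (sum f A) = (\<Sum>a\<in>A. e z (f a))" if "finite A" for f and A :: "'x set"
          using that by (induction A rule: finite_induct) (auto simp: e0 e_add)
        show ?thesis
          using T(1) by (simp add: bd_def cz_def e_sum e_signed)
      qed
      then show ?thesis
        using c(5) by (simp add: e0)
    qed
    \<comment> \<open>A cycle whose simplices all lie below \<open>z\<close> is filled by the cone
      over its part away from \<open>z\<close>.\<close>
    define b0 where "b0 = cone_over lab z (avoiding z cz)"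
    have offz: "z \<notin> \<tau> \<and> \<tau> \<subseteq> T \<and> inj_on lab (insert z \<tau>)" if "avoiding z cz \<tau> \<noteq> 0" for \<tau>
    proof -
      have "z \<notin> \<tau>" "cz \<tau> \<noteq> 0"
        using that by (auto simp: avoiding_def split: if_splits)
      then show ?thesis
        using chz inj PT by (meson insert_subset subset_trans)
    qed
    have linkz: "z \<notin> \<tau> \<and> \<tau> \<subseteq> T \<and> inj_on lab (insert z \<tau>)" if "link_part lab z cz \<tau> \<noteq> 0" for \<tau>
    proof -
      have "z \<notin> \<tau>" "cz (insert z \<tau>) \<noteq> 0"
        using that by (auto simp: link_part_def split: if_splits)
      then show ?thesis
        using chz [of "insert z \<tau>"] inj PT by (metis insert_absorb2 insert_subset subset_trans)
    qed
    have bd_b0: "bd lab T b0 = cz"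
    proof
      fix \<tau>
      have "bd lab T b0 \<tau> = avoiding z cz \<tau> - cone_over lab z (bd lab T (avoiding z cz)) \<tau>"
        unfolding b0_def by (rule bd_cone [OF T(1) zT]) (use offz in auto)
      \<comment> \<open>Away from \<open>z\<close>, the vanishing boundary of \<open>cz\<close> says
        that the boundary of the avoiding part is minus the link part.\<close>
      also have "cone_over lab z (bd lab T (avoiding z cz)) \<tau> = - cone_over lab z (link_part lab z cz) \<tau>"
      proof (cases "z \<in> \<tau>")
        case True
        define \<rho> where "\<rho> = \<tau> - {z}"
        have "cz = (\<lambda>\<tau>. avoiding z cz \<tau> + cone_over lab z (link_part lab z cz) \<tau>)"
          by (rule ext) (rule avoiding_add_cone)
        then have "0 = bd lab T (avoiding z cz) \<rho> + bd lab T (cone_over lab z (link_part lab z cz)) \<rho>"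
          using bdcz by (metis bd_add)
        also have "bd lab T (cone_over lab z (link_part lab z cz)) \<rho> = link_part lab z cz \<rho>"
          by (subst bd_cone [OF T(1) zT]) (use linkz in \<open>auto simp: cone_over_def \<rho>_def\<close>)
        finally have "bd lab T (avoiding z cz) \<rho> = - link_part lab z cz \<rho>"
          by (simp add: eq_neg_iff_add_eq_0)
        then show ?thesis
          using True by (simp add: cone_over_def \<rho>_def signed_minus)
      qed (simp add: cone_over_def)
      finally show "bd lab T b0 \<tau> = cz \<tau>"
        using avoiding_add_cone [of cz \<tau>] by simp
    qed
    have b0: "b0 \<tau> \<in> W" "y \<in> \<tau> \<Longrightarrow> e y (b0 \<tau>) = b0 \<tau>" "b0 \<tau> \<noteq> 0 \<Longrightarrow> \<tau> \<subseteq> P \<and> ?ch \<tau>" "b0 {} = 0"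
      for \<tau> y
    proof -
      show "b0 \<tau> \<in> W"
        using W(1) W_signed c(1) e_W [OF z(1)] by (auto simp: b0_def cone_over_def avoiding_def cz_def)
      show "b0 \<tau> \<noteq> 0 \<Longrightarrow> \<tau> \<subseteq> P \<and> ?ch \<tau>"
        using chz [of "\<tau> - {z}"]
        by (auto simp: b0_def cone_over_def avoiding_def insert_absorb split: if_splits)
      show "b0 {} = 0"
        by (simp add: b0_def cone_over_def)
      show "e y (b0 \<tau>) = b0 \<tau>" if "y \<in> \<tau>"
      proof (cases "b0 \<tau> = 0")
        case False
        then have "\<tau> \<subseteq> P" and zt: "z \<in> \<tau>"
          using \<open>b0 \<tau> \<noteq> 0 \<Longrightarrow> \<tau> \<subseteq> P \<and> ?ch \<tau>\<close> by (auto simp: b0_def cone_over_def split: if_splits)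
        then have y: "y \<in> P"
          using that by blast
        have "e y (e z (c (\<tau> - {z}))) = e z (c (\<tau> - {z}))"
        proof (cases "y = z")
          case True
          then show ?thesis
            using e_idem z(1) c(1) by simp
        next
          case False
          then show ?thesis
            using that c(2) [of y "\<tau> - {z}"] e_comm [OF y z(1) c(1)] by simp
        qed
        then show ?thesis
          using zt by (simp add: b0_def cone_over_def avoiding_def cz_def e_signed)
      qed (simp add: e0)
    qed
    define W' where "W' = {w \<in> W. e z w = 0}"
    have "card (P - {z}) < card P"
      using finP z(1) by (rule card_Diff1_less)
    moreover have "P - {z} \<subseteq> T"
      using PT by blast
    moreover have "inj_on lab \<tau>" if "\<tau> \<subseteq> P - {z}" "?ch \<tau>" for \<tau>
      using inj that by blast
    moreover have "0 \<in> W'" "\<And>v w. v \<in> W' \<Longrightarrow> w \<in> W' \<Longrightarrow> v - w \<in> W'"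
      using W by (auto simp: W'_def e0 e_diff)
    moreover have "e y w \<in> W'" "e y (e y w) = e y w" if "y \<in> P - {z}" "w \<in> W'" for y w
      using that e_W e_idem e_comm [of z y w] z(1) e0 by (auto simp: W'_def)
    moreover have "e y (e y' w) = e y' (e y w)" if "y \<in> P - {z}" "y' \<in> P - {z}" "w \<in> W'" for y y' w
      using that e_comm by (auto simp: W'_def)
    moreover have "(\<forall>w\<in>W'. e y (e y' w) = 0) \<or>
        (\<exists>u\<in>P - {z}. le y u \<and> le y' u \<and> (\<forall>w\<in>W'. e u (e y (e y' w)) = e y (e y' w)))"
      if y: "y \<in> P - {z}" "y' \<in> P - {z}" for y y'
    proof -
      consider "\<forall>w\<in>W. e y (e y' w) = 0" | u where "u \<in> P" "le y u" "le y' u"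
        "\<forall>w\<in>W. e u (e y (e y' w)) = e y (e y' w)"
        using join [of y y'] y by blast
      then show ?thesis
      proof cases
        case 1
        then show ?thesis
          by (auto simp: W'_def)
      next
        case (2 u)
        show ?thesis
        proof (cases "u = z")
          case True
          \<comment> \<open>\<open>e z\<close> fixes the product, and moved to the right it kills
            \<open>w\<close>. This case is the reason for the first alternative in
            \<open>join\<close>.\<close>
          have "e y (e y' w) = 0" if "w \<in> W'" for w
          proof -
            have w: "w \<in> W" "e z w = 0"
              using that by (auto simp: W'_def)
            have "e y (e y' w) = e z (e y (e y' w))"
              using 2(4) w True by auto
            also have "\<dots> = e y (e y' (e z w))"
              using e_comm e_W y z(1) w(1) by (metis DiffD1)
            finally show ?thesis
              by (simp add: w e0)
          qed
          then show ?thesis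
            by blast
        next
          case False
          then show ?thesis
            using 2 by (auto simp: W'_def)
        qed
      qed
    qed
    moreover have "c' \<tau> \<in> W'" for \<tau>
      using c(1) e_W [OF z(1)] W(2) e_idem [OF z(1)] by (auto simp: W'_def c'_def e_diff)
    moreover have "c' \<tau> \<noteq> 0 \<Longrightarrow> \<tau> \<subseteq> P - {z} \<and> ?ch \<tau>" for \<tau>
    proof -
      assume ne: "c' \<tau> \<noteq> 0"
      then have "c \<tau> \<noteq> 0" "z \<notin> \<tau>"
        using c(2) e0 by (auto simp: c'_def)
      then show ?thesis
        using c(3) by blast
    qed
    moreover have "e y (c' \<tau>) = c' \<tau>" if "y \<in> \<tau>" for \<tau> y
    proof (cases "c \<tau> = 0")
      case False
      then have "y \<in> P"
        using c(3) that by blast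
      then show ?thesis
        using that e_comm [of y z "c \<tau>"] c(1,2) z(1) by (simp add: c'_def e_diff)
    qed (simp add: c'_def e0)
    moreover have "c' {} = 0"
      by (simp add: c'_def c(4) e0)
    moreover have "bd lab T c' = (\<lambda>_. 0)"
    proof -
      have "bd lab T c' = (\<lambda>\<tau>. bd lab T c \<tau> - bd lab T cz \<tau>)"
        unfolding c'_def cz_def by (rule ext) (rule bd_diff)
      then show ?thesis
        using c(5) bdcz by simp
    qed
    ultimately obtain b' where b': "\<forall>\<tau>. b' \<tau> \<in> W'" "\<forall>\<tau>. \<forall>y\<in>\<tau>. e y (b' \<tau>) = b' \<tau>"
      "\<forall>\<tau>. b' \<tau> \<noteq> 0 \<longrightarrow> \<tau> \<subseteq> P - {z} \<and> ?ch \<tau>" "b' {} = 0" "bd lab T b' = c'"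
      using less.hyps [of "P - {z}" W' c'] by blast
    show ?thesis
    proof (intro exI [of _ "\<lambda>\<tau>. b0 \<tau> + b' \<tau>"] conjI)
      show "\<forall>\<tau>. b0 \<tau> + b' \<tau> \<in> W"
        using b0(1) b'(1) W_add by (simp add: W'_def)
      show "\<forall>\<tau>. \<forall>y\<in>\<tau>. e y (b0 \<tau> + b' \<tau>) = b0 \<tau> + b' \<tau>"
        using b0(2) b'(2) by (simp add: e_add)
      show "\<forall>\<tau>. b0 \<tau> + b' \<tau> \<noteq> 0 \<longrightarrow> \<tau> \<subseteq> P \<and> ?ch \<tau>"
      proof (intro allI impI)
        fix \<tau> assume "b0 \<tau> + b' \<tau> \<noteq> 0"
        then have "b0 \<tau> \<noteq> 0 \<or> b' \<tau> \<noteq> 0"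
          by auto
        then show "\<tau> \<subseteq> P \<and> ?ch \<tau>"
        proof
          assume "b0 \<tau> \<noteq> 0"
          then show ?thesis
            by (rule b0(3))
        next
          assume "b' \<tau> \<noteq> 0"
          then show ?thesis
            using b'(3) by blast
        qed
      qed
      show "b0 {} + b' {} = 0"
        using b0(4) b'(4) by simp
      show "bd lab T (\<lambda>\<tau>. b0 \<tau> + b' \<tau>) = c"
        by (rule ext) (simp add: bd_add bd_b0 b'(5), simp add: cz_def c'_def)
    qed
  qed
qed

text \<open>What the induction uses of the building. \<open>spx_up\<close>, \<open>spx_chain\<close>
  and \<open>up_spx\<close> say that, seen from a vertex minimal in its simplices, the link is the
  order complex of \<open>up x\<close>. \<open>e_join\<close> serves the higher degrees,
  \<open>e_between\<close> the degree in which the link meets the augmentation. Commutation is asked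
  only around one vertex, where the lattices are adjacent.\<close>

locale idempotent_complex =
  fixes lab :: "'x \<Rightarrow> nat" and T :: "'x set" and le :: "'x \<Rightarrow> 'x \<Rightarrow> bool"
    and up :: "'x \<Rightarrow> 'x set" and spx :: "'x set \<Rightarrow> bool"
    and e :: "'x \<Rightarrow> 'v::ab_group_add \<Rightarrow> 'v"
  assumes finite_T: "finite T"
    and le_refl: "le x x"
    and le_trans: "le x y \<Longrightarrow> le y z \<Longrightarrow> le x z"
    and le_antisym: "x \<in> T \<Longrightarrow> y \<in> T \<Longrightarrow> le x y \<Longrightarrow> le y x \<Longrightarrow> x = y"
    and spx_subset: "spx \<sigma> \<Longrightarrow> \<tau> \<subseteq> \<sigma> \<Longrightarrow> \<tau> \<noteq> {} \<Longrightarrow> spx \<tau>"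
    and spx_inj: "spx \<sigma> \<Longrightarrow> inj_on lab \<sigma>"
    and up_T: "x \<in> T \<Longrightarrow> up x \<subseteq> T"
    and up_le: "x \<in> T \<Longrightarrow> y \<in> up x \<Longrightarrow> le x y \<and> y \<noteq> x"
    and spx_up: "spx \<sigma> \<Longrightarrow> \<sigma> \<subseteq> T \<Longrightarrow> x \<in> \<sigma> \<Longrightarrow> \<forall>y\<in>\<sigma>. le y x \<longrightarrow> y = x \<Longrightarrow> \<sigma> - {x} \<subseteq> up x"
    and spx_chain: "spx \<sigma> \<Longrightarrow> \<sigma> \<subseteq> T \<Longrightarrow> x \<in> \<sigma> \<Longrightarrow> \<forall>y\<in>\<sigma>. le y x \<longrightarrow> y = x \<Longrightarrow>
      \<forall>y\<in>\<sigma> - {x}. \<forall>z\<in>\<sigma> - {x}. le y z \<or> le z y"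
    and up_spx: "x \<in> T \<Longrightarrow> \<rho> \<subseteq> up x \<Longrightarrow> \<forall>y\<in>\<rho>. \<forall>z\<in>\<rho>. le y z \<or> le z y \<Longrightarrow> spx (insert x \<rho>)"
    and e_add: "e y (v + w) = e y v + e y w"
    and e_idem: "e y (e y v) = e y v"
    and e_comm_up: "x \<in> T \<Longrightarrow> y \<in> insert x (up x) \<Longrightarrow> z \<in> insert x (up x) \<Longrightarrow>
      e y (e z v) = e z (e y v)"
    and e_between: "x \<in> T \<Longrightarrow> y \<in> T \<Longrightarrow> \<not> le y x \<Longrightarrow> \<exists>z\<in>up x. \<forall>v. e x (e y v) = e x (e z (e y v))"
    and e_join: "x \<in> T \<Longrightarrow> y \<in> up x \<Longrightarrow> y' \<in> up x \<Longrightarrow>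
      \<exists>z\<in>up x. le y z \<and> le y' z \<and> (\<forall>v. e z (e y (e y' v)) = e y (e y' v))"
begin

text \<open>Chains of mixed dimension. As \<open>c {} = 0\<close> keeps out dimension -1, the cycle
  condition at \<open>{}\<close> says that the vertex coefficients sum to zero.\<close>

definition chains_on :: "'x set \<Rightarrow> ('x set \<Rightarrow> 'v) \<Rightarrow> bool"
  where "chains_on U c \<longleftrightarrow> c {} = 0 \<and> (\<forall>\<sigma>. c \<sigma> \<noteq> 0 \<longrightarrow> \<sigma> \<subseteq> U \<and> spx \<sigma>) \<and>
    (\<forall>\<sigma>. \<forall>y\<in>\<sigma>. e y (c \<sigma>) = c \<sigma>)"

lemma e_0: "e y 0 = 0"
  using e_add [of y 0 0] by simp

lemma e_minus: "e y (- v) = - e y v"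
proof -
  have "e y (- v) + e y v = e y (- v + v)"
    by (simp only: e_add)
  then show ?thesis
    by (simp add: e_0 eq_neg_iff_add_eq_0)
qed

lemma e_diff: "e y (v - w) = e y v - e y w"
  using e_add [of y v "- w"] by (simp add: e_minus)

lemma e_signed: "e y (signed k v) = signed k (e y v)"
  by (simp add: signed_def e_minus)

lemma e_sum: "e y (sum f A) = (\<Sum>a\<in>A. e y (f a))"
  by (induction A rule: infinite_finite_induct) (simp_all add: e_0 e_add)

text \<open>
  Vertices are removed one at a time, smallest first. A cycle near the vertex \<open>x\<close> to be removed is
  a cycle in the link \<open>up x\<close> with coefficients in the image of \<open>e x\<close>; \<open>e_between\<close> bounds it in
  the lowest degree, \<open>link_acyclic\<close> in the others.
\<close>

theorem acyclic:
  assumes "U \<subseteq> T" "\<And>x. x \<in> U \<Longrightarrow> up x \<subseteq> U" "chains_on U c" "bd lab T c = (\<lambda>_. 0)"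
  shows "\<exists>b. chains_on U b \<and> bd lab T b = c"
  using assms
proof (induction "card U" arbitrary: U c rule: less_induct)
  case less
  note UT = less.prems(1) and up_U = less.prems(2) and chc = less.prems(3) and bdc = less.prems(4)
  have c: "c {} = 0" "\<And>\<sigma>. c \<sigma> \<noteq> 0 \<Longrightarrow> \<sigma> \<subseteq> U \<and> spx \<sigma>" "\<And>\<sigma> y. y \<in> \<sigma> \<Longrightarrow> e y (c \<sigma>) = c \<sigma>"
    using chc by (auto simp: chains_on_def)
  let ?ch = "\<lambda>\<tau>. \<forall>x\<in>\<tau>. \<forall>y\<in>\<tau>. le x y \<or> le y x"
  have finU: "finite U"
    using UT finite_T by (rule finite_subset)
  show ?case
  proof (cases "U = {}")
    case True
    have "c \<sigma> = 0" for \<sigma>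
      using c(1) c(2) [of \<sigma>] True by (cases "c \<sigma> = 0") auto
    then have "bd lab T (\<lambda>_. 0) = c"
      by (simp add: bd_0 fun_eq_iff)
    moreover have "chains_on U (\<lambda>_. 0)"
      by (simp add: chains_on_def e_0)
    ultimately show ?thesis
      by blast
  next
    case False
    have "x = y" if "x \<in> U" "y \<in> U" "le y x" "le x y" for x y
      using le_antisym [OF _ _ that(4,3)] that(1,2) UT by blast
    then obtain x where x: "x \<in> U" "\<And>y. y \<in> U \<Longrightarrow> le y x \<Longrightarrow> y = x"
      using finite_has_maximal_on [OF finU False, of "\<lambda>x y. le y x"] le_trans by metis
    have xT: "x \<in> T"
      using x(1) UT by blast
    define P where "P = up x"
    have PU: "P \<subseteq> U - {x}"
      using up_U [OF x(1)] up_le [OF xT] by (auto simp: P_def)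
    have PT: "P \<subseteq> T" "x \<notin> P"
      using PU UT by auto
    have e_P: "e y (e z v) = e z (e y v)" if "y \<in> insert x P" "z \<in> insert x P" for y z v
      using e_comm_up [OF xT] that by (simp add: P_def)
    have spxP: "spx (insert x \<rho>)" if "\<rho> \<subseteq> P" "?ch \<rho>" for \<rho>
      using up_spx [OF xT] that by (simp add: P_def)
    define c0 where "c0 = avoiding x c"
    define c1 where "c1 = link_part lab x c"
    have c_eq: "c \<tau> = c0 \<tau> + cone_over lab x c1 \<tau>" for \<tau>
      unfolding c0_def c1_def by (rule avoiding_add_cone)
    have c0: "c0 {} = 0" "\<And>\<sigma>. c0 \<sigma> \<noteq> 0 \<Longrightarrow> x \<notin> \<sigma> \<and> \<sigma> \<subseteq> U \<and> spx \<sigma>"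
        "\<And>\<sigma> y. y \<in> \<sigma> \<Longrightarrow> e y (c0 \<sigma>) = c0 \<sigma>"
      using c by (auto simp: c0_def avoiding_def e_0 split: if_splits)
    have c1: "x \<notin> \<rho> \<and> \<rho> \<subseteq> P \<and> ?ch \<rho> \<and> \<rho> \<subseteq> T \<and> inj_on lab (insert x \<rho>)" if "c1 \<rho> \<noteq> 0" for \<rho>
    proof -
      have xr: "x \<notin> \<rho>" "c (insert x \<rho>) \<noteq> 0"
        using that by (auto simp: c1_def link_part_def split: if_splits)
      have s: "spx (insert x \<rho>)" "insert x \<rho> \<subseteq> U"
        using c(2) [OF xr(2)] by auto
      have s': "insert x \<rho> \<subseteq> T"
        using s(2) UT by (rule order_trans)
      have m: "\<forall>y\<in>insert x \<rho>. le y x \<longrightarrow> y = x"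
        using x(2) s(2) by blast
      have "insert x \<rho> - {x} = \<rho>"
        using xr by simp
      then have "\<rho> \<subseteq> P" "?ch \<rho>"
        using spx_up [OF s(1) s' insertI1 m] spx_chain [OF s(1) s' insertI1 m]
        by (simp_all only: P_def simp_thms)
      then show ?thesis
        using xr s' spx_inj [OF s(1)] by simp
    qed
    have c1_fix: "e y (c1 \<rho>) = c1 \<rho>" if "y \<in> insert x \<rho>" for y \<rho>
      using c(3) [of y "insert x \<rho>"] that by (simp add: c1_def link_part_def e_signed e_0)
    have bd_c: "bd lab T c \<tau> = bd lab T c0 \<tau> + (c1 \<tau> - cone_over lab x (bd lab T c1) \<tau>)" for \<tau>
    proof -
      have "bd lab T c \<tau> = bd lab T (\<lambda>\<tau>. c0 \<tau> + cone_over lab x c1 \<tau>) \<tau>"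
        using c_eq by presburger
      also have "\<dots> = bd lab T c0 \<tau> + bd lab T (cone_over lab x c1) \<tau>"
        by (rule bd_add)
      also have "bd lab T (cone_over lab x c1) \<tau> = c1 \<tau> - cone_over lab x (bd lab T c1) \<tau>"
        by (rule bd_cone [OF finite_T xT]) (drule c1, blast)
      finally show ?thesis .
    qed
    have c0_x: "c0 \<tau> = 0" if "x \<in> \<tau>" for \<tau>
      using that by (simp add: c0_def avoiding_def)
    have c1_x: "c1 \<tau> = 0" if "x \<in> \<tau>" for \<tau>
      using that by (simp add: c1_def link_part_def)
    \<comment> \<open>At a simplex containing \<open>x\<close>, \<open>c1\<close> and the boundary
      of \<open>c0\<close> vanish, so the cycle condition leaves only the cone over the boundary of
      \<open>c1\<close>.\<close>
    have bd_c1: "bd lab T c1 \<rho> = 0" for \<rho>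
    proof (cases "x \<in> \<rho>")
      case True
      then show ?thesis
        by (simp add: bd_def c1_x)
    next
      case False
      have "bd lab T c0 (insert x \<rho>) = 0"
        by (simp add: bd_def c0_x)
      then have "cone_over lab x (bd lab T c1) (insert x \<rho>) = 0"
        using bd_c [of "insert x \<rho>"] bdc by (simp add: c1_x)
      then show ?thesis
        using False by (simp add: cone_over_def)
    qed
    \<comment> \<open>\<open>c1 {}\<close> is the coefficient of \<open>c\<close> at the vertex
      \<open>x\<close>; the vanishing of the augmentation expresses it by the other
      vertices.\<close>
    have "c1 {} = - bd lab T c0 {}"
      using bd_c [of "{}"] bdc by (simp add: cone_over_def eq_neg_iff_add_eq_0 add.commute)
    also have "\<dots> = - (\<Sum>y\<in>U - {x}. c {y})"
    proof -
      have "bd lab T c0 {} = (\<Sum>y\<in>T. c0 {y})"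
        by (simp add: bd_def)
      also have "\<dots> = (\<Sum>y\<in>U - {x}. c0 {y})"
        by (rule sum.mono_neutral_right) (use finite_T UT c0(2) in auto)
      also have "\<dots> = (\<Sum>y\<in>U - {x}. c {y})"
        by (rule sum.cong) (auto simp: c0_def avoiding_def)
      finally show ?thesis
        by simp
    qed
    finally have c1_empty: "c1 {} = - (\<Sum>y\<in>U - {x}. c {y})" .
    have "\<forall>y\<in>U - {x}. \<exists>z\<in>P. \<forall>v. e x (e y v) = e x (e z (e y v))"
    proof
      fix y assume y: "y \<in> U - {x}"
      then have "\<not> le y x" "y \<in> T"
        using x(2) UT by auto
      then show "\<exists>z\<in>P. \<forall>v. e x (e y v) = e x (e z (e y v))"
        using e_between [OF xT] by (simp add: P_def)
    qed
    then obtain z where z: "\<And>y. y \<in> U - {x} \<Longrightarrow> z y \<in> P"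
        "\<And>y v. y \<in> U - {x} \<Longrightarrow> e x (e y v) = e x (e (z y) (e y v))"
      by metis
    \<comment> \<open>A chain of link vertices whose coefficients sum to \<open>c1 {}\<close>. Being
      fixed by \<open>e x\<close>, \<open>c1 {}\<close> is minus the sum of the
      \<open>e x (c {y})\<close>, and \<open>e_between\<close> lets each summand sit at
      \<open>z y\<close>. Distinct \<open>y\<close> may share \<open>z y\<close>, hence the sum over
      \<open>y\<close>.\<close>
    define b' where "b' = (\<lambda>\<tau>. - (\<Sum>y\<in>U - {x}. if \<tau> = {z y} then e x (e (z y) (c {y})) else 0))"
    have b'_ne: "\<exists>y\<in>U - {x}. \<tau> = {z y}" if "b' \<tau> \<noteq> 0" for \<tau>
    proof (rule ccontr)
      assume "\<not> ?thesis"
      then have "b' \<tau> = 0"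
        unfolding b'_def by (simp add: sum.neutral)
      then show False
        using that by simp
    qed
    have b'_fix: "e y (b' \<tau>) = b' \<tau>" if y: "y \<in> insert x \<tau>" for y \<tau>
    proof -
      have "e y (if \<tau> = {z y'} then e x (e (z y') (c {y'})) else 0)
          = (if \<tau> = {z y'} then e x (e (z y') (c {y'})) else 0)" if "y' \<in> U - {x}" for y'
      proof (cases "\<tau> = {z y'}")
        case True
        then consider "y = x" | "y = z y'"
          using y by blast
        then show ?thesis
          by cases (use True e_P [of "z y'" x] z(1) [OF that] in \<open>simp_all add: e_idem\<close>)
      qed (simp add: e_0)
      then show ?thesis
        by (simp add: b'_def e_minus e_sum)
    qed
    have bd_b'_ne: "bd lab T b' \<tau> = 0" if "\<tau> \<noteq> {}" for \<tau>
      unfolding bd_def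
    proof (rule sum.neutral, rule ballI)
      fix y assume "y \<in> T - \<tau>"
      then have "b' (insert y \<tau>) = 0"
        using b'_ne [of "insert y \<tau>"] that by auto
      then show "signed (label_pos lab y \<tau>) (b' (insert y \<tau>)) = 0"
        by simp
    qed
    have bd_b'_empty: "bd lab T b' {} = c1 {}"
    proof -
      have "bd lab T b' {} = - (\<Sum>t\<in>T. \<Sum>y\<in>U - {x}. if t = z y then e x (e (z y) (c {y})) else 0)"
        by (simp add: bd_def b'_def sum_negf)
      also have "\<dots> = - (\<Sum>y\<in>U - {x}. \<Sum>t\<in>T. if t = z y then e x (e (z y) (c {y})) else 0)"
        by (subst sum.swap) simp
      also have "\<dots> = - (\<Sum>y\<in>U - {x}. e x (e (z y) (c {y})))"
      proof -
        have "(\<Sum>t\<in>T. if t = z y then e x (e (z y) (c {y})) else 0) = e x (e (z y) (c {y}))"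
          if "y \<in> U - {x}" for y
          using z(1) [OF that] PT finite_T by (subst sum.delta) auto
        then show ?thesis
          by simp
      qed
      also have "\<dots> = - (\<Sum>y\<in>U - {x}. e x (c {y}))"
      proof -
        have "e x (e (z y) (c {y})) = e x (c {y})" if "y \<in> U - {x}" for y
          using z(2) [OF that, of "c {y}"] c(3) [of y "{y}"] by simp
        then show ?thesis
          by simp
      qed
      also have "\<dots> = e x (c1 {})"
        by (simp add: c1_empty e_minus e_sum)
      also have "\<dots> = c1 {}"
        by (simp add: c1_fix)
      finally show ?thesis .
    qed
    \<comment> \<open>\<open>b'\<close> accounts for the value at \<open>{}\<close>, which
      \<open>link_acyclic\<close> wants to be zero. The differential never reads that value, so
      \<open>c2\<close> is still a cycle.\<close>
    define c2 where "c2 = (\<lambda>\<tau>. if \<tau> = {} then 0 else c1 \<tau>)"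
    define W where "W = {v. e x v = v}"
    have c2_ne: "c1 \<tau> \<noteq> 0" if "c2 \<tau> \<noteq> 0" for \<tau>
      using that by (auto simp: c2_def split: if_splits)
    have "\<exists>b. (\<forall>\<tau>. b \<tau> \<in> W) \<and> (\<forall>\<tau>. \<forall>y\<in>\<tau>. e y (b \<tau>) = b \<tau>) \<and>
        (\<forall>\<tau>. b \<tau> \<noteq> 0 \<longrightarrow> \<tau> \<subseteq> P \<and> ?ch \<tau>) \<and> b {} = 0 \<and> bd lab T b = c2"
    proof (rule link_acyclic [where e = e])
      show "finite T" "P \<subseteq> T"
        by (fact finite_T) (fact PT(1))
      show "le x x" "le x y \<Longrightarrow> le y z \<Longrightarrow> le x z" for x y z
        by (fact le_refl) (fact le_trans)
      show "x = y" if "x \<in> T" "y \<in> T" "le x y" "le y x" for x y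
        using that by (rule le_antisym)
      show "inj_on lab \<tau>" if "\<tau> \<subseteq> P" "?ch \<tau>" for \<tau>
        using spx_inj [OF spxP [OF that]] by simp
      show "e y (v + w) = e y v + e y w" "e y (e y v) = e y v" for y v w
        by (fact e_add) (fact e_idem)
      show "0 \<in> W" "v \<in> W \<Longrightarrow> w \<in> W \<Longrightarrow> v - w \<in> W" for v w
        by (simp_all add: W_def e_0 e_diff)
      show "e y w \<in> W" if "y \<in> P" "w \<in> W" for y w
        using e_P [of x y w] that by (simp add: W_def)
      show "e y (e y' w) = e y' (e y w)" if "y \<in> P" "y' \<in> P" for y y' w
        by (rule e_P) (use that in auto)
      show "(\<forall>w\<in>W. e y (e y' w) = 0) \<or>
          (\<exists>z\<in>P. le y z \<and> le y' z \<and> (\<forall>w\<in>W. e z (e y (e y' w)) = e y (e y' w)))"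
        if "y \<in> P" "y' \<in> P" for y y'
        using e_join [OF xT, of y y'] that unfolding P_def by blast
      show "c2 \<tau> \<in> W" "y \<in> \<tau> \<Longrightarrow> e y (c2 \<tau>) = c2 \<tau>" for \<tau> y
        by (simp_all add: W_def c2_def c1_fix e_0)
      show "\<tau> \<subseteq> P \<and> ?ch \<tau>" if "c2 \<tau> \<noteq> 0" for \<tau>
        using c1 [OF c2_ne [OF that]] by blast
      show "c2 {} = 0"
        by (simp add: c2_def)
      show "bd lab T c2 = (\<lambda>_. 0)"
      proof
        fix \<tau>
        have "bd lab T c2 \<tau> = bd lab T c1 \<tau>"
          by (simp add: bd_def c2_def)
        then show "bd lab T c2 \<tau> = 0"
          by (simp add: bd_c1)
      qed
    qed
    then obtain b2 where b2': "\<forall>\<tau>. b2 \<tau> \<in> W" "\<forall>\<tau>. \<forall>y\<in>\<tau>. e y (b2 \<tau>) = b2 \<tau>"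
        "\<forall>\<tau>. b2 \<tau> \<noteq> 0 \<longrightarrow> \<tau> \<subseteq> P \<and> ?ch \<tau>" "b2 {} = 0" "bd lab T b2 = c2"
      by (elim exE conjE)
    have b2: "e x (b2 \<tau>) = b2 \<tau>" "y \<in> \<tau> \<Longrightarrow> e y (b2 \<tau>) = b2 \<tau>" "b2 \<tau> \<noteq> 0 \<Longrightarrow> \<tau> \<subseteq> P \<and> ?ch \<tau>"
        "b2 {} = 0" "bd lab T b2 = c2" for \<tau> y
      using b2'(1) [THEN spec, of \<tau>] b2'(2) b2'(3) [THEN spec, of \<tau>] b2'(4,5)
      by (simp_all add: W_def)
    define b1 where "b1 = (\<lambda>\<tau>. b2 \<tau> + b' \<tau>)"
    have bd_b1: "bd lab T b1 = c1"
    proof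
      fix \<tau>
      have "bd lab T b1 \<tau> = c2 \<tau> + bd lab T b' \<tau>"
        by (simp add: b1_def bd_add b2(5))
      then show "bd lab T b1 \<tau> = c1 \<tau>"
        by (cases "\<tau> = {}") (simp_all add: c2_def bd_b'_empty bd_b'_ne)
    qed
    have b1_fix: "e y (b1 \<tau>) = b1 \<tau>" if "y \<in> insert x \<tau>" for y \<tau>
    proof -
      have "e y (b2 \<tau>) = b2 \<tau>"
        using that b2(1,2) by blast
      then show ?thesis
        using b'_fix [OF that] by (simp add: b1_def e_add)
    qed
    have b1_ch: "\<tau> \<subseteq> P \<and> ?ch \<tau>" if "b1 \<tau> \<noteq> 0" for \<tau>
    proof (cases "b2 \<tau> = 0")
      case True
      then have "b' \<tau> \<noteq> 0"
        using that by (simp add: b1_def)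
      then obtain y where "y \<in> U - {x}" "\<tau> = {z y}"
        using b'_ne by blast
      then show ?thesis
        using z(1) [of y] le_refl by simp
    next
      case False
      then show ?thesis
        by (rule b2(3))
    qed
    have "b' {} = 0"
      using b'_ne [of "{}"] by auto
    then have b1_empty: "b1 {} = 0"
      using b2(4) by (simp add: b1_def)
    have b1_spx: "spx (insert x \<tau>)" "x \<notin> \<tau>" "insert x \<tau> \<subseteq> U" if "b1 \<tau> \<noteq> 0" for \<tau>
      using spxP [of \<tau>] b1_ch [OF that] PU x(1) by blast+
    \<comment> \<open>Homologous to \<open>c\<close>: by \<open>c'_eq\<close> the boundary of the
      cone over \<open>b1\<close> has been added, which trades the star of \<open>x\<close> for a
      chain in its link.\<close>
    define c' where "c' = (\<lambda>\<tau>. c0 \<tau> + b1 \<tau>)"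
    have ch': "chains_on (U - {x}) c'"
      unfolding chains_on_def
    proof (intro conjI allI impI ballI)
      show "c' {} = 0"
        by (simp add: c'_def c0(1) b1_empty)
      show "e y (c' \<sigma>) = c' \<sigma>" if "y \<in> \<sigma>" for y \<sigma>
        using that by (simp add: c'_def e_add c0(3) b1_fix)
      show "\<sigma> \<subseteq> U - {x}" "spx \<sigma>" if "c' \<sigma> \<noteq> 0" for \<sigma>
      proof -
        have "\<sigma> \<subseteq> U - {x} \<and> spx \<sigma>"
        proof (cases "c0 \<sigma> = 0")
          case True
          then have ne: "b1 \<sigma> \<noteq> 0"
            using that by (simp add: c'_def)
          then have "\<sigma> \<noteq> {}"
            using b1_empty by blast
          then show ?thesis
            using spx_subset [OF b1_spx(1) [OF ne]] b1_spx(2,3) [OF ne] by blast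
        next
          case False
          then show ?thesis
            using c0(2) by blast
        qed
        then show "\<sigma> \<subseteq> U - {x}" "spx \<sigma>"
          by simp_all
      qed
    qed
    have bd_cone_b1: "bd lab T (cone_over lab x b1) \<tau> = b1 \<tau> - cone_over lab x c1 \<tau>" for \<tau>
    proof -
      have "bd lab T (cone_over lab x b1) \<tau> = b1 \<tau> - cone_over lab x (bd lab T b1) \<tau>"
      proof (rule bd_cone [OF finite_T xT])
        fix \<tau> assume ne: "b1 \<tau> \<noteq> 0"
        then show "x \<notin> \<tau> \<and> \<tau> \<subseteq> T \<and> inj_on lab (insert x \<tau>)"
          using b1_spx [OF ne] spx_inj [OF b1_spx(1) [OF ne]] UT by blast
      qed
      then show ?thesis
        by (simp add: bd_b1)
    qed
    have c'_eq: "c' \<tau> = c \<tau> + bd lab T (cone_over lab x b1) \<tau>" for \<tau>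
      using c_eq [of \<tau>] bd_cone_b1 [of \<tau>] by (simp add: c'_def)
    have cone_b1_ne: "\<tau> \<subseteq> U \<and> spx \<tau>" if "cone_over lab x b1 \<tau> \<noteq> 0" for \<tau>
    proof -
      have "x \<in> \<tau>" "b1 (\<tau> - {x}) \<noteq> 0"
        using that by (auto simp: cone_over_def split: if_splits)
      then show ?thesis
        using b1_spx [of "\<tau> - {x}"] by (simp add: insert_absorb)
    qed
    have ch_cone: "chains_on U (cone_over lab x b1)"
      unfolding chains_on_def
    proof (intro conjI allI impI ballI)
      show "cone_over lab x b1 {} = 0"
        by (simp add: cone_over_def)
      show "e y (cone_over lab x b1 \<sigma>) = cone_over lab x b1 \<sigma>" if "y \<in> \<sigma>" for y \<sigma>
        using b1_fix [of y "\<sigma> - {x}"] that by (simp add: cone_over_def e_signed e_0)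
    qed (use cone_b1_ne in auto)
    have bd_c': "bd lab T c' = (\<lambda>_. 0)"
    proof
      fix \<tau>
      have "bd lab T c' \<tau> = bd lab T (\<lambda>\<tau>. c \<tau> + bd lab T (cone_over lab x b1) \<tau>) \<tau>"
        using c'_eq by presburger
      also have "\<dots> = bd lab T c \<tau> + bd lab T (bd lab T (cone_over lab x b1)) \<tau>"
        by (rule bd_add)
      also have "bd lab T (bd lab T (cone_over lab x b1)) \<tau> = 0"
      proof (rule bd_bd [OF finite_T])
        fix \<tau> assume "cone_over lab x b1 \<tau> \<noteq> 0"
        from cone_b1_ne [OF this] show "\<tau> \<subseteq> T \<and> inj_on lab \<tau>"
          using UT spx_inj [of \<tau>] by blast
      qed
      finally show "bd lab T c' \<tau> = 0"
        using bdc by simp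
    qed
    \<comment> \<open>\<open>x\<close> is minimal, so it lies above no other vertex of
      \<open>U\<close>, and its removal keeps \<open>U\<close> closed upwards.\<close>
    have up': "up y \<subseteq> U - {x}" if y: "y \<in> U - {x}" for y
      using up_U [of y] up_le [of y x] x(2) [of y] y UT by blast
    have "card (U - {x}) < card U" "U - {x} \<subseteq> T"
      using card_Diff1_less [OF finU x(1)] UT by auto
    then obtain b3 where b3: "chains_on (U - {x}) b3" "bd lab T b3 = c'"
      using less.hyps [OF _ _ up' ch' bd_c'] by blast
    have "chains_on U (\<lambda>\<tau>. b3 \<tau> - cone_over lab x b1 \<tau>)"
      unfolding chains_on_def
    proof (intro conjI allI impI ballI)
      show "b3 {} - cone_over lab x b1 {} = 0"
        using b3(1) by (simp add: chains_on_def cone_over_def)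
      show "e y (b3 \<sigma> - cone_over lab x b1 \<sigma>) = b3 \<sigma> - cone_over lab x b1 \<sigma>" if "y \<in> \<sigma>" for y \<sigma>
        using b3(1) ch_cone that by (simp add: chains_on_def e_diff)
      fix \<sigma> assume "b3 \<sigma> - cone_over lab x b1 \<sigma> \<noteq> 0"
      then consider "b3 \<sigma> \<noteq> 0" | "cone_over lab x b1 \<sigma> \<noteq> 0"
        by fastforce
      then have "\<sigma> \<subseteq> U \<and> spx \<sigma>"
        using b3(1) cone_b1_ne by cases (auto simp: chains_on_def)
      then show "\<sigma> \<subseteq> U" "spx \<sigma>"
        by simp_all
    qed
    moreover have "bd lab T (\<lambda>\<tau>. b3 \<tau> - cone_over lab x b1 \<tau>) = c"
      by (rule ext) (simp add: bd_diff b3(2) c'_eq)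
    ultimately show ?thesis
      by blast
  qed
qed

end

section \<open>The field\<close>

lemma absv_nonneg [simp]: "0 \<le> absv (x :: 'k::nonarch_lc_field)"
  using dist_absv [of x 0] zero_le_dist [of x 0] by simp

lemma absv_eq_0 [simp]: "absv x = 0 \<longleftrightarrow> x = (0 :: 'k::nonarch_lc_field)"
  using dist_absv [of x 0] by (metis diff_zero dist_eq_0_iff)

lemma absv_0 [simp]: "absv (0 :: 'k::nonarch_lc_field) = 0"
  by simp

lemma absv_pos [simp]: "0 < absv x \<longleftrightarrow> x \<noteq> (0 :: 'k::nonarch_lc_field)"
  using absv_nonneg [of x] absv_eq_0 [of x] by linarith

lemma absv_le_0 [simp]: "absv x \<le> 0 \<longleftrightarrow> x = (0 :: 'k::nonarch_lc_field)"
  using absv_nonneg [of x] absv_eq_0 [of x] by linarith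

lemma absv_1 [simp]: "absv (1 :: 'k::nonarch_lc_field) = 1"
proof -
  have "absv (1 :: 'k) * absv (1 :: 'k) = absv (1 :: 'k)"
    using absv_mult [of "1 :: 'k" 1] by simp
  moreover have "absv (1 :: 'k) \<noteq> 0"
    by simp
  ultimately show ?thesis
    by (metis mult_cancel_left1)
qed

lemma absv_minus [simp]: "absv (- x) = absv (x :: 'k::nonarch_lc_field)"
  using dist_absv [of 0 x] dist_absv [of x 0] dist_commute [of 0 x] by simp

lemma absv_diff_le: "absv (x - y) \<le> max (absv x) (absv (y :: 'k::nonarch_lc_field))"
  using absv_ultrametric [of x "- y"] by simp

lemma absv_power: "absv (x ^ m) = absv (x :: 'k::nonarch_lc_field) ^ m"
  by (induction m) (simp_all add: absv_mult)

lemma absv_inverse: "absv (inverse x) = inverse (absv (x :: 'k::nonarch_lc_field))"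
proof (cases "x = 0")
  case False
  then have "absv x * absv (inverse x) = 1"
    using absv_mult [of x "inverse x"] by simp
  then show ?thesis
    by (metis inverse_unique)
qed simp

lemma absv_divide: "absv (x / y) = absv x / absv (y :: 'k::nonarch_lc_field)"
  by (simp add: divide_inverse absv_mult absv_inverse)

lemma absv_sum_le:
  fixes f :: "'b \<Rightarrow> 'k::nonarch_lc_field"
  assumes "0 \<le> r" "\<And>i. i \<in> A \<Longrightarrow> absv (f i) \<le> r"
  shows "absv (sum f A) \<le> r"
  using assms(2)
proof (induction A rule: infinite_finite_induct)
  case (insert x F)
  then have "max (absv (f x)) (absv (sum f F)) \<le> r"
    by simp
  then show ?case
    using order_trans [OF absv_ultrametric [of "f x" "sum f F"]] insert.hyps by simp
qed (use assms(1) in auto)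

lemma integers_0 [simp]: "0 \<in> (integers :: 'k::nonarch_lc_field set)"
  and integers_1 [simp]: "1 \<in> (integers :: 'k::nonarch_lc_field set)"
  by (simp_all add: integers_def)

lemma integers_add: "a \<in> integers \<Longrightarrow> b \<in> integers \<Longrightarrow> a + b \<in> (integers :: 'k::nonarch_lc_field set)"
  using absv_ultrametric [of a b] by (simp add: integers_def)

lemma integers_diff: "a \<in> integers \<Longrightarrow> b \<in> integers \<Longrightarrow> a - b \<in> (integers :: 'k::nonarch_lc_field set)"
  using absv_diff_le [of a b] by (simp add: integers_def)

lemma integers_minus: "a \<in> integers \<Longrightarrow> - a \<in> (integers :: 'k::nonarch_lc_field set)"
  by (simp add: integers_def)

lemma integers_mult: "a \<in> integers \<Longrightarrow> b \<in> integers \<Longrightarrow> a * b \<in> (integers :: 'k::nonarch_lc_field set)"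
  by (simp add: integers_def absv_mult mult_le_one)

lemma integers_power: "a \<in> integers \<Longrightarrow> a ^ m \<in> (integers :: 'k::nonarch_lc_field set)"
  by (simp add: integers_def absv_power power_le_one)

lemma integers_of_nat: "of_nat m \<in> (integers :: 'k::nonarch_lc_field set)"
  by (induction m) (auto intro: integers_add)

locale uniformizer =
  fixes \<pi> :: "'k::nonarch_lc_field"
  assumes prime: "prime_element \<pi>"
begin

lemma pi_nz [simp]: "\<pi> \<noteq> 0"
  using prime by (simp add: prime_element_def)

lemma absv_pi_lt_1: "absv \<pi> < 1"
proof -
  have "\<not> inverse (absv \<pi>) \<le> 1"
    using prime by (simp add: prime_element_def integers_def absv_inverse)
  then show ?thesis
    by (metis absv_nonneg inverse_le_1_iff linorder_not_le)
qed

lemma pi_int [simp]: "\<pi> \<in> integers"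
  using absv_pi_lt_1 by (simp add: integers_def)

lemma pi_power_int [simp]: "\<pi> ^ m \<in> integers"
  by (simp add: integers_power)

lemma dvd_integers: "c \<noteq> 0 \<Longrightarrow> (\<exists>b\<in>integers. a = c * b) \<longleftrightarrow> absv a \<le> absv (c :: 'k)"
proof
  assume c: "c \<noteq> 0" "absv a \<le> absv c"
  then have "a / c \<in> integers"
    by (simp add: integers_def absv_divide divide_le_eq_1)
  moreover have "a = c * (a / c)"
    using c by simp
  ultimately show "\<exists>b\<in>integers. a = c * b"
    by blast
qed (auto simp: integers_def absv_mult mult_left_le)

lemma ex_power_le:
  assumes "0 < r"
  shows "\<exists>m. absv \<pi> ^ m \<le> r"
  using real_arch_pow_inv [OF assms absv_pi_lt_1] less_imp_le by blast

text \<open>A high power of \<open>a\<close> is divisible by \<open>\<pi>\<close>, and primality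
  passes this down to \<open>a\<close>. Thus \<open>absv \<pi>\<close> is the largest value below 1:
  the discreteness of the value group comes from the prime element.\<close>

lemma absv_lt_1_imp_le:
  fixes a :: 'k
  assumes "absv a < 1"
  shows "absv a \<le> absv \<pi>"
proof (cases "a = 0")
  case False
  have a: "a \<in> integers"
    using assms by (simp add: integers_def)
  have dvd: "absv b \<le> absv \<pi> \<or> absv c \<le> absv \<pi>"
    if "b \<in> integers" "c \<in> integers" "absv (b * c) \<le> absv \<pi>" for b c :: 'k
    using prime that unfolding prime_element_def by (simp add: dvd_integers)
  have *: "absv a \<le> absv \<pi>" if "absv (a ^ m) \<le> absv \<pi>" for m
    using that
  proof (induction m)
    case 0
    then show ?case
      using absv_pi_lt_1 by simp
  next
    case (Suc m)
    then show ?case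
      using dvd [OF a integers_power [OF a]] by (auto simp only: power_Suc)
  qed
  obtain m where "absv a ^ m < absv \<pi>"
    using real_arch_pow_inv [of "absv \<pi>" "absv a"] assms by auto
  then show ?thesis
    using * [of m] by (simp add: absv_power)
qed simp

lemma unit_or_dvd:
  fixes a :: 'k
  assumes "a \<in> integers"
  shows "absv a = 1 \<or> absv a \<le> absv \<pi>"
  using assms absv_lt_1_imp_le [of a] by (force simp: integers_def)

text \<open>Local compactness enters through the finiteness of the quotients of the ring of integers.\<close>

lemma finite_residues: "\<exists>R :: 'k set. finite R \<and> R \<subseteq> integers \<and> (\<forall>a\<in>integers. \<exists>r\<in>R. absv (a - r) \<le> absv \<pi> ^ m)"
proof -
  obtain U C :: "'k set" where UC: "open U" "0 \<in> U" "U \<subseteq> C" "compact C"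
    using locally_compact by blast
  obtain \<epsilon> where \<epsilon>: "0 < \<epsilon>" "ball 0 \<epsilon> \<subseteq> U"
    using UC(1,2) open_contains_ball by blast
  obtain s where s: "absv \<pi> ^ s < \<epsilon>"
    using real_arch_pow_inv [OF \<epsilon>(1) absv_pi_lt_1] by blast
  \<comment> \<open>A closed ball small enough to lie in a compact set; division by
    \<open>\<pi> ^ s\<close> turns it into the ring of integers.\<close>
  define B where "B = cball (0 :: 'k) (absv \<pi> ^ s)"
  have "B \<subseteq> C"
  proof
    fix x assume "x \<in> B"
    then have "x \<in> ball 0 \<epsilon>"
      using s by (simp add: B_def)
    then show "x \<in> C"
      using \<epsilon>(2) UC(3) by blast
  qed
  then have "compact B"
    using compact_Int_closed [OF UC(4), of B] by (simp add: B_def Int_absorb1)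
  moreover have "open (ball x (absv \<pi> ^ (s + m)))" if "x \<in> B" for x
    by simp
  moreover have "B \<subseteq> (\<Union>x\<in>B. ball x (absv \<pi> ^ (s + m)))"
    by force
  ultimately obtain D where D: "D \<subseteq> B" "finite D" "B \<subseteq> (\<Union>x\<in>D. ball x (absv \<pi> ^ (s + m)))"
    by (rule compactE_image)
  define R where "R = (\<lambda>x. x / \<pi> ^ s) ` D"
  have "R \<subseteq> integers"
    using D(1) by (auto simp: R_def B_def integers_def absv_divide absv_power dist_absv divide_le_eq_1)
  moreover have "\<exists>r\<in>R. absv (a - r) \<le> absv \<pi> ^ m" if "a \<in> integers" for a
  proof -
    have "\<pi> ^ s * a \<in> B"
      using that by (simp add: B_def integers_def dist_absv absv_mult absv_power mult_left_le)
    then obtain x where x: "x \<in> D" "dist x (\<pi> ^ s * a) < absv \<pi> ^ (s + m)"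
      using D(3) by auto
    have "absv \<pi> ^ s * absv (a - x / \<pi> ^ s) = absv (\<pi> ^ s * a - x)"
      by (simp add: right_diff_distrib flip: absv_power absv_mult)
    also have "\<dots> < absv \<pi> ^ s * absv \<pi> ^ m"
      using x(2) absv_minus [of "x - \<pi> ^ s * a"] by (simp add: dist_absv power_add)
    finally have "absv (a - x / \<pi> ^ s) \<le> absv \<pi> ^ m"
      by (simp add: mult_less_cancel_left)
    then show ?thesis
      using x(1) by (auto simp: R_def)
  qed
  moreover have "finite R"
    using D(2) by (simp add: R_def)
  ultimately show ?thesis
    by blast
qed

text \<open>By finiteness of the residues, two natural numbers \<open>i < j\<close> are congruent
  modulo \<open>\<pi>\<close>; so \<open>p\<close> divides \<open>j - i\<close> and cannot be
  0.\<close>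

lemma residue_char_props:
  assumes "residue_char TYPE('k) p"
  shows "p > 0" "absv (of_nat p :: 'k) \<le> absv \<pi>"
proof -
  have p: "absv (of_nat m :: 'k) < 1 \<longleftrightarrow> p dvd m" for m
    using assms by (simp add: residue_char_def)
  show "absv (of_nat p :: 'k) \<le> absv \<pi>"
    using p [of p] by (simp add: absv_lt_1_imp_le)
  obtain R :: "'k set" where R: "finite R" "\<forall>a\<in>integers. \<exists>r\<in>R. absv (a - r) \<le> absv \<pi> ^ 1"
    using finite_residues [of 1] by blast
  have "\<forall>m::nat. \<exists>r\<in>R. absv (of_nat m - r) \<le> absv \<pi>"
    using R(2) integers_of_nat by auto
  then obtain f where f: "\<And>m::nat. f m \<in> R \<and> absv (of_nat m - f m) \<le> absv \<pi>"
    by metis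
  have "\<not> inj f"
  proof
    assume "inj f"
    then have "infinite (range f)"
      using finite_imageD by auto
    then show False
      using R(1) f finite_subset [of "range f" R] by auto
  qed
  then obtain i j where ij: "i < j" "f i = f j"
    unfolding inj_def by (metis linorder_neqE_nat)
  have "of_nat (j - i) = (of_nat j - f j) - (of_nat i - f i)"
    using ij by (simp add: of_nat_diff)
  also have "absv \<dots> \<le> max (absv (of_nat j - f j)) (absv (of_nat i - f i))"
    by (rule absv_diff_le)
  also have "\<dots> \<le> absv \<pi>"
    using f by simp
  finally have "p dvd j - i"
    using p absv_pi_lt_1 by fastforce
  then show "p > 0"
    using ij(1) by (cases p) auto
qed

end

section \<open>Lattices\<close>

text \<open>Lattices without the freeness condition, so that sums and intermediate modules can be
  handled before they are known to be lattices.\<close>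

definition omodule :: "('k::nonarch_lc_field ^ 'n) set \<Rightarrow> bool"
  where "omodule L \<longleftrightarrow> 0 \<in> L \<and> (\<forall>v\<in>L. \<forall>w\<in>L. v + w \<in> L) \<and> (\<forall>a\<in>integers. \<forall>v\<in>L. a *s v \<in> L)"

abbreviation smult_set :: "'k::nonarch_lc_field \<Rightarrow> ('k ^ 'n) set \<Rightarrow> ('k ^ 'n) set"
  where "smult_set c L \<equiv> (\<lambda>v. c *s v) ` L"

lemma omodule_0: "omodule L \<Longrightarrow> 0 \<in> L"
  and omodule_add: "omodule L \<Longrightarrow> v \<in> L \<Longrightarrow> w \<in> L \<Longrightarrow> v + w \<in> L"
  and omodule_smult: "omodule L \<Longrightarrow> a \<in> integers \<Longrightarrow> v \<in> L \<Longrightarrow> a *s v \<in> L"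
  by (auto simp: omodule_def)

lemma omodule_minus: "omodule L \<Longrightarrow> v \<in> L \<Longrightarrow> - v \<in> L"
  using omodule_smult [of L "- 1" v] by (simp add: integers_minus)

lemma omodule_diff: "omodule L \<Longrightarrow> v \<in> L \<Longrightarrow> w \<in> L \<Longrightarrow> v - w \<in> L"
  using omodule_add [of L v "- w"] by (simp add: omodule_minus)

lemma omodule_sum: "omodule L \<Longrightarrow> (\<And>i. i \<in> A \<Longrightarrow> f i \<in> L) \<Longrightarrow> sum f A \<in> L"
  by (induction A rule: infinite_finite_induct) (auto intro: omodule_0 omodule_add)

lemma mem_smult_set:
  fixes L :: "('k::nonarch_lc_field ^ 'n) set"
  shows "c \<noteq> 0 \<Longrightarrow> v \<in> smult_set c L \<longleftrightarrow> inverse c *s v \<in> L"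
proof
  assume "c \<noteq> 0" "inverse c *s v \<in> L"
  then show "v \<in> smult_set c L"
    by (intro image_eqI [of _ _ "inverse c *s v"]) (simp_all add: vector_smult_assoc)
qed (auto simp: vector_smult_assoc)

lemma smult_smult_set: "smult_set c (smult_set d L) = smult_set (c * d) L"
  by (simp add: image_image vector_smult_assoc)

lemma smult_set_1 [simp]: "smult_set 1 L = L"
  by simp

lemma smult_mem_smult_set: "c \<noteq> 0 \<Longrightarrow> c *s v \<in> smult_set c L \<longleftrightarrow> v \<in> L"
  by (simp add: mem_smult_set vector_smult_assoc)

lemma smult_set_mono_iff: "c \<noteq> 0 \<Longrightarrow> smult_set c L \<subseteq> smult_set c M \<longleftrightarrow> L \<subseteq> M"
  by (auto simp: mem_smult_set vector_smult_assoc)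

lemma omodule_smult_set:
  assumes "omodule L"
  shows "omodule (smult_set c L)"
  unfolding omodule_def
proof (intro conjI ballI)
  show "0 \<in> smult_set c L"
    by (rule image_eqI [of _ _ 0]) (simp_all add: omodule_0 [OF assms])
  show "v + w \<in> smult_set c L" if vw: "v \<in> smult_set c L" "w \<in> smult_set c L" for v w
  proof -
    obtain v' w' where "v' \<in> L" "v = c *s v'" "w' \<in> L" "w = c *s w'"
      using vw by blast
    then show ?thesis
      using omodule_add [OF assms] by (intro image_eqI [of _ _ "v' + w'"]) (simp_all add: vector_add_ldistrib)
  qed
  show "a *s v \<in> smult_set c L" if a: "a \<in> integers" and v: "v \<in> smult_set c L" for a v
  proof -
    obtain w where w: "w \<in> L" "v = c *s w"
      using v by blast
    then have "a *s v = c *s (a *s w)"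
      by (simp add: vector_smult_assoc mult.commute)
    then show ?thesis
      using omodule_smult [OF assms a w(1)] by blast
  qed
qed

lemma smult_set_subset:
  assumes "omodule L" "absv c \<le> absv (d :: 'k::nonarch_lc_field)"
  shows "smult_set c L \<subseteq> smult_set d L"
proof (cases "d = 0")
  case True
  then show ?thesis
    using assms(2) by auto
next
  case False
  have "c / d \<in> integers"
    using False assms(2) by (simp add: integers_def absv_divide divide_le_eq_1)
  then show ?thesis
    using omodule_smult [OF assms(1)] False
    by (auto simp: mem_smult_set vector_smult_assoc divide_inverse mult.commute)
qed

lemma smult_set_eq:
  assumes "omodule L" "absv c = absv (d :: 'k::nonarch_lc_field)"
  shows "smult_set c L = smult_set d L"
  using assms by (intro subset_antisym smult_set_subset) simp_all

lemma omodule_image_mult: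
  assumes "omodule L"
  shows "omodule ((\<lambda>v. g *v v) ` L)"
  unfolding omodule_def
proof (intro conjI ballI)
  show "0 \<in> (\<lambda>v. g *v v) ` L"
    by (rule image_eqI [of _ _ 0]) (simp_all add: omodule_0 [OF assms])
  show "v + w \<in> (\<lambda>v. g *v v) ` L" if "v \<in> (\<lambda>v. g *v v) ` L" "w \<in> (\<lambda>v. g *v v) ` L" for v w
    using that omodule_add [OF assms] by (auto simp: matrix_vector_right_distrib [symmetric])
  show "a *s v \<in> (\<lambda>v. g *v v) ` L" if "a \<in> integers" "v \<in> (\<lambda>v. g *v v) ` L" for a v
    using that omodule_smult [OF assms] by (auto simp: vector_scalar_commute [symmetric])
qed

lemma image_mult_smult_set: "(\<lambda>v. g *v v) ` smult_set c L = smult_set c ((\<lambda>v. g *v v) ` L)"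
  for g :: "'k::nonarch_lc_field ^ 'n ^ 'n"
  by (simp add: image_image vector_scalar_commute)

lemma axis_standard: "axis j 1 \<in> standard_lattice"
  by (simp add: standard_lattice_def axis_def)

lemma omodule_standard: "omodule standard_lattice"
  by (auto simp: omodule_def standard_lattice_def integers_add integers_mult)

lemma matrix_inv_props:
  fixes g :: "'k::field ^ 'n ^ 'n"
  assumes "invertible g"
  shows "g ** matrix_inv g = mat 1" "matrix_inv g ** g = mat 1" "invertible (matrix_inv g)"
    "matrix_inv g *v (g *v v) = v" "g *v (matrix_inv g *v v) = v"
proof -
  show *: "g ** matrix_inv g = mat 1" "matrix_inv g ** g = mat 1"
    using someI_ex [OF assms [unfolded invertible_def]] unfolding matrix_inv_def by simp_all
  then show "invertible (matrix_inv g)"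
    unfolding invertible_def by blast
  show "matrix_inv g *v (g *v v) = v" "g *v (matrix_inv g *v v) = v"
    by (simp_all add: matrix_vector_mul_assoc *)
qed

lemma matrix_inv_matrix_inv:
  fixes g :: "'k::field ^ 'n ^ 'n"
  assumes "invertible g"
  shows "matrix_inv (matrix_inv g) = g"
  using matrix_inv_props(1,2) [OF assms] matrix_inv_props(1) [OF matrix_inv_props(3) [OF assms]]
  by (metis matrix_mul_assoc matrix_mul_lid matrix_mul_rid)

lemma mem_image_mult:
  fixes g :: "'k::field ^ 'n ^ 'n"
  assumes "invertible g"
  shows "v \<in> (\<lambda>v. g *v v) ` L \<longleftrightarrow> matrix_inv g *v v \<in> L"
  using matrix_inv_props(4,5) [OF assms] by (metis (no_types, lifting) imageE imageI)

lemma invertible_iff_ker: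
  fixes g :: "'k::field ^ 'n ^ 'n"
  shows "invertible g \<longleftrightarrow> (\<forall>v. g *v v = 0 \<longrightarrow> v = 0)"
  by (simp add: invertible_left_inverse matrix_left_invertible_ker)

section \<open>Lattices as images of the standard lattice under invertible matrices\<close>

context uniformizer
begin

lemma ex_power_integral: "\<exists>m. \<pi> ^ m *s v \<in> standard_lattice"
proof -
  have "\<exists>m. absv \<pi> ^ m * absv (v $ i) \<le> 1" for i
  proof (cases "v $ i = 0")
    case False
    then obtain m where "absv \<pi> ^ m \<le> 1 / absv (v $ i)"
      using ex_power_le [of "1 / absv (v $ i)"] by auto
    then show ?thesis
      using False by (auto simp: field_simps)
  qed simp
  then obtain m where m: "\<And>i. absv \<pi> ^ m i * absv (v $ i) \<le> 1"
    by metis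
  have "absv \<pi> ^ (\<Sum>j\<in>UNIV. m j) * absv (v $ i) \<le> 1" for i
  proof -
    have "m i \<le> (\<Sum>j\<in>UNIV. m j)"
      by (rule member_le_sum) auto
    then have "absv \<pi> ^ (\<Sum>j\<in>UNIV. m j) \<le> absv \<pi> ^ m i"
      using absv_pi_lt_1 by (intro power_decreasing) auto
    then show ?thesis
      using m [of i] mult_right_mono [OF _ absv_nonneg [of "v $ i"]] order_trans by blast
  qed
  then show ?thesis
    by (auto simp: standard_lattice_def integers_def absv_mult absv_power)
qed

text \<open>Independence over the ring of integers extends to the field, because a power of
  \<open>\<pi>\<close> clears the denominators of a relation. Hence the matrix of a basis has
  trivial kernel.\<close>

lemma is_lattice_iff:
  "is_lattice L \<longleftrightarrow> (\<exists>g :: 'k ^ 'n ^ 'n. invertible g \<and> L = (\<lambda>v. g *v v) ` standard_lattice)"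
proof
  assume "is_lattice L"
  then obtain b :: "'n \<Rightarrow> 'k ^ 'n" where
    indep: "\<And>a. (\<forall>i. a i \<in> integers) \<Longrightarrow> (\<Sum>i\<in>UNIV. a i *s b i) = 0 \<Longrightarrow> \<forall>i. a i = 0" and
    L: "L = {(\<Sum>i\<in>UNIV. a i *s b i) | a. \<forall>i. a i \<in> integers}"
    unfolding is_lattice_def by blast
  define g :: "'k ^ 'n ^ 'n" where "g = (\<chi> r c. b c $ r)"
  have g: "g *v v = (\<Sum>i\<in>UNIV. v $ i *s b i)" for v
    by (simp add: matrix_mult_sum column_def g_def vec_eq_iff)
  have "v = 0" if "g *v v = 0" for v
  proof -
    obtain m where m: "\<pi> ^ m *s v \<in> standard_lattice"
      using ex_power_integral by blast
    have "g *v (\<pi> ^ m *s v) = 0"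
      using that by (simp add: vector_scalar_commute)
    then have "\<forall>i. (\<pi> ^ m *s v) $ i = 0"
      using m by (intro indep) (auto simp: g standard_lattice_def)
    then show ?thesis
      by (simp add: vec_eq_iff)
  qed
  then have "invertible g"
    by (simp add: invertible_iff_ker)
  moreover have "L = (\<lambda>v. g *v v) ` standard_lattice"
  proof
    show "L \<subseteq> (\<lambda>v. g *v v) ` standard_lattice"
    proof
      fix v assume "v \<in> L"
      then obtain a where "v = (\<Sum>i\<in>UNIV. a i *s b i)" "\<forall>i. a i \<in> integers"
        using L by blast
      then show "v \<in> (\<lambda>v. g *v v) ` standard_lattice"
        by (intro image_eqI [of _ _ "\<chi> i. a i"]) (auto simp: g standard_lattice_def)
    qed
    show "(\<lambda>v. g *v v) ` standard_lattice \<subseteq> L"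
      by (auto simp: g L standard_lattice_def)
  qed
  ultimately show "\<exists>g :: 'k ^ 'n ^ 'n. invertible g \<and> L = (\<lambda>v. g *v v) ` standard_lattice"
    by blast
next
  assume "\<exists>g :: 'k ^ 'n ^ 'n. invertible g \<and> L = (\<lambda>v. g *v v) ` standard_lattice"
  then obtain g :: "'k ^ 'n ^ 'n" where g: "invertible g" "L = (\<lambda>v. g *v v) ` standard_lattice"
    by blast
  have sum: "(\<Sum>i\<in>UNIV. a i *s column i g) = g *v (\<chi> i. a i)" for a
    by (simp add: matrix_mult_sum)
  show "is_lattice L"
    unfolding is_lattice_def
  proof (intro exI [of _ "\<lambda>i. column i g"] conjI allI impI)
    fix a i
    assume "(\<forall>i. a i \<in> integers) \<and> (\<Sum>i\<in>UNIV. a i *s column i g) = 0"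
    then have "(\<chi> i. a i) = (0 :: 'k ^ 'n)"
      using g(1) by (simp add: sum invertible_iff_ker)
    then show "a i = 0"
      by (simp add: vec_eq_iff)
  next
    show "L = {(\<Sum>i\<in>UNIV. a i *s column i g) | a. \<forall>i. a i \<in> integers}"
    proof
      show "L \<subseteq> {(\<Sum>i\<in>UNIV. a i *s column i g) | a. \<forall>i. a i \<in> integers}"
      proof
        fix v assume "v \<in> L"
        then obtain w where "w \<in> standard_lattice" "v = g *v w"
          using g(2) by blast
        then show "v \<in> {(\<Sum>i\<in>UNIV. a i *s column i g) | a. \<forall>i. a i \<in> integers}"
          by (auto simp: matrix_mult_sum standard_lattice_def intro!: exI [of _ "($) w"])
      qed
    qed (auto simp: g(2) sum standard_lattice_def)
  qed
qed

lemma lattice_omodule: "is_lattice L \<Longrightarrow> omodule (L :: ('k ^ 'n) set)"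
  unfolding is_lattice_iff by (elim exE conjE) (simp add: omodule_image_mult omodule_standard)

lemma lattice_standard: "is_lattice (standard_lattice :: ('k ^ 'n) set)"
  unfolding is_lattice_iff by (intro exI [of _ "mat 1"]) (simp add: invertible_iff_ker)

lemma lattice_image_mult:
  fixes L :: "('k ^ 'n) set" and g :: "'k ^ 'n ^ 'n"
  assumes "is_lattice L" "invertible g"
  shows "is_lattice ((\<lambda>v. g *v v) ` L)"
proof -
  obtain h :: "'k ^ 'n ^ 'n" where h: "invertible h" "L = (\<lambda>v. h *v v) ` standard_lattice"
    using assms(1) is_lattice_iff by blast
  have "(\<lambda>v. g *v v) ` L = (\<lambda>v. (g ** h) *v v) ` standard_lattice"
    by (simp add: h(2) image_image matrix_vector_mul_assoc)
  then show ?thesis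
    unfolding is_lattice_iff using invertible_mult [OF assms(2) h(1)] by (intro exI [of _ "g ** h"]) simp
qed

lemma lattice_smult_set:
  fixes L :: "('k ^ 'n) set"
  assumes "is_lattice L" "c \<noteq> 0"
  shows "is_lattice (smult_set c L)"
proof -
  obtain g :: "'k ^ 'n ^ 'n" where g: "invertible g" "L = (\<lambda>v. g *v v) ` standard_lattice"
    using assms(1) is_lattice_iff by blast
  define h :: "'k ^ 'n ^ 'n" where "h = (\<chi> i j. if i = j then c else 0)"
  have h: "h *v v = c *s v" for v
  proof -
    have "(\<Sum>j\<in>UNIV. (if i = j then c else 0) * v $ j) = c * v $ i" for i
    proof -
      have "(\<Sum>j\<in>UNIV. (if i = j then c else 0) * v $ j) = (\<Sum>j\<in>UNIV. if i = j then c * v $ j else 0)"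
        by (rule sum.cong) auto
      then show ?thesis
        by simp
    qed
    then show ?thesis
      by (simp add: h_def matrix_vector_mult_def vec_eq_iff)
  qed
  then have "invertible h"
    using assms(2) by (simp add: invertible_iff_ker)
  moreover have "smult_set c L = (\<lambda>v. h *v v) ` L"
    by (simp add: h)
  ultimately show ?thesis
    using lattice_image_mult [OF assms(1)] by simp
qed

lemma lattice_absorbs:
  fixes L :: "('k ^ 'n) set"
  assumes "is_lattice L"
  shows "\<exists>m. \<pi> ^ m *s v \<in> L"
proof -
  obtain g :: "'k ^ 'n ^ 'n" where g: "invertible g" "L = (\<lambda>v. g *v v) ` standard_lattice"
    using assms is_lattice_iff by blast
  obtain m where "\<pi> ^ m *s (matrix_inv g *v v) \<in> standard_lattice"
    using ex_power_integral by blast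
  then show ?thesis
    using g by (auto simp: mem_image_mult vector_scalar_commute)
qed

lemma smult_power_mono:
  assumes "omodule L" "m \<le> m'" "\<pi> ^ m *s v \<in> L"
  shows "\<pi> ^ m' *s v \<in> L"
proof -
  have "\<pi> ^ m' *s v = \<pi> ^ (m' - m) *s (\<pi> ^ m *s v)"
    using assms(2) by (simp add: vector_smult_assoc flip: power_add)
  then show ?thesis
    using omodule_smult [OF assms(1) pi_power_int assms(3)] by (simp only:)
qed

text \<open>Only the finitely many basis vectors of \<open>M\<close> have to be absorbed; the sum of
  their exponents serves for all of them.\<close>

lemma lattice_absorbs_lattice:
  fixes L M :: "('k ^ 'n) set"
  assumes "is_lattice L" "is_lattice M"
  shows "\<exists>m. smult_set (\<pi> ^ m) M \<subseteq> L"
proof -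
  note L = lattice_omodule [OF assms(1)]
  obtain g :: "'k ^ 'n ^ 'n" where g: "invertible g" "M = (\<lambda>v. g *v v) ` standard_lattice"
    using assms(2) is_lattice_iff by blast
  have "\<forall>i. \<exists>m. \<pi> ^ m *s column i g \<in> L"
    using lattice_absorbs [OF assms(1)] by blast
  then obtain m where m: "\<And>i. \<pi> ^ m i *s column i g \<in> L"
    by metis
  define s where "s = (\<Sum>j\<in>UNIV. m j)"
  have "m i \<le> s" for i
    unfolding s_def by (rule member_le_sum) auto
  from smult_power_mono [OF L this m] have s: "\<pi> ^ s *s column i g \<in> L" for i .
  have "\<pi> ^ s *s (g *v v) \<in> L" if "v \<in> standard_lattice" for v
  proof -
    have "\<pi> ^ s *s (g *v v) = (\<Sum>i\<in>UNIV. v $ i *s (\<pi> ^ s *s column i g))"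
      by (simp add: matrix_mult_sum vec.scale_sum_right vector_smult_assoc mult.commute)
    also have "\<dots> \<in> L"
      using that by (intro omodule_sum [OF L] omodule_smult [OF L _ s]) (auto simp: standard_lattice_def)
    finally show ?thesis .
  qed
  then show ?thesis
    using g(2) by auto
qed

lemma lattice_nonzero:
  fixes L :: "('k ^ 'n) set"
  assumes "is_lattice L"
  shows "\<exists>v\<in>L. v \<noteq> 0"
proof -
  obtain g :: "'k ^ 'n ^ 'n" where g: "invertible g" "L = (\<lambda>v. g *v v) ` standard_lattice"
    using assms is_lattice_iff by blast
  have "(1 :: 'k ^ 'n) \<in> standard_lattice" "(1 :: 'k ^ 'n) \<noteq> 0"
    by (auto simp: standard_lattice_def)
  then have "g *v 1 \<in> L" "g *v 1 \<noteq> 0"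
    using g by (auto simp: invertible_iff_ker)
  then show ?thesis
    by blast
qed

end

definition msum :: "('k::nonarch_lc_field ^ 'n) set \<Rightarrow> ('k ^ 'n) set \<Rightarrow> ('k ^ 'n) set"
  where "msum L M = {v + w | v w. v \<in> L \<and> w \<in> M}"

lemma omodule_msum:
  assumes "omodule L" "omodule M"
  shows "omodule (msum L M)"
  unfolding omodule_def
proof (intro conjI ballI)
  show "0 \<in> msum L M"
    using omodule_0 [OF assms(1)] omodule_0 [OF assms(2)] unfolding msum_def
    by (intro CollectI exI [of _ 0]) simp
  show "u + u' \<in> msum L M" if "u \<in> msum L M" "u' \<in> msum L M" for u u'
  proof -
    from \<open>u \<in> msum L M\<close> obtain v w where u: "u = v + w" "v \<in> L" "w \<in> M"
      unfolding msum_def by blast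
    from \<open>u' \<in> msum L M\<close> obtain v' w' where u': "u' = v' + w'" "v' \<in> L" "w' \<in> M"
      unfolding msum_def by blast
    have "u + u' = (v + v') + (w + w')" "v + v' \<in> L" "w + w' \<in> M"
      using u u' omodule_add assms by (simp_all add: algebra_simps)
    then show ?thesis
      unfolding msum_def by blast
  qed
  show "a *s u \<in> msum L M" if "a \<in> integers" "u \<in> msum L M" for a u
  proof -
    from \<open>u \<in> msum L M\<close> obtain v w where u: "u = v + w" "v \<in> L" "w \<in> M"
      unfolding msum_def by blast
    have "a *s u = a *s v + a *s w" "a *s v \<in> L" "a *s w \<in> M"
      using u omodule_smult assms \<open>a \<in> integers\<close> by (simp_all add: vector_add_ldistrib)
    then show ?thesis
      unfolding msum_def by blast
  qed
qed

lemma msum_upper: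
  assumes "omodule L" "omodule M"
  shows "L \<subseteq> msum L M" "M \<subseteq> msum L M"
proof -
  show "L \<subseteq> msum L M"
  proof
    fix v assume "v \<in> L"
    then show "v \<in> msum L M"
      using omodule_0 [OF assms(2)] unfolding msum_def by (intro CollectI exI [of _ v] exI [of _ 0]) simp
  qed
  show "M \<subseteq> msum L M"
  proof
    fix v assume "v \<in> M"
    then show "v \<in> msum L M"
      using omodule_0 [OF assms(1)] unfolding msum_def by (intro CollectI exI [of _ 0] exI [of _ v]) simp
  qed
qed

lemma msum_least: "omodule N \<Longrightarrow> L \<subseteq> N \<Longrightarrow> M \<subseteq> N \<Longrightarrow> msum L M \<subseteq> N"
  unfolding msum_def using omodule_add by blast

lemma mult_axis: "g *v axis j 1 = column j (g :: 'k::field ^ 'n ^ 'm)"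
proof -
  have "(\<Sum>i\<in>UNIV. g $ r $ i * axis j 1 $ i) = g $ r $ j" for r
  proof -
    have "(\<Sum>i\<in>UNIV. g $ r $ i * axis j 1 $ i) = (\<Sum>i\<in>UNIV. if i = j then g $ r $ i else 0)"
      by (rule sum.cong) (auto simp: axis_def)
    then show ?thesis
      by simp
  qed
  then show ?thesis
    by (simp add: matrix_vector_mult_def column_def vec_eq_iff)
qed

section \<open>Adapted bases, intermediate lattices and sums\<close>

context uniformizer
begin

text \<open>
  A basis of \<open>L\<close> with as many members as possible in \<open>Q\<close>: if some element of \<open>Q\<close> had a unit
  coordinate elsewhere, it could be exchanged for a further basis vector.
\<close>

lemma adapted_basis:
  fixes L Q :: "('k ^ 'n) set"
  assumes "is_lattice L" "Q \<subseteq> L"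
  obtains g :: "'k ^ 'n ^ 'n" and I where "invertible g" "L = (\<lambda>v. g *v v) ` standard_lattice"
    "\<And>i. i \<in> I \<Longrightarrow> column i g \<in> Q"
    "\<And>v i. g *v v \<in> Q \<Longrightarrow> i \<notin> I \<Longrightarrow> absv (v $ i) \<le> absv \<pi>"
proof -
  define P where "P = (\<lambda>(g :: 'k ^ 'n ^ 'n) I. invertible g \<and> L = (\<lambda>v. g *v v) ` standard_lattice \<and>
    (\<forall>i\<in>I. column i g \<in> Q))"
  define F where "F = {I. \<exists>g. P g I}"
  have "{} \<in> F"
    using assms(1) unfolding is_lattice_iff by (auto simp: F_def P_def)
  then obtain I where "I \<in> F" and max: "\<And>J. J \<in> F \<Longrightarrow> card J \<le> card I"
    using ex_has_greatest_nat [of "\<lambda>J. J \<in> F" "{}" card "Suc CARD('n)"] card_mono [of "UNIV :: 'n set"]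
    by (auto simp: less_Suc_eq_le)
  then obtain g where g: "P g I"
    by (auto simp: F_def)
  then have inv: "invertible g" and L: "L = (\<lambda>v. g *v v) ` standard_lattice"
    and cI: "\<And>i. i \<in> I \<Longrightarrow> column i g \<in> Q"
    by (auto simp: P_def)
  have "absv (v $ i) \<le> absv \<pi>" if v: "g *v v \<in> Q" and i: "i \<notin> I" for v i
  proof (rule ccontr)
    assume no: "\<not> absv (v $ i) \<le> absv \<pi>"
    have "g *v v \<in> (\<lambda>v. g *v v) ` standard_lattice"
      using v assms(2) L by blast
    then have vs: "v \<in> standard_lattice"
      by (simp add: mem_image_mult [OF inv] matrix_inv_props(4) [OF inv])
    then have "v $ i \<in> integers"
      by (simp add: standard_lattice_def)
    then have vi: "absv (v $ i) = 1"
      using unit_or_dvd no by blast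
    \<comment> \<open>\<open>E\<close> below sends \<open>axis i 1\<close> to \<open>v\<close> and
      fixes the other axes; \<open>u\<close> is the displacement.\<close>
    define u where "u = v - axis i 1"
    define E :: "'k ^ 'n ^ 'n" where "E = mat 1 + (\<chi> r c. if c = i then u $ r else 0)"
    have E: "E *v w = w + w $ i *s u" for w
    proof -
      have "(\<Sum>j\<in>UNIV. (if j = i then u $ r else 0) * w $ j) = w $ i * u $ r" for r
      proof -
        have "(\<Sum>j\<in>UNIV. (if j = i then u $ r else 0) * w $ j)
            = (\<Sum>j\<in>UNIV. if j = i then w $ i * u $ r else 0)"
          by (rule sum.cong) auto
        then show ?thesis
          by simp
      qed
      then have "(\<chi> r c. if c = i then u $ r else 0) *v w = w $ i *s u"
        by (simp add: matrix_vector_mult_def vec_eq_iff)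
      then show ?thesis
        by (simp add: E_def matrix_vector_mult_add_rdistrib)
    qed
    have us: "u \<in> standard_lattice"
      using vs unfolding u_def
      by (auto simp: standard_lattice_def axis_def intro: integers_diff)
    have ui: "u $ i = v $ i - 1"
      by (simp add: u_def)
    have vi0: "v $ i \<noteq> 0"
      using vi by auto
    have "w = 0" if "E *v w = 0" for w
    proof -
      have "(E *v w) $ i = 0"
        using that by simp
      then have "w $ i = 0"
        using vi0 by (simp add: E ui algebra_simps)
      then show ?thesis
        using that by (simp add: E)
    qed
    then have invE: "invertible E"
      by (simp add: invertible_iff_ker)
    have "(\<lambda>v. E *v v) ` standard_lattice = standard_lattice"
    proof
      show "(\<lambda>v. E *v v) ` standard_lattice \<subseteq> standard_lattice"
        using us omodule_add [OF omodule_standard] omodule_smult [OF omodule_standard]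
        by (auto simp: E) (auto simp: standard_lattice_def integers_add integers_mult)
      show "standard_lattice \<subseteq> (\<lambda>v. E *v v) ` standard_lattice"
      proof
        fix d :: "'k ^ 'n" assume d: "d \<in> standard_lattice"
        \<comment> \<open>The \<open>i\<close>-th coordinate of the image of \<open>w\<close> under
          \<open>E\<close> is \<open>v $ i * w $ i\<close>. This determines the \<open>i\<close>-th
          coordinate of the preimage, which is integral because \<open>v $ i\<close> is a
          unit.\<close>
        define t where "t = d $ i / v $ i"
        have t: "t \<in> integers"
          using d vi by (simp add: t_def standard_lattice_def integers_def absv_divide)
        have "(d - t *s u) $ i = t"
          using vi0 by (simp add: t_def ui field_simps)
        then have "E *v (d - t *s u) = d"
          by (simp add: E)
        moreover have "d - t *s u \<in> standard_lattice"
          by (intro omodule_diff omodule_smult omodule_standard d t us)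
        ultimately show "d \<in> (\<lambda>v. E *v v) ` standard_lattice"
          by (metis imageI)
      qed
    qed
    then have "L = (\<lambda>v. g *v v) ` ((\<lambda>v. E *v v) ` standard_lattice)"
      by (simp add: L)
    then have LE: "L = (\<lambda>v. (g ** E) *v v) ` standard_lattice"
      by (simp add: image_image matrix_vector_mul_assoc)
    have "column j (g ** E) \<in> Q" if "j \<in> insert i I" for j
    proof (cases "j = i")
      case True
      have "column i (g ** E) = g *v (E *v axis i 1)"
        by (simp add: matrix_vector_mul_assoc flip: mult_axis)
      also have "E *v axis i 1 = v"
        by (simp add: E u_def)
      finally show ?thesis
        using v True by simp
    next
      case False
      have "column j (g ** E) = g *v (E *v axis j 1)"
        by (simp add: matrix_vector_mul_assoc flip: mult_axis)
      also have "E *v axis j 1 = axis j 1"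
        using False by (simp add: E axis_def)
      finally show ?thesis
        using cI that False by (simp add: mult_axis)
    qed
    then have "P (g ** E) (insert i I)"
      using LE invertible_mult [OF inv invE] by (simp add: P_def)
    then have "insert i I \<in> F"
      by (auto simp: F_def)
    from max [OF this] show False
      using i by simp
  qed
  then show ?thesis
    using that [OF inv L cI] by blast
qed

text \<open>A basis of \<open>L\<close> adapted to \<open>N\<close> becomes one of \<open>N\<close>
  after multiplying the vectors outside \<open>I\<close> by \<open>\<pi>\<close>: the elementary
  divisors of \<open>N\<close> in \<open>L\<close> are 1 and \<open>\<pi>\<close> only.\<close>

lemma lattice_between:
  fixes L N :: "('k ^ 'n) set"
  assumes "is_lattice L" "omodule N" "smult_set \<pi> L \<subseteq> N" "N \<subseteq> L"
  shows "is_lattice N"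
proof -
  obtain g :: "'k ^ 'n ^ 'n" and I where g: "invertible g" "L = (\<lambda>v. g *v v) ` standard_lattice"
    "\<And>i. i \<in> I \<Longrightarrow> column i g \<in> N"
    "\<And>v i. g *v v \<in> N \<Longrightarrow> i \<notin> I \<Longrightarrow> absv (v $ i) \<le> absv \<pi>"
    using adapted_basis [OF assms(1,4)] by metis
  define t where "t i = (if i \<in> I then 1 else \<pi>)" for i
  have t0: "t i \<noteq> 0" for i
    by (simp add: t_def)
  define D :: "'k ^ 'n ^ 'n" where "D = (\<chi> r c. if r = c then t r else 0)"
  have D: "(D *v w) $ r = t r * w $ r" for w r
  proof -
    have "(\<Sum>j\<in>UNIV. (if r = j then t r else 0) * w $ j) = (\<Sum>j\<in>UNIV. if r = j then t r * w $ r else 0)"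
      by (rule sum.cong) auto
    then show ?thesis
      by (simp add: D_def matrix_vector_mult_def)
  qed
  then have invD: "invertible D"
    using t0 by (simp add: invertible_iff_ker vec_eq_iff)
  have col: "t i *s column i g \<in> N" for i
  proof (cases "i \<in> I")
    case True
    then show ?thesis
      using g(3) by (simp add: t_def)
  next
    case False
    have "column i g \<in> L"
      unfolding g(2) by (metis axis_standard imageI mult_axis)
    then show ?thesis
      using False assms(3) by (auto simp: t_def)
  qed
  have "N = (\<lambda>v. (g ** D) *v v) ` standard_lattice"
  proof
    show "N \<subseteq> (\<lambda>v. (g ** D) *v v) ` standard_lattice"
    proof
      fix u assume u: "u \<in> N"
      then obtain v where v: "v \<in> standard_lattice" "u = g *v v"
        using assms(4) g(2) by blast
      define w where "w = (\<chi> i. v $ i / t i)"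
      have "absv (v $ i) \<le> absv (t i)" for i
        using v g(4) [of v i] u by (auto simp: t_def standard_lattice_def integers_def)
      then have "w \<in> standard_lattice"
        using t0 by (simp add: w_def standard_lattice_def integers_def absv_divide divide_le_eq_1)
      moreover have "D *v w = v"
        using t0 by (simp add: vec_eq_iff D w_def)
      ultimately show "u \<in> (\<lambda>v. (g ** D) *v v) ` standard_lattice"
        using v(2) by (intro image_eqI [of _ _ w]) (simp_all flip: matrix_vector_mul_assoc)
    qed
    show "(\<lambda>v. (g ** D) *v v) ` standard_lattice \<subseteq> N"
    proof
      fix u assume "u \<in> (\<lambda>v. (g ** D) *v v) ` standard_lattice"
      then obtain w where w: "w \<in> standard_lattice" "u = g *v (D *v w)"
        by (auto simp: matrix_vector_mul_assoc)
      have "u = (\<Sum>i\<in>UNIV. w $ i *s (t i *s column i g))"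
        by (simp add: w(2) matrix_mult_sum [of g] D vector_smult_assoc mult.commute)
      also have "\<dots> \<in> N"
        using w(1) by (intro omodule_sum omodule_smult assms(2) col) (simp add: standard_lattice_def)
      finally show "u \<in> N" .
    qed
  qed
  then show ?thesis
    unfolding is_lattice_iff using invertible_mult [OF g(1) invD] by (intro exI [of _ "g ** D"] conjI)
qed

lemma smult_pi_subset: "omodule L \<Longrightarrow> smult_set \<pi> L \<subseteq> L"
  using smult_set_subset [of L \<pi> 1] absv_pi_lt_1 by simp

text \<open>Multiplied by \<open>\<pi>\<close>, the sum lies between \<open>\<pi> L\<close> and
  \<open>L\<close>, where \<open>lattice_between\<close> applies.\<close>

lemma lattice_msum:
  fixes L M :: "('k ^ 'n) set"
  assumes "is_lattice L" "is_lattice M" "smult_set \<pi> M \<subseteq> L"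
  shows "is_lattice (msum L M)"
proof -
  note L = lattice_omodule [OF assms(1)] and M = lattice_omodule [OF assms(2)]
  note up = msum_upper [OF L M]
  have "smult_set \<pi> (msum L M) \<subseteq> L"
  proof
    fix u assume "u \<in> smult_set \<pi> (msum L M)"
    then obtain v w where u: "u = \<pi> *s v + \<pi> *s w" "v \<in> L" "w \<in> M"
      unfolding msum_def by (auto simp: vector_add_ldistrib)
    have "\<pi> *s v \<in> L" "\<pi> *s w \<in> L"
      using u assms(3) smult_pi_subset [OF L] by auto
    then show "u \<in> L"
      unfolding u(1) by (rule omodule_add [OF L])
  qed
  moreover have "smult_set \<pi> L \<subseteq> smult_set \<pi> (msum L M)"
    using up(1) by (rule image_mono)
  ultimately have "is_lattice (smult_set \<pi> (msum L M))"
    by (intro lattice_between [OF assms(1)] omodule_smult_set omodule_msum L M)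
  then have "is_lattice (smult_set (inverse \<pi>) (smult_set \<pi> (msum L M)))"
    by (rule lattice_smult_set) simp
  then show ?thesis
    by (simp add: smult_smult_set)
qed

section \<open>Normalized representatives of homothety classes, and finiteness\<close>

definition normalized :: "('k ^ 'n) set \<Rightarrow> bool"
  where "normalized L \<longleftrightarrow> is_lattice L \<and> L \<subseteq> standard_lattice \<and> \<not> L \<subseteq> smult_set \<pi> standard_lattice"

text \<open>Discreteness of the values: \<open>absv c < absv d\<close> already gives
  \<open>absv c \<le> absv (\<pi> * d)\<close>. This gap is what tells homothetic lattices apart in
  chains and in normal forms.\<close>

lemma lattice_smult_mono:
  fixes L :: "('k ^ 'n) set"
  assumes "omodule L" "c \<noteq> 0" "d \<noteq> 0"
  shows "smult_set c L = smult_set d L \<or> smult_set c L \<subseteq> smult_set (\<pi> * d) L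
    \<or> smult_set d L \<subseteq> smult_set (\<pi> * c) L"
proof -
  consider "absv c = absv d" | "absv (c / d) < 1" | "absv (d / c) < 1"
    using assms(2,3) by (fastforce simp: absv_divide divide_less_eq_1)
  then show ?thesis
  proof cases
    case 1
    then show ?thesis
      using smult_set_eq [OF assms(1)] by blast
  next
    case 2
    then have "absv c \<le> absv (\<pi> * d)"
      using absv_lt_1_imp_le [OF 2] assms(3) by (simp add: absv_divide absv_mult divide_le_eq)
    then show ?thesis
      using smult_set_subset [OF assms(1)] by blast
  next
    case 3
    then have "absv d \<le> absv (\<pi> * c)"
      using absv_lt_1_imp_le [OF 3] assms(2) by (simp add: absv_divide absv_mult divide_le_eq)
    then show ?thesis
      using smult_set_subset [OF assms(1)] by blast
  qed
qed

text \<open>Otherwise one of the two lattices would lie in \<open>\<pi>\<close> times the other,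
  hence in \<open>\<pi>\<close> times the standard lattice.\<close>

lemma normalized_unique:
  assumes "normalized L" "normalized (smult_set c L)" "c \<noteq> 0"
  shows "smult_set c L = L"
proof -
  have L: "omodule L" "L \<subseteq> standard_lattice" "\<not> L \<subseteq> smult_set \<pi> standard_lattice"
    using assms(1) lattice_omodule by (auto simp: normalized_def)
  have cL: "smult_set c L \<subseteq> standard_lattice" "\<not> smult_set c L \<subseteq> smult_set \<pi> standard_lattice"
    using assms(2) by (auto simp: normalized_def)
  consider "smult_set c L = L" | "smult_set c L \<subseteq> smult_set \<pi> L" | "L \<subseteq> smult_set \<pi> (smult_set c L)"
    using lattice_smult_mono [OF L(1) assms(3) one_neq_zero] unfolding smult_smult_set mult_1_right smult_set_1
    by blast
  then show ?thesis
  proof cases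
    case 2
    then show ?thesis
      using cL(2) image_mono [OF L(2), of "\<lambda>v. \<pi> *s v"] by blast
  next
    case 3
    then show ?thesis
      using L(3) image_mono [OF cL(1), of "\<lambda>v. \<pi> *s v"] by blast
  qed
qed

lemma ex_normalized:
  fixes L :: "('k ^ 'n) set"
  assumes "is_lattice L"
  shows "\<exists>c. c \<noteq> 0 \<and> normalized (smult_set c L)"
proof -
  note L = lattice_omodule [OF assms]
  obtain m where m: "smult_set (\<pi> ^ m) L \<subseteq> standard_lattice"
    using lattice_absorbs_lattice [OF lattice_standard assms] by blast
  obtain v where v: "v \<in> L" "v \<noteq> 0"
    using lattice_nonzero [OF assms] by blast
  then obtain i where i: "v $ i \<noteq> 0"
    by (auto simp: vec_eq_iff)
  \<comment> \<open>The powers of \<open>\<pi>\<close> that can be taken out of the lattice. A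
    nonzero coordinate bounds them, and the last one gives the normalizing factor.\<close>
  define S where "S = {t. smult_set (\<pi> ^ m) L \<subseteq> smult_set (\<pi> ^ t) standard_lattice}"
  have "0 < absv (\<pi> ^ m * v $ i)"
    using i by simp
  then obtain s where s: "absv \<pi> ^ s < absv (\<pi> ^ m * v $ i)"
    using real_arch_pow_inv absv_pi_lt_1 by blast
  have "t < s" if "t \<in> S" for t
  proof (rule ccontr)
    assume "\<not> t < s"
    have "\<pi> ^ m *s v \<in> smult_set (\<pi> ^ t) standard_lattice"
      using that v(1) unfolding S_def by blast
    then obtain w where w: "w \<in> standard_lattice" "\<pi> ^ m *s v = \<pi> ^ t *s w"
      by blast
    then have "\<pi> ^ m * v $ i = \<pi> ^ t * w $ i"
      by (metis vector_smult_component)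
    then have "absv (\<pi> ^ m * v $ i) \<le> absv \<pi> ^ t"
      using w(1) by (simp add: absv_mult absv_power mult_left_le standard_lattice_def integers_def)
    also have "\<dots> \<le> absv \<pi> ^ s"
      using \<open>\<not> t < s\<close> absv_pi_lt_1 by (intro power_decreasing) auto
    finally show False
      using s by simp
  qed
  then have "finite S"
    by (meson bounded_nat_set_is_finite)
  moreover have "0 \<in> S"
    using m by (simp add: S_def)
  ultimately obtain t where t: "t \<in> S" "Suc t \<notin> S"
    by (metis Max_ge Max_in Suc_n_not_le_n empty_iff)
  \<comment> \<open>This is \<open>\<pi>\<close> to the exponent \<open>m - t\<close>, which may be
    negative.\<close>
  define c where "c = inverse (\<pi> ^ t) * \<pi> ^ m"
  have "\<pi> ^ t * c = \<pi> ^ m"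
    by (simp add: c_def field_simps)
  then have c: "smult_set (\<pi> ^ t) (smult_set c L) = smult_set (\<pi> ^ m) L"
    unfolding smult_smult_set by (simp only:)
  have "smult_set (\<pi> ^ t) (smult_set c L) \<subseteq> smult_set (\<pi> ^ t) standard_lattice"
    using t(1) unfolding c S_def by simp
  then have 1: "smult_set c L \<subseteq> standard_lattice"
    by (subst (asm) smult_set_mono_iff) simp_all
  have 2: "\<not> smult_set c L \<subseteq> smult_set \<pi> standard_lattice"
  proof
    assume "smult_set c L \<subseteq> smult_set \<pi> standard_lattice"
    then have "smult_set (\<pi> ^ t) (smult_set c L) \<subseteq> smult_set (\<pi> ^ t) (smult_set \<pi> standard_lattice)"
      by (rule image_mono)
    then show False
      using t(2) unfolding c S_def by (simp add: smult_smult_set mult.commute)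
  qed
  have "c \<noteq> 0"
    by (simp add: c_def)
  then show ?thesis
    using 1 2 lattice_smult_set [OF assms] unfolding normalized_def by blast
qed

lemma finite_lattice_residues:
  fixes L :: "('k ^ 'n) set"
  assumes "is_lattice L"
  shows "\<exists>R. finite R \<and> R \<subseteq> L \<and> (\<forall>v\<in>L. \<exists>r\<in>R. v - r \<in> smult_set (\<pi> ^ m) L)"
proof -
  obtain g :: "'k ^ 'n ^ 'n" where g: "invertible g" "L = (\<lambda>v. g *v v) ` standard_lattice"
    using assms is_lattice_iff by blast
  obtain R0 :: "'k set" where R0: "finite R0" "R0 \<subseteq> integers"
      "\<And>a. a \<in> integers \<Longrightarrow> \<exists>r\<in>R0. absv (a - r) \<le> absv \<pi> ^ m"
    using finite_residues [of m] by metis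
  define R1 :: "('k ^ 'n) set" where "R1 = vec_lambda ` (UNIV \<rightarrow>\<^sub>E R0)"
  have "finite R1"
    using R0(1) by (simp add: R1_def finite_PiE)
  moreover have "R1 \<subseteq> standard_lattice"
    using R0(2) by (auto simp: R1_def standard_lattice_def PiE_def Pi_def)
  moreover have "\<exists>r\<in>R1. v - r \<in> smult_set (\<pi> ^ m) standard_lattice" if "v \<in> standard_lattice" for v
  proof -
    have "\<forall>i. \<exists>r\<in>R0. absv (v $ i - r) \<le> absv \<pi> ^ m"
      using that R0(3) by (auto simp: standard_lattice_def)
    then obtain f where f: "\<And>i. f i \<in> R0" "\<And>i. absv (v $ i - f i) \<le> absv \<pi> ^ m"
      by metis
    have "vec_lambda f \<in> R1"
      using f(1) by (auto simp: R1_def)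
    moreover have "v - vec_lambda f \<in> smult_set (\<pi> ^ m) standard_lattice"
      using f(2) by (simp add: mem_smult_set standard_lattice_def integers_def absv_mult absv_inverse
          absv_power absv_divide divide_le_eq_1 field_simps)
    ultimately show ?thesis
      by blast
  qed
  ultimately have R1: "finite R1" "R1 \<subseteq> standard_lattice"
    "\<And>v. v \<in> standard_lattice \<Longrightarrow> \<exists>r\<in>R1. v - r \<in> smult_set (\<pi> ^ m) standard_lattice"
    by auto
  show ?thesis
  proof (intro exI [of _ "(\<lambda>v. g *v v) ` R1"] conjI ballI)
    show "finite ((\<lambda>v. g *v v) ` R1)"
      using R1(1) by simp
    show "(\<lambda>v. g *v v) ` R1 \<subseteq> L"
      using R1(2) g(2) by blast
    fix v assume "v \<in> L"
    then obtain w where w: "w \<in> standard_lattice" "v = g *v w"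
      using g(2) by blast
    then obtain r where r: "r \<in> R1" "w - r \<in> smult_set (\<pi> ^ m) standard_lattice"
      using R1(3) by blast
    have "v - g *v r = g *v (w - r)"
      by (simp add: w(2) matrix_vector_mult_diff_distrib)
    then have "v - g *v r \<in> smult_set (\<pi> ^ m) L"
      using r(2) unfolding g(2) image_mult_smult_set [symmetric] by (metis imageI)
    then show "\<exists>r\<in>(\<lambda>v. g *v v) ` R1. v - r \<in> smult_set (\<pi> ^ m) L"
      using r(1) by blast
  qed
qed

text \<open>Each such \<open>N\<close> contains \<open>\<pi> ^ m\<close> times \<open>M\<close>, so
  it is a union of cosets and determined by its members among the finitely many representatives
  \<open>R\<close>.\<close>

lemma finite_lattices_between:
  fixes L M :: "('k ^ 'n) set"
  assumes "is_lattice L" "is_lattice M"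
  shows "finite {N. is_lattice N \<and> L \<subseteq> N \<and> N \<subseteq> M}"
proof -
  obtain m where m: "smult_set (\<pi> ^ m) M \<subseteq> L"
    using lattice_absorbs_lattice [OF assms] by blast
  obtain R where R: "finite R" "\<And>v. v \<in> M \<Longrightarrow> \<exists>r\<in>R. v - r \<in> smult_set (\<pi> ^ m) M"
    using finite_lattice_residues [OF assms(2), of m] by metis
  let ?F = "{N. is_lattice N \<and> L \<subseteq> N \<and> N \<subseteq> M}"
  have sub: "N \<subseteq> N'" if N: "N \<in> ?F" and N': "N' \<in> ?F" and eq: "N \<inter> R = N' \<inter> R" for N N'
  proof
    fix v assume v: "v \<in> N"
    then obtain r where r: "r \<in> R" "v - r \<in> smult_set (\<pi> ^ m) M"
      using N R(2) by blast
    then have d: "v - r \<in> N" "v - r \<in> N'"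
      using m N N' by auto
    have "v - (v - r) \<in> N"
      using omodule_diff [OF lattice_omodule v d(1)] N by simp
    then have "r \<in> N'"
      using r(1) eq by auto
    then show "v \<in> N'"
      using omodule_add [OF lattice_omodule d(2), of r] N' by simp
  qed
  have "inj_on (\<lambda>N. N \<inter> R) ?F"
    using sub by (intro inj_onI subset_antisym) (metis (no_types, lifting))+
  moreover have "(\<lambda>N. N \<inter> R) ` ?F \<subseteq> Pow R"
    by blast
  ultimately show ?thesis
    using R(1) by (meson finite_Pow_iff finite_subset finite_imageD)
qed

end

lemma matrix_mult_add_rdistrib: "(A + B) ** C = A ** C + B ** (C :: 'k::ring_1 ^ 'n ^ 'm)"
  by (simp add: matrix_matrix_mult_def vec_eq_iff algebra_simps sum.distrib)

lemma matrix_mult_diff_ldistrib: "A ** (B - C) = A ** B - A ** (C :: 'k::ring_1 ^ 'n ^ 'm)"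
  by (simp add: matrix_matrix_mult_def vec_eq_iff algebra_simps sum_subtractf)

lemma matrix_mult_diff_rdistrib: "(A - B) ** C = A ** C - B ** (C :: 'k::ring_1 ^ 'n ^ 'm)"
  by (simp add: matrix_matrix_mult_def vec_eq_iff algebra_simps sum_subtractf)

section \<open>Congruence subgroups\<close>

context uniformizer
begin

text \<open>Described by the action on \<open>L\<close> and not by matrix entries, so that it makes
  sense for any lattice and behaves well under conjugation. For \<open>m \<ge> 1\<close>, stability
  of a lattice under inverses is a consequence, see \<open>cong_group_inv\<close>.\<close>

definition cong_group :: "nat \<Rightarrow> ('k ^ 'n) set \<Rightarrow> ('k ^ 'n ^ 'n) set"
  where "cong_group m L = {g. invertible g \<and> (\<forall>v\<in>L. g *v v - v \<in> smult_set (\<pi> ^ m) L)}"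

lemma cong_groupD:
  "g \<in> cong_group m L \<Longrightarrow> invertible g"
  "g \<in> cong_group m L \<Longrightarrow> v \<in> L \<Longrightarrow> g *v v - v \<in> smult_set (\<pi> ^ m) L"
  by (auto simp: cong_group_def)

lemma smult_power_subset: "omodule L \<Longrightarrow> m \<le> m' \<Longrightarrow> smult_set (\<pi> ^ m') L \<subseteq> smult_set (\<pi> ^ m) L"
  using absv_pi_lt_1 by (intro smult_set_subset) (auto simp: absv_power intro: power_decreasing)

lemma smult_power_subset_self: "omodule L \<Longrightarrow> smult_set (\<pi> ^ m) L \<subseteq> L"
  using smult_power_subset [of L 0 m] by simp

lemma cong_group_stable:
  assumes "omodule L" "g \<in> cong_group m L" "v \<in> L"
  shows "g *v v \<in> L"
proof -
  have "g *v v - v \<in> L"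
    using cong_groupD(2) [OF assms(2,3)] smult_power_subset_self [OF assms(1)] by blast
  then have "(g *v v - v) + v \<in> L"
    using assms(1,3) omodule_add by blast
  then show ?thesis
    by simp
qed

lemma mat_1_cong_group: "omodule L \<Longrightarrow> mat 1 \<in> cong_group m L"
  using omodule_0 [OF omodule_smult_set] by (auto simp: cong_group_def invertible_iff_ker)

lemma cong_group_antimono: "omodule L \<Longrightarrow> m \<le> m' \<Longrightarrow> cong_group m' L \<subseteq> cong_group m L"
  using smult_power_subset unfolding cong_group_def by blast

lemma mult_smult_power_stable:
  fixes L :: "('k ^ 'n) set" and g :: "'k ^ 'n ^ 'n"
  assumes "\<And>v. v \<in> L \<Longrightarrow> g *v v \<in> M" "w \<in> smult_set c L"
  shows "g *v w \<in> smult_set c M"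
  using assms by (auto simp: vector_scalar_commute)

lemma mult_smult_minus_smult: "g *v (c *s v) - c *s v = c *s (g *v v - v)" for g :: "'k ^ 'n ^ 'n"
  by (simp add: vector_scalar_commute)

lemma cong_group_mult:
  assumes "omodule L" "g \<in> cong_group m L" "h \<in> cong_group m L"
  shows "g ** h \<in> cong_group m L"
proof -
  have "(g ** h) *v v - v \<in> smult_set (\<pi> ^ m) L" if v: "v \<in> L" for v
  proof -
    have "(g ** h) *v v - v = g *v (h *v v - v) + (g *v v - v)"
      by (simp add: matrix_vector_mult_diff_distrib matrix_vector_mul_assoc)
    also have "\<dots> \<in> smult_set (\<pi> ^ m) L"
    proof (rule omodule_add [OF omodule_smult_set [OF assms(1)] _ cong_groupD(2) [OF assms(2) v]])
      show "g *v (h *v v - v) \<in> smult_set (\<pi> ^ m) L"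
        by (rule mult_smult_power_stable [OF _ cong_groupD(2) [OF assms(3) v]])
          (rule cong_group_stable [OF assms(1,2)])
    qed
    finally show ?thesis .
  qed
  then show ?thesis
    using invertible_mult cong_groupD(1) assms(2,3) by (auto simp: cong_group_def)
qed

text \<open>Induction on the denominator of \<open>w\<close>. If \<open>\<pi> ^ Suc s *s w\<close>
  is in \<open>L\<close>, then \<open>g - 1\<close> maps it into \<open>\<pi> L\<close>; after
  division by \<open>\<pi>\<close>, \<open>g\<close> changes \<open>\<pi> ^ s *s w\<close> only by
  an element of \<open>L\<close>.\<close>

lemma cong_group_inj:
  fixes L :: "('k ^ 'n) set"
  assumes "is_lattice L" "m \<ge> 1" "g \<in> cong_group m L" "g *v w \<in> L"
  shows "w \<in> L"
proof -
  note L = lattice_omodule [OF assms(1)]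
  have "w \<in> L" if "g *v w \<in> L" "\<pi> ^ s *s w \<in> L" for s w
    using that
  proof (induction s)
    case (Suc s)
    have "\<pi> *s (\<pi> ^ s *s w) \<in> L"
      using Suc.prems(2) by (simp add: vector_smult_assoc)
    then have "g *v (\<pi> *s (\<pi> ^ s *s w)) - \<pi> *s (\<pi> ^ s *s w) \<in> smult_set (\<pi> ^ 1) L"
      using cong_groupD(2) [OF assms(3)] smult_power_subset [OF L assms(2)] by blast
    then have "g *v (\<pi> ^ s *s w) - \<pi> ^ s *s w \<in> L"
      by (simp only: mult_smult_minus_smult smult_mem_smult_set [OF pi_nz] power_one_right)
    moreover have "g *v (\<pi> ^ s *s w) \<in> L"
      using omodule_smult [OF L pi_power_int Suc.prems(1)] by (simp add: vector_scalar_commute)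
    ultimately have "g *v (\<pi> ^ s *s w) - (g *v (\<pi> ^ s *s w) - \<pi> ^ s *s w) \<in> L"
      by (rule omodule_diff [OF L, rotated])
    then show ?case
      using Suc.IH [OF Suc.prems(1)] by (simp only: diff_diff_eq2 add_diff_cancel_left')
  qed simp
  then show ?thesis
    using lattice_absorbs [OF assms(1), of w] assms(4) by blast
qed

text \<open>The congruence for \<open>g\<close> is applied to \<open>matrix_inv g *v v\<close>,
  which lies in \<open>L\<close> by \<open>cong_group_inj\<close>.\<close>

lemma cong_group_inv:
  fixes L :: "('k ^ 'n) set"
  assumes "is_lattice L" "m \<ge> 1" "g \<in> cong_group m L"
  shows "matrix_inv g \<in> cong_group m L"
proof -
  note L = lattice_omodule [OF assms(1)]
  note inv = matrix_inv_props [OF cong_groupD(1) [OF assms(3)]]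
  have "matrix_inv g *v v - v \<in> smult_set (\<pi> ^ m) L" if "v \<in> L" for v
  proof -
    have "matrix_inv g *v v \<in> L"
      by (rule cong_group_inj [OF assms]) (simp add: inv that)
    from cong_groupD(2) [OF assms(3) this]
    have "v - matrix_inv g *v v \<in> smult_set (\<pi> ^ m) L"
      by (simp add: inv)
    from omodule_minus [OF omodule_smult_set [OF L] this] show ?thesis
      by simp
  qed
  then show ?thesis
    using inv(3) by (simp add: cong_group_def)
qed

lemma cong_group_image:
  fixes L :: "('k ^ 'n) set"
  assumes "is_lattice L" "m \<ge> 1" "g \<in> cong_group m L"
  shows "(\<lambda>v. g *v v) ` L = L"
proof
  show "(\<lambda>v. g *v v) ` L \<subseteq> L"
    using cong_group_stable [OF lattice_omodule [OF assms(1)] assms(3)] by blast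
  show "L \<subseteq> (\<lambda>v. g *v v) ` L"
    using cong_group_stable [OF lattice_omodule [OF assms(1)] cong_group_inv [OF assms]]
    by (auto simp: mem_image_mult [OF cong_groupD(1) [OF assms(3)]])
qed

lemma cong_group_conj:
  fixes L :: "('k ^ 'n) set" and g :: "'k ^ 'n ^ 'n"
  assumes "u \<in> cong_group m L" "invertible g"
  shows "g ** u ** matrix_inv g \<in> cong_group m ((\<lambda>v. g *v v) ` L)"
proof -
  note inv = matrix_inv_props [OF assms(2)]
  have "(g ** u ** matrix_inv g) *v (g *v v) - g *v v \<in> smult_set (\<pi> ^ m) ((\<lambda>v. g *v v) ` L)"
    if "v \<in> L" for v
  proof -
    have "(g ** u ** matrix_inv g) *v (g *v v) - g *v v = g *v (u *v v - v)"
      by (simp add: matrix_vector_mult_diff_distrib inv flip: matrix_vector_mul_assoc)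
    then show ?thesis
      using cong_groupD(2) [OF assms(1) that] unfolding image_mult_smult_set [symmetric] by (metis imageI)
  qed
  then show ?thesis
    using invertible_mult [OF invertible_mult [OF assms(2) cong_groupD(1) [OF assms(1)]] inv(3)]
    by (auto simp: cong_group_def)
qed

text \<open>By linearity the factor \<open>c\<close> cancels. The group therefore belongs to the
  vertex and not to its representative.\<close>

lemma cong_group_smult_set:
  fixes L :: "('k ^ 'n) set"
  assumes "c \<noteq> 0"
  shows "cong_group m (smult_set c L) = cong_group m L"
proof -
  have "g *v (c *s v) - c *s v \<in> smult_set (\<pi> ^ m) (smult_set c L) \<longleftrightarrow> g *v v - v \<in> smult_set (\<pi> ^ m) L"
    for g :: "'k ^ 'n ^ 'n" and v
  proof -
    have "smult_set (\<pi> ^ m) (smult_set c L) = smult_set c (smult_set (\<pi> ^ m) L)"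
      by (simp add: smult_smult_set mult.commute)
    then show ?thesis
      unfolding mult_smult_minus_smult by (simp only: smult_mem_smult_set [OF assms])
  qed
  then show ?thesis
    by (simp add: cong_group_def)
qed

text \<open>One factor \<open>\<pi>\<close> is spent on moving \<open>v\<close> from
  \<open>L\<close> into \<open>M\<close> and another on returning from \<open>M\<close> to
  \<open>L\<close>, which leaves \<open>\<pi> ^ (m - 2)\<close>. This is what demands level at least
  2.\<close>

lemma cong_group_image_adjacent:
  fixes L M :: "('k ^ 'n) set"
  assumes "is_lattice L" "is_lattice M" "smult_set \<pi> L \<subseteq> M" "smult_set \<pi> M \<subseteq> L" "m \<ge> 2"
    "u \<in> cong_group m M"
  shows "(\<lambda>v. u *v v) ` L = L"
proof -
  note L = lattice_omodule [OF assms(1)] and M = lattice_omodule [OF assms(2)]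
  have m: "m = Suc (Suc (m - 2))"
    using assms(5) by simp
  have stable: "g *v v \<in> L" if g: "g \<in> cong_group m M" and v: "v \<in> L" for g v
  proof -
    have "\<pi> *s v \<in> M"
      using v assms(3) by blast
    then have "g *v (\<pi> *s v) - \<pi> *s v \<in> smult_set (\<pi> ^ m) M"
      by (rule cong_groupD(2) [OF g])
    then have "\<pi> *s (g *v v - v) \<in> smult_set (\<pi> ^ m) M"
      by (simp only: mult_smult_minus_smult)
    also have "smult_set (\<pi> ^ m) M = smult_set \<pi> (smult_set (\<pi> ^ (m - 2)) (smult_set \<pi> M))"
      by (subst m) (simp add: smult_smult_set mult.commute mult.left_commute)
    finally have "g *v v - v \<in> smult_set (\<pi> ^ (m - 2)) (smult_set \<pi> M)"
      by (simp only: smult_mem_smult_set [OF pi_nz])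
    also have "\<dots> \<subseteq> smult_set (\<pi> ^ (m - 2)) L"
      using assms(4) by (rule image_mono)
    also have "\<dots> \<subseteq> L"
      by (rule smult_power_subset_self [OF L])
    finally have "(g *v v - v) + v \<in> L"
      using omodule_add [OF L] v by blast
    then show ?thesis
      by simp
  qed
  show ?thesis
  proof
    show "(\<lambda>v. u *v v) ` L \<subseteq> L"
      using stable [OF assms(6)] by blast
    have "matrix_inv u \<in> cong_group m M"
      using cong_group_inv [OF assms(2) _ assms(6)] assms(5) by simp
    from stable [OF this] show "L \<subseteq> (\<lambda>v. u *v v) ` L"
      by (auto simp: mem_image_mult [OF cong_groupD(1) [OF assms(6)]])
  qed
qed

lemma cong_group_standardI:
  fixes g :: "'k ^ 'n ^ 'n"
  assumes "invertible g" "\<And>i j. absv ((g - mat 1) $ i $ j) \<le> absv \<pi> ^ m"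
  shows "g \<in> cong_group m standard_lattice"
proof -
  have "g *v v - v \<in> smult_set (\<pi> ^ m) standard_lattice" if "v \<in> standard_lattice" for v
  proof -
    have "absv (((g - mat 1) *v v) $ i) \<le> absv \<pi> ^ m" for i
      unfolding matrix_vector_mult_def vec_lambda_beta
    proof (rule absv_sum_le)
      fix j
      have "absv ((g - mat 1) $ i $ j) * absv (v $ j) \<le> absv \<pi> ^ m * 1"
        using that assms(2) by (intro mult_mono) (auto simp: standard_lattice_def integers_def)
      then show "absv ((g - mat 1) $ i $ j * v $ j) \<le> absv \<pi> ^ m"
        by (simp add: absv_mult)
    qed simp
    moreover have "(g - mat 1) *v v = g *v v - v"
      by (simp add: matrix_vector_mult_diff_rdistrib)
    ultimately have "absv ((g *v v - v) $ i) \<le> absv \<pi> ^ m" for i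
      by metis
    then show ?thesis
      by (simp add: mem_smult_set standard_lattice_def integers_def absv_mult absv_inverse
          absv_power absv_divide divide_le_eq_1 field_simps)
  qed
  then show ?thesis
    using assms(1) by (simp add: cong_group_def)
qed

text \<open>
  In coordinates: \<open>u - 1\<close> is integral modulo \<open>\<pi>^m\<close> except for its block from the coordinates
  outside \<open>I\<close> to those in \<open>I\<close>. That block has square zero, so splitting it off factors \<open>u\<close>.
\<close>

lemma cong_group_msum_standard:
  fixes M :: "('k ^ 'n) set" and u :: "'k ^ 'n ^ 'n"
  assumes M: "omodule M" "\<And>i. i \<in> I \<Longrightarrow> axis i 1 \<in> smult_set \<pi> M"
    "\<And>v i. v \<in> smult_set \<pi> M \<Longrightarrow> v \<in> standard_lattice"
    "\<And>v i. v \<in> smult_set \<pi> M \<Longrightarrow> i \<notin> I \<Longrightarrow> absv (v $ i) \<le> absv \<pi>"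
    and u: "u \<in> cong_group m (msum standard_lattice M)" and m: "m \<ge> 1"
  shows "\<exists>a b. a \<in> cong_group m standard_lattice \<and> b \<in> cong_group m M \<and> u = a ** b"
proof -
  let ?N = "msum standard_lattice M"
  have N: "omodule ?N"
    by (intro omodule_msum omodule_standard M(1))
  note up = msum_upper [OF omodule_standard M(1)]
  \<comment> \<open>Outside \<open>I\<close> the coordinates of the sum are still integral; inside
    \<open>I\<close> one factor \<open>\<pi>\<close> may stand in the denominator
    (\<open>N_in\<close>).\<close>
  have N_out: "absv (v $ i) \<le> 1" if "v \<in> ?N" "i \<notin> I" for v i
  proof -
    from that(1) obtain x y where xy: "v = x + y" "x \<in> standard_lattice" "y \<in> M"
      unfolding msum_def by blast
    have "absv \<pi> * absv (y $ i) \<le> absv \<pi>"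
      using M(4) [OF imageI [OF xy(3)] that(2)] by (simp add: absv_mult)
    then have "absv (y $ i) \<le> 1"
      by simp
    moreover have "absv (x $ i) \<le> 1"
      using xy(2) by (simp add: standard_lattice_def integers_def)
    ultimately show ?thesis
      using absv_ultrametric [of "x $ i" "y $ i"] xy(1) by simp
  qed
  have N_in: "absv \<pi> * absv (v $ i) \<le> 1" if "v \<in> ?N" for v i
  proof -
    from that(1) obtain x y where xy: "v = x + y" "x \<in> standard_lattice" "y \<in> M"
      unfolding msum_def by blast
    have "\<pi> *s x \<in> standard_lattice" "\<pi> *s y \<in> standard_lattice"
      using omodule_smult [OF omodule_standard pi_int xy(2)] M(3) [OF imageI [OF xy(3)]] by simp_all
    then have "\<pi> *s v \<in> standard_lattice"
      using omodule_add [OF omodule_standard] by (simp add: xy(1) vector_add_ldistrib)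
    then show ?thesis
      by (simp add: standard_lattice_def integers_def absv_mult)
  qed
  define A where "A = u - mat 1"
  \<comment> \<open>The block for which only the weaker bound \<open>A2\<close> is available. Rows
    outside \<open>I\<close> are controlled by \<open>A1\<close>, and columns in \<open>I\<close> by
    \<open>A3\<close>, since there \<open>axis j 1\<close> divided by \<open>\<pi>\<close> lies in
    \<open>M\<close>.\<close>
  define B :: "'k ^ 'n ^ 'n" where "B = (\<chi> i j. if i \<in> I \<and> j \<notin> I then A $ i $ j else 0)"
  have A_axis: "(u *v axis j 1 - axis j 1) $ i = A $ i $ j" for i j
    by (simp only: mult_axis) (simp add: A_def column_def mat_def axis_def)
  have A_mem: "\<exists>w\<in>?N. c *s (u *v axis j 1 - axis j 1) = \<pi> ^ m *s w" if "c *s axis j 1 \<in> ?N" for j c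
  proof -
    have "u *v (c *s axis j 1) - c *s axis j 1 \<in> smult_set (\<pi> ^ m) ?N"
      by (rule cong_groupD(2) [OF u that])
    then show ?thesis
      by (auto simp only: mult_smult_minus_smult)
  qed
  have A_entry: "\<exists>w\<in>?N. c * A $ i $ j = \<pi> ^ m * w $ i" if "c *s axis j 1 \<in> ?N" for i j c
    using A_mem [OF that] by (metis A_axis vector_smult_component)
  have axisN: "1 *s axis j 1 \<in> ?N" for j
    using up(1) axis_standard by auto
  have A1: "absv (A $ i $ j) \<le> absv \<pi> ^ m" if "i \<notin> I" for i j
  proof -
    obtain w where "w \<in> ?N" "A $ i $ j = \<pi> ^ m * w $ i"
      using A_entry [OF axisN] by auto
    then show ?thesis
      using N_out [of w i] that by (simp add: absv_mult absv_power mult_left_le)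
  qed
  have A2: "absv \<pi> * absv (A $ i $ j) \<le> absv \<pi> ^ m" for i j
  proof -
    obtain w where w: "w \<in> ?N" "A $ i $ j = \<pi> ^ m * w $ i"
      using A_entry [OF axisN] by auto
    have "absv \<pi> * absv (A $ i $ j) = absv \<pi> ^ m * (absv \<pi> * absv (w $ i))"
      by (simp add: w(2) absv_mult absv_power)
    also have "\<dots> \<le> absv \<pi> ^ m * 1"
      by (intro mult_left_mono N_in w(1)) simp
    finally show ?thesis
      by simp
  qed
  have A3: "absv (A $ i $ j) \<le> absv \<pi> ^ m" if "j \<in> I" for i j
  proof -
    have "inverse \<pi> *s axis j 1 \<in> M"
      using M(2) [OF that] by (simp add: mem_smult_set)
    then have "inverse \<pi> *s axis j 1 \<in> ?N"
      using up(2) by blast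
    from A_entry [OF this] obtain w where w: "w \<in> ?N" "inverse \<pi> * A $ i $ j = \<pi> ^ m * w $ i"
      by blast
    then have "A $ i $ j = \<pi> * (\<pi> ^ m * w $ i)"
      by (simp add: field_simps)
    then have "absv (A $ i $ j) = absv \<pi> ^ m * (absv \<pi> * absv (w $ i))"
      by (simp add: absv_mult absv_power)
    also have "\<dots> \<le> absv \<pi> ^ m * 1"
      by (intro mult_left_mono N_in w(1)) simp
    finally show ?thesis
      by simp
  qed
  have BB: "B ** B = 0"
  proof -
    have "B $ i $ l * B $ l $ j = 0" for i l j
      by (simp add: B_def)
    then show ?thesis
      by (simp add: matrix_matrix_mult_def vec_eq_iff sum.neutral)
  qed
  define b where "b = mat 1 + B"
  define b' where "b' = mat 1 - B"
  have bb: "b ** b' = mat 1" "b' ** b = mat 1"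
    using BB by (simp_all add: b_def b'_def matrix_add_ldistrib matrix_mult_diff_ldistrib
        matrix_mult_add_rdistrib matrix_mult_diff_rdistrib)
  \<comment> \<open>The image of \<open>B\<close> lives in the coordinates \<open>I\<close>, where
    \<open>M\<close> contains the axes divided by \<open>\<pi>\<close>; that makes up for the factor
    missing in \<open>A2\<close>.\<close>
  have b: "b \<in> cong_group m M"
  proof -
    have "b *v v - v \<in> smult_set (\<pi> ^ m) M" if v: "v \<in> M" for v
    proof -
      have "b *v v - v = B *v v"
        by (simp add: b_def matrix_vector_mult_add_rdistrib)
      also have "B *v v = (\<Sum>i\<in>I. (B *v v) $ i *s axis i 1)"
      proof -
        have "(\<Sum>i\<in>I. (B *v v) $ i *s axis i 1) $ r = (B *v v) $ r" for r
        proof -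
          have "(\<Sum>i\<in>I. (B *v v) $ i *s axis i 1) $ r = (\<Sum>i\<in>I. if i = r then (B *v v) $ r else 0)"
            unfolding sum_component by (rule sum.cong) (auto simp: axis_def)
          also have "\<dots> = (B *v v) $ r"
            by (simp add: B_def matrix_vector_mult_def)
          finally show ?thesis .
        qed
        then show ?thesis
          by (simp add: vec_eq_iff)
      qed
      also have "\<dots> \<in> smult_set (\<pi> ^ m) M"
      proof (rule omodule_sum [OF omodule_smult_set [OF M(1)]])
        fix i assume i: "i \<in> I"
        have "absv \<pi> * absv ((B *v v) $ i) \<le> absv \<pi> ^ m"
        proof -
          have "absv (\<pi> * (B *v v) $ i) \<le> absv \<pi> ^ m"
            unfolding matrix_vector_mult_def vec_lambda_beta sum_distrib_left
          proof (rule absv_sum_le)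
            fix j
            show "absv (\<pi> * (B $ i $ j * v $ j)) \<le> absv \<pi> ^ m"
            proof (cases "j \<in> I")
              case False
              have "absv (v $ j) \<le> 1"
                using N_out [of v j] up(2) v False by blast
              then have "(absv \<pi> * absv (A $ i $ j)) * absv (v $ j) \<le> absv \<pi> ^ m * 1"
                by (intro mult_mono A2) simp_all
              then show ?thesis
                using i False by (simp add: B_def absv_mult mult.assoc)
            qed (simp add: B_def)
          qed simp
          then show ?thesis
            by (simp add: absv_mult)
        qed
        then have "(B *v v) $ i * \<pi> / \<pi> ^ m \<in> integers"
          by (simp add: integers_def absv_mult absv_divide absv_power divide_le_eq_1 mult.commute)
        moreover have "inverse \<pi> *s axis i 1 \<in> M"
          using M(2) [OF i] by (simp add: mem_smult_set)
        ultimately have "((B *v v) $ i * \<pi> / \<pi> ^ m) *s (inverse \<pi> *s axis i 1) \<in> M"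
          by (rule omodule_smult [OF M(1)])
        then show "(B *v v) $ i *s axis i 1 \<in> smult_set (\<pi> ^ m) M"
          by (simp add: mem_smult_set vector_smult_assoc field_simps)
      qed
      finally show ?thesis .
    qed
    moreover have "invertible b"
      using bb unfolding invertible_def by blast
    ultimately show ?thesis
      by (simp add: cong_group_def)
  qed
  have a: "u ** b' \<in> cong_group m standard_lattice"
  proof (rule cong_group_standardI)
    have "invertible b'"
      using bb unfolding invertible_def by blast
    then show "invertible (u ** b')"
      using invertible_mult cong_groupD(1) [OF u] by blast
    fix i j
    have u_eq: "u = mat 1 + A"
      by (simp add: A_def)
    \<comment> \<open>The bad block cancels in \<open>A - B\<close>. In \<open>A ** B\<close> the
      left factor enters through its columns in \<open>I\<close>, bounded by \<open>A3\<close>, and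
      \<open>B\<close> is integral because \<open>m \<ge> 1\<close>.\<close>
    have "u ** b' - mat 1 = (A - B) - A ** B"
      unfolding b'_def u_eq by (simp add: matrix_mult_diff_ldistrib matrix_mult_add_rdistrib)
    moreover have "absv ((A - B) $ i $ j) \<le> absv \<pi> ^ m"
      using A1 A3 by (auto simp: B_def)
    moreover have "absv ((A ** B) $ i $ j) \<le> absv \<pi> ^ m"
      unfolding matrix_matrix_mult_def vec_lambda_beta
    proof (rule absv_sum_le)
      fix l
      show "absv (A $ i $ l * B $ l $ j) \<le> absv \<pi> ^ m"
      proof (cases "l \<in> I \<and> j \<notin> I")
        case True
        have "absv \<pi> * absv (A $ l $ j) \<le> absv \<pi>"
          using order_trans [OF A2 [of l j]] power_decreasing [OF m, of "absv \<pi>"] absv_pi_lt_1 by simp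
        then have "absv (A $ l $ j) \<le> 1"
          by simp
        then have "absv (A $ i $ l) * absv (A $ l $ j) \<le> absv \<pi> ^ m * 1"
          using A3 True by (intro mult_mono) simp_all
        then show ?thesis
          using True by (simp add: B_def absv_mult)
      qed (auto simp: B_def)
    qed simp
    ultimately show "absv ((u ** b' - mat 1) $ i $ j) \<le> absv \<pi> ^ m"
      using absv_diff_le [of "(A - B) $ i $ j" "(A ** B) $ i $ j"] by simp
  qed
  have "u = (u ** b') ** b"
    using bb by (simp flip: matrix_mul_assoc)
  then show ?thesis
    using a b by blast
qed

text \<open>In a basis of \<open>L\<close> adapted to \<open>\<pi> M\<close> both modules take the
  shape handled in coordinates; conjugation by the basis matrix carries the factorization
  back.\<close>

lemma cong_group_msum:
  fixes L M :: "('k ^ 'n) set"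
  assumes L: "is_lattice L" and M: "omodule M" "smult_set \<pi> M \<subseteq> L"
    and u: "u \<in> cong_group m (msum L M)" and m: "m \<ge> 1"
  shows "\<exists>a b. a \<in> cong_group m L \<and> b \<in> cong_group m M \<and> u = a ** b"
proof -
  obtain g :: "'k ^ 'n ^ 'n" and I where g: "invertible g" "L = (\<lambda>v. g *v v) ` standard_lattice"
    "\<And>i. i \<in> I \<Longrightarrow> column i g \<in> smult_set \<pi> M"
    "\<And>v i. g *v v \<in> smult_set \<pi> M \<Longrightarrow> i \<notin> I \<Longrightarrow> absv (v $ i) \<le> absv \<pi>"
    using adapted_basis [OF L M(2)] by metis
  note inv = matrix_inv_props [OF g(1)]
  let ?h = "matrix_inv g"
  note hh = matrix_inv_matrix_inv [OF g(1)]
  define M' where "M' = (\<lambda>v. ?h *v v) ` M"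
  have M_eq: "M = (\<lambda>v. g *v v) ` M'"
    by (simp add: M'_def image_image inv)
  have mem: "v \<in> smult_set \<pi> M' \<longleftrightarrow> g *v v \<in> smult_set \<pi> M" for v
    unfolding M'_def image_mult_smult_set [symmetric] mem_image_mult [OF inv(3)] hh ..
  have sum: "msum standard_lattice M' = (\<lambda>v. ?h *v v) ` msum L M"
  proof
    show "msum standard_lattice M' \<subseteq> (\<lambda>v. ?h *v v) ` msum L M"
    proof
      fix x assume "x \<in> msum standard_lattice M'"
      then obtain v w where vw: "x = v + w" "v \<in> standard_lattice" "w \<in> M'"
        unfolding msum_def by blast
      then have "g *v v \<in> L" "g *v w \<in> M"
        using g(2) M_eq by blast+
      then have "g *v v + g *v w \<in> msum L M"
        unfolding msum_def by blast
      then show "x \<in> (\<lambda>v. ?h *v v) ` msum L M"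
        by (simp add: mem_image_mult [OF inv(3)] hh vw(1) matrix_vector_right_distrib)
    qed
    show "(\<lambda>v. ?h *v v) ` msum L M \<subseteq> msum standard_lattice M'"
    proof
      fix x assume "x \<in> (\<lambda>v. ?h *v v) ` msum L M"
      then obtain v w where vw: "x = ?h *v (v + w)" "v \<in> L" "w \<in> M"
        unfolding msum_def by blast
      then have "?h *v v \<in> standard_lattice" "?h *v w \<in> M'"
        by (auto simp: g(2) M'_def inv)
      then show "x \<in> msum standard_lattice M'"
        unfolding vw(1) matrix_vector_right_distrib msum_def by blast
    qed
  qed
  have "\<exists>a b. a \<in> cong_group m standard_lattice \<and> b \<in> cong_group m M' \<and> ?h ** u ** matrix_inv ?h = a ** b"
  proof (rule cong_group_msum_standard [where I = I])
    show "omodule M'"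
      unfolding M'_def by (rule omodule_image_mult [OF M(1)])
    show "axis i 1 \<in> smult_set \<pi> M'" if "i \<in> I" for i
      using g(3) [OF that] by (simp add: mem mult_axis)
    show "absv (v $ i) \<le> absv \<pi>" if "v \<in> smult_set \<pi> M'" "i \<notin> I" for v i
      using g(4) that by (simp add: mem)
    show "v \<in> standard_lattice" if "v \<in> smult_set \<pi> M'" for v
    proof -
      have "g *v v \<in> L"
        using that M(2) unfolding mem by blast
      then show ?thesis
        by (simp add: g(2) mem_image_mult [OF g(1)] inv)
    qed
    show "?h ** u ** matrix_inv ?h \<in> cong_group m (msum standard_lattice M')"
      unfolding sum by (rule cong_group_conj [OF u inv(3)])
  qed (fact m)
  then obtain a b where ab: "a \<in> cong_group m standard_lattice" "b \<in> cong_group m M'"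
    "?h ** u ** g = a ** b"
    unfolding hh by blast
  have "u = g ** (?h ** u ** g) ** ?h"
    using inv(1) by (simp add: matrix_mul_assoc) (simp add: inv(1) flip: matrix_mul_assoc)
  also have "\<dots> = (g ** a ** ?h) ** (g ** b ** ?h)"
    unfolding ab(3) by (simp add: matrix_mul_assoc) (metis inv(2) matrix_mul_assoc matrix_mul_rid)
  finally have "u = (g ** a ** ?h) ** (g ** b ** ?h)" .
  moreover have "g ** a ** ?h \<in> cong_group m L"
    unfolding g(2) by (rule cong_group_conj [OF ab(1) g(1)])
  moreover have "g ** b ** ?h \<in> cong_group m M"
    unfolding M_eq by (rule cong_group_conj [OF ab(2) g(1)])
  ultimately show ?thesis
    by blast
qed

end

section \<open>Averaging over finite quotients\<close>

text \<open>The exponent \<open>N\<close> is generous: the multiplicity of \<open>r\<close> in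
  \<open>N\<close> is less than \<open>r ^ multiplicity r N\<close>, which is at most
  \<open>N\<close>.\<close>

lemma dvd_power_if_primes_dvd:
  fixes N p :: nat
  assumes "N > 0" "p > 0" "\<And>r. prime r \<Longrightarrow> r dvd N \<Longrightarrow> r dvd p"
  shows "N dvd p ^ N"
proof (rule multiplicity_le_imp_dvd)
  show "N \<noteq> 0"
    using assms(1) by simp
  fix r :: nat assume r: "prime r"
  show "multiplicity r N \<le> multiplicity r (p ^ N)"
  proof (cases "r dvd N")
    case True
    have "r ^ multiplicity r N dvd N"
      by (rule multiplicity_dvd)
    then have "r ^ multiplicity r N \<le> N"
      using assms(1) by (rule dvd_imp_le)
    moreover have "multiplicity r N < r ^ multiplicity r N"
      using prime_gt_1_nat [OF r] by (simp add: power_gt_expt)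
    ultimately have "multiplicity r N \<le> N"
      by simp
    moreover have "1 \<le> multiplicity r p"
      using multiplicity_geI [of p r 1] assms(2) assms(3) [OF r True] prime_gt_1_nat [OF r] by simp
    then have "N \<le> N * multiplicity r p"
      using mult_le_mono2 [of 1 "multiplicity r p" N] by simp
    ultimately show ?thesis
      using r assms(2) by (simp add: prime_elem_multiplicity_power_distrib le_trans)
  qed (simp add: not_dvd_imp_multiplicity_0)
qed

text \<open>A prime \<open>r\<close> dividing the order is the order of some element, by Sylow's
  theorem; so \<open>r\<close> divides \<open>p ^ q\<close> and hence \<open>p\<close>. The argument
  works for any positive \<open>p\<close>.\<close>

lemma (in group) order_dvd_power:
  fixes p q :: nat
  assumes "finite (carrier G)" "p > 0" "\<And>x. x \<in> carrier G \<Longrightarrow> x [^] (p ^ q) = \<one>"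
  shows "\<exists>M. order G dvd p ^ M"
proof -
  have "order G > 0"
    using assms(1) by (simp add: order_gt_0_iff_finite)
  moreover have "r dvd p" if r: "prime r" "r dvd order G" for r :: nat
  proof -
    obtain m where "order G = r ^ 1 * m"
      using r(2) by (auto elim: dvdE)
    from sylow_thm [OF r(1) is_group this assms(1)]
    obtain H where H: "subgroup H G" "card H = r"
      by auto
    interpret H: group "G\<lparr>carrier := H\<rparr>"
      using H(1) by (rule subgroup_imp_group)
    have "card H \<noteq> 1"
      using H(2) r(1) by auto
    then have "H \<noteq> {\<one>}"
      by auto
    then obtain x where x: "x \<in> H" "x \<noteq> \<one>"
      using subgroup.one_closed [OF H(1)] by blast
    have xG: "x \<in> carrier G"
      using x(1) subgroup.subset [OF H(1)] by blast
    have "x [^] r = \<one>"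
      using H.pow_order_eq_1 [of x] x(1) H(2) by (simp add: order_def flip: nat_pow_consistent)
    then have "ord x dvd r"
      using xG by (simp add: pow_eq_id)
    moreover have "ord x \<noteq> 1"
      using x(2) by (simp only: ord_eq_1 [OF xG] simp_thms)
    ultimately have "ord x = r"
      using r(1) by (metis prime_nat_iff)
    moreover have "ord x dvd p ^ q"
      using assms(3) [OF xG] xG by (simp add: pow_eq_id)
    ultimately show ?thesis
      using r(1) prime_dvd_power by blast
  qed
  ultimately show ?thesis
    using dvd_power_if_primes_dvd [OF _ assms(2)] by blast
qed

section \<open>Averaging in modules over the integers with \<open>p\<close> inverted\<close>

lemma Z_inv_1: "1 \<in> Z_inv p"
  unfolding Z_inv_def by (intro CollectI exI [of _ 1] exI [of _ 0]) simp

lemma Z_inv_of_nat: "of_nat m \<in> Z_inv p"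
  unfolding Z_inv_def by (intro CollectI exI [of _ "int m"] exI [of _ 0]) simp

lemma Z_inv_minus_1: "- 1 \<in> Z_inv p"
  unfolding Z_inv_def by (intro CollectI exI [of _ "- 1"] exI [of _ 0]) simp

lemma Z_inv_0: "0 \<in> Z_inv p"
  using Z_inv_of_nat [of 0] by simp

lemma Z_inv_inverse:
  assumes "N dvd p ^ M" "p > 0"
  shows "1 / of_nat N \<in> Z_inv p"
proof -
  obtain s where s: "p ^ M = N * s"
    using assms(1) by (elim dvdE)
  then have "s \<noteq> 0"
    using assms(2) by (metis mult_0_right power_not_zero less_numeral_extra(3))
  have "(of_nat p :: rat) ^ M = of_nat N * of_nat s"
    using s by (metis of_nat_mult of_nat_power)
  then have "1 / of_nat N = (of_int (int s) / of_nat p ^ M :: rat)"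
    using \<open>s \<noteq> 0\<close> by (cases "N = 0") (simp_all add: field_simps)
  then show ?thesis
    unfolding Z_inv_def by blast
qed

context Z_inv_module
begin

lemma scl_zero_right: "r \<in> Z_inv p \<Longrightarrow> scl r 0 = 0"
  using scl_add_right [of r 0 0] by simp

lemma scl_zero_left: "scl 0 v = 0"
  using scl_add_left [of 0 0 v] by (simp add: Z_inv_0)

lemma scl_sum: "r \<in> Z_inv p \<Longrightarrow> scl r (sum f A) = (\<Sum>a\<in>A. scl r (f a))"
  by (induction A rule: infinite_finite_induct) (simp_all add: scl_zero_right scl_add_right)

lemma scl_of_nat: "scl (of_nat (card A)) v = (\<Sum>a\<in>A. v)"
proof (induction A rule: infinite_finite_induct)
  case (insert x F)
  then show ?case
    using scl_add_left [OF Z_inv_1 Z_inv_of_nat [of "card F"]] by (simp add: scl_one)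
qed (simp_all add: scl_zero_left)

lemma scl_minus_1: "scl (- 1) v = - v"
proof -
  have "scl (- 1 + 1) v = scl (- 1) v + v"
    by (subst scl_add_left) (simp_all add: Z_inv_1 Z_inv_minus_1 scl_one)
  then show ?thesis
    by (simp add: scl_zero_left eq_neg_iff_add_eq_0)
qed

lemma scl_average:
  assumes "finite A" "A \<noteq> {}" "1 / of_nat (card A) \<in> Z_inv p"
  shows "scl (1 / of_nat (card A)) (\<Sum>a\<in>A. v) = v"
  using assms by (simp add: scl_scl Z_inv_of_nat scl_one flip: scl_of_nat)

definition linear_map :: "('v \<Rightarrow> 'v) \<Rightarrow> bool"
  where "linear_map T \<longleftrightarrow> (\<forall>v w. T (v + w) = T v + T w) \<and> (\<forall>r\<in>Z_inv p. \<forall>v. T (scl r v) = scl r (T v))"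

lemma linear_map_add: "linear_map T \<Longrightarrow> T (v + w) = T v + T w"
  and linear_map_scl: "linear_map T \<Longrightarrow> r \<in> Z_inv p \<Longrightarrow> T (scl r v) = scl r (T v)"
  by (simp_all add: linear_map_def)

lemma linear_map_0: "linear_map T \<Longrightarrow> T 0 = 0"
  using linear_map_add [of T 0 0] by simp

lemma linear_map_sum: "linear_map T \<Longrightarrow> T (sum f A) = (\<Sum>a\<in>A. T (f a))"
  by (induction A rule: infinite_finite_induct) (simp_all add: linear_map_0 linear_map_add)

lemma linear_map_comp: "linear_map S \<Longrightarrow> linear_map T \<Longrightarrow> linear_map (\<lambda>v. S (T v))"
  by (simp add: linear_map_def)

text \<open>
  The last clause says that \<open>e v\<close> is a linear combination of the translates of \<open>v\<close>.
\<close>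

definition averages :: "('g \<Rightarrow> 'v \<Rightarrow> 'v) \<Rightarrow> 'g set \<Rightarrow> ('v \<Rightarrow> 'v) \<Rightarrow> bool"
  where "averages \<sigma> H e \<longleftrightarrow> linear_map e \<and> (\<forall>v. \<forall>h\<in>H. \<sigma> h (e v) = e v) \<and>
    (\<forall>v. (\<forall>h\<in>H. \<sigma> h v = v) \<longrightarrow> e v = v) \<and> (\<forall>v. \<forall>h\<in>H. e (\<sigma> h v) = e v) \<and>
    (\<forall>T v. linear_map T \<longrightarrow> (\<forall>h\<in>H. T (\<sigma> h v) = T v) \<longrightarrow> T (e v) = T v)"

text \<open>\<open>e\<close> averages over chosen coset representatives. Only for vectors fixed by
  \<open>N\<close> is the choice immaterial, so only there is invariance under \<open>G\<close>
  claimed; the other clauses hold for any choice.\<close>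

lemma average_over_quotient:
  fixes G :: "('g, 'b) monoid_scheme" and \<sigma> :: "'g \<Rightarrow> 'v \<Rightarrow> 'v"
  assumes N: "N \<lhd> G" and fin: "finite (carrier (G Mod N))"
    and Z: "1 / of_nat (card (carrier (G Mod N))) \<in> Z_inv p"
    and lin: "\<And>g. g \<in> carrier G \<Longrightarrow> linear_map (\<sigma> g)"
    and mult: "\<And>g h v. g \<in> carrier G \<Longrightarrow> h \<in> carrier G \<Longrightarrow> \<sigma> (g \<otimes>\<^bsub>G\<^esub> h) v = \<sigma> g (\<sigma> h v)"
  shows "\<exists>e. linear_map e \<and> (\<forall>v. (\<forall>g\<in>carrier G. \<sigma> g v = v) \<longrightarrow> e v = v) \<and>
    (\<forall>v. (\<forall>g\<in>N. \<sigma> g v = v) \<longrightarrow> (\<forall>g\<in>carrier G. \<sigma> g (e v) = e v \<and> e (\<sigma> g v) = e v)) \<and>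
    (\<forall>T v. linear_map T \<longrightarrow> (\<forall>g\<in>carrier G. T (\<sigma> g v) = T v) \<longrightarrow> T (e v) = T v)"
proof -
  interpret N: normal N G
    by (rule N)
  interpret Q: group "G Mod N"
    by (rule N.factorgroup_is_group)
  let ?Q = "carrier (G Mod N)"
  have Q: "?Q = (\<lambda>g. N #>\<^bsub>G\<^esub> g) ` carrier G"
    by (auto simp: FactGroup_def RCOSETS_def)
  define rep where "rep C = (SOME g. g \<in> carrier G \<and> C = N #>\<^bsub>G\<^esub> g)" for C
  have rep: "rep C \<in> carrier G \<and> C = N #>\<^bsub>G\<^esub> rep C" if "C \<in> ?Q" for C
    unfolding rep_def by (rule someI_ex) (use that Q in blast)
  define e where "e v = scl (1 / of_nat (card ?Q)) (\<Sum>C\<in>?Q. \<sigma> (rep C) v)" for v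
  have Q_ne: "?Q \<noteq> {}"
    using Q.one_closed by blast
  have avg: "scl (1 / of_nat (card ?Q)) (\<Sum>C\<in>?Q. v) = v" for v
    by (rule scl_average [OF fin Q_ne Z])
  have lin_e: "linear_map e"
    unfolding linear_map_def
  proof (intro conjI allI ballI)
    show "e (v + w) = e v + e w" for v w
    proof -
      have "(\<Sum>C\<in>?Q. \<sigma> (rep C) (v + w)) = (\<Sum>C\<in>?Q. \<sigma> (rep C) v + \<sigma> (rep C) w)"
        by (rule sum.cong) (use rep lin linear_map_add in auto)
      then show ?thesis
        by (simp add: e_def sum.distrib scl_add_right Z)
    qed
    show "e (scl r v) = scl r (e v)" if r: "r \<in> Z_inv p" for r v
    proof -
      have "(\<Sum>C\<in>?Q. \<sigma> (rep C) (scl r v)) = (\<Sum>C\<in>?Q. scl r (\<sigma> (rep C) v))"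
        by (rule sum.cong) (use rep lin linear_map_scl r in auto)
      then show ?thesis
        by (simp add: e_def scl_scl Z r mult.commute flip: scl_sum)
    qed
  qed
  have e_T: "T (e v) = T v" if T: "linear_map T" "\<And>g. g \<in> carrier G \<Longrightarrow> T (\<sigma> g v) = T v" for T v
  proof -
    have "T (e v) = scl (1 / of_nat (card ?Q)) (\<Sum>C\<in>?Q. T (\<sigma> (rep C) v))"
      using T(1) by (simp add: e_def linear_map_scl Z linear_map_sum)
    also have "(\<Sum>C\<in>?Q. T (\<sigma> (rep C) v)) = (\<Sum>C\<in>?Q. T v)"
      by (rule sum.cong) (use rep T(2) in auto)
    finally show ?thesis
      by (simp add: avg)
  qed
  have e_fix: "e v = v" if "\<And>g. g \<in> carrier G \<Longrightarrow> \<sigma> g v = v" for v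
  proof -
    have "(\<Sum>C\<in>?Q. \<sigma> (rep C) v) = (\<Sum>C\<in>?Q. v)"
      by (rule sum.cong) (use rep that in auto)
    then show ?thesis
      by (simp add: e_def avg)
  qed
  have fixed: "\<sigma> g (e v) = e v" "e (\<sigma> g v) = e v"
    if v: "\<And>n. n \<in> N \<Longrightarrow> \<sigma> n v = v" and g: "g \<in> carrier G" for v g
  proof -
    have NG: "n \<in> carrier G" if "n \<in> N" for n
      using that N.subset by blast
    \<comment> \<open>By normality the representative of the coset of \<open>a\<close> differs from
      \<open>a\<close> by a factor in \<open>N\<close> on the right, which fixes
      \<open>v\<close>.\<close>
    have coset: "\<sigma> (rep (N #>\<^bsub>G\<^esub> a)) v = \<sigma> a v" if a: "a \<in> carrier G" for a
    proof -
      have *: "N #>\<^bsub>G\<^esub> a \<in> ?Q"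
        using a by (simp add: Q)
      have "rep (N #>\<^bsub>G\<^esub> a) \<in> N #>\<^bsub>G\<^esub> rep (N #>\<^bsub>G\<^esub> a)"
        using rep [OF *] N.subgroup_axioms by (intro N.rcos_self) auto
      then have "rep (N #>\<^bsub>G\<^esub> a) \<in> a <#\<^bsub>G\<^esub> N"
        using rep [OF *] N.coset_eq a by auto
      then obtain n where n: "n \<in> N" "rep (N #>\<^bsub>G\<^esub> a) = a \<otimes>\<^bsub>G\<^esub> n"
        by (auto simp: l_coset_def)
      then show ?thesis
        using mult [OF a NG [OF n(1)]] v by simp
    qed
    have gQ: "N #>\<^bsub>G\<^esub> g \<in> ?Q"
      using g by (simp add: Q)
    have r_mult: "\<sigma> (rep ((N #>\<^bsub>G\<^esub> g) \<otimes>\<^bsub>G Mod N\<^esub> C)) v = \<sigma> g (\<sigma> (rep C) v)"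
      "\<sigma> (rep (C \<otimes>\<^bsub>G Mod N\<^esub> (N #>\<^bsub>G\<^esub> g))) v = \<sigma> (rep C) (\<sigma> g v)" if C: "C \<in> ?Q" for C
    proof -
      have "(N #>\<^bsub>G\<^esub> g) \<otimes>\<^bsub>G Mod N\<^esub> C = N #>\<^bsub>G\<^esub> (g \<otimes>\<^bsub>G\<^esub> rep C)"
        "C \<otimes>\<^bsub>G Mod N\<^esub> (N #>\<^bsub>G\<^esub> g) = N #>\<^bsub>G\<^esub> (rep C \<otimes>\<^bsub>G\<^esub> g)"
        using rep [OF C] N.rcos_sum g by (simp_all add: FactGroup_def) (metis)+
      then show "\<sigma> (rep ((N #>\<^bsub>G\<^esub> g) \<otimes>\<^bsub>G Mod N\<^esub> C)) v = \<sigma> g (\<sigma> (rep C) v)"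
        "\<sigma> (rep (C \<otimes>\<^bsub>G Mod N\<^esub> (N #>\<^bsub>G\<^esub> g))) v = \<sigma> (rep C) (\<sigma> g v)"
        using rep [OF C] g by (simp_all add: coset mult)
    qed
    have fin_bij: "bij_betw f ?Q ?Q" if "inj_on f ?Q" "f ` ?Q \<subseteq> ?Q" for f
      using that endo_inj_surj [OF fin] by (simp add: bij_betw_def)
    \<comment> \<open>Left and right translation by the class of \<open>g\<close> permute the finite
      quotient; the first yields \<open>\<sigma> g (e v) = e v\<close>, the second
      \<open>e (\<sigma> g v) = e v\<close>.\<close>
    have bij: "bij_betw (\<lambda>C. (N #>\<^bsub>G\<^esub> g) \<otimes>\<^bsub>G Mod N\<^esub> C) ?Q ?Q"
      "bij_betw (\<lambda>C. C \<otimes>\<^bsub>G Mod N\<^esub> (N #>\<^bsub>G\<^esub> g)) ?Q ?Q"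
      using Q.inj_on_cmult [OF gQ] Q.inj_on_multc [OF gQ] Q.m_closed gQ by (intro fin_bij; blast)+
    have "\<sigma> g (e v) = scl (1 / of_nat (card ?Q)) (\<Sum>C\<in>?Q. \<sigma> g (\<sigma> (rep C) v))"
      using lin [OF g] by (simp add: e_def linear_map_scl Z linear_map_sum)
    also have "(\<Sum>C\<in>?Q. \<sigma> g (\<sigma> (rep C) v)) = (\<Sum>C\<in>?Q. \<sigma> (rep ((N #>\<^bsub>G\<^esub> g) \<otimes>\<^bsub>G Mod N\<^esub> C)) v)"
      by (rule sum.cong [OF refl], rule sym, rule r_mult(1))
    also have "\<dots> = (\<Sum>C\<in>?Q. \<sigma> (rep C) v)"
      by (rule sum.reindex_bij_betw [OF bij(1)])
    finally show "\<sigma> g (e v) = e v"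
      by (simp add: e_def)
    have "(\<Sum>C\<in>?Q. \<sigma> (rep C) (\<sigma> g v)) = (\<Sum>C\<in>?Q. \<sigma> (rep (C \<otimes>\<^bsub>G Mod N\<^esub> (N #>\<^bsub>G\<^esub> g))) v)"
      by (rule sum.cong [OF refl], rule sym, rule r_mult(2))
    also have "\<dots> = (\<Sum>C\<in>?Q. \<sigma> (rep C) v)"
      by (rule sum.reindex_bij_betw [OF bij(2)])
    finally show "e (\<sigma> g v) = e v"
      by (simp add: e_def)
  qed
  show ?thesis
    by (intro exI [of _ e] conjI allI impI ballI) (use lin_e e_T e_fix fixed in blast)+
qed

text \<open>Each vector is fixed by some \<open>N (\<mu> v)\<close>, and its averages at all deeper
  levels agree, so they glue to one map. For sums, multiples and translates a common level is
  used.\<close>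

lemma ex_averages:
  fixes G :: "('g, 'b) monoid_scheme" and \<sigma> :: "'g \<Rightarrow> 'v \<Rightarrow> 'v" and N :: "nat \<Rightarrow> 'g set"
  assumes N: "\<And>m. N m \<lhd> G" "\<And>m. finite (carrier (G Mod N m))"
      "\<And>m. 1 / of_nat (card (carrier (G Mod N m))) \<in> Z_inv p"
      "\<And>m m'. m \<le> m' \<Longrightarrow> N m' \<subseteq> N m"
    and smooth: "\<And>v. \<exists>m. \<forall>g\<in>N m. \<sigma> g v = v"
    and lin: "\<And>g. g \<in> carrier G \<Longrightarrow> linear_map (\<sigma> g)"
    and mult: "\<And>g h v. g \<in> carrier G \<Longrightarrow> h \<in> carrier G \<Longrightarrow> \<sigma> (g \<otimes>\<^bsub>G\<^esub> h) v = \<sigma> g (\<sigma> h v)"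
  shows "\<exists>e. averages \<sigma> (carrier G) e"
proof -
  have "\<forall>m. \<exists>e. linear_map e \<and> (\<forall>v. (\<forall>g\<in>carrier G. \<sigma> g v = v) \<longrightarrow> e v = v) \<and>
      (\<forall>v. (\<forall>g\<in>N m. \<sigma> g v = v) \<longrightarrow> (\<forall>g\<in>carrier G. \<sigma> g (e v) = e v \<and> e (\<sigma> g v) = e v)) \<and>
      (\<forall>T v. linear_map T \<longrightarrow> (\<forall>g\<in>carrier G. T (\<sigma> g v) = T v) \<longrightarrow> T (e v) = T v)"
    by (intro allI average_over_quotient N lin mult)
  then obtain E where E: "\<forall>m. linear_map (E m) \<and> (\<forall>v. (\<forall>g\<in>carrier G. \<sigma> g v = v) \<longrightarrow> E m v = v) \<and>
      (\<forall>v. (\<forall>g\<in>N m. \<sigma> g v = v) \<longrightarrow> (\<forall>g\<in>carrier G. \<sigma> g (E m v) = E m v \<and> E m (\<sigma> g v) = E m v)) \<and>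
      (\<forall>T v. linear_map T \<longrightarrow> (\<forall>g\<in>carrier G. T (\<sigma> g v) = T v) \<longrightarrow> T (E m v) = T v)"
    by (rule choice [THEN exE])
  have lin_E: "linear_map (E m)" for m
    using E by simp
  have E_fix: "E m v = v" if "\<forall>g\<in>carrier G. \<sigma> g v = v" for m v
    using E that by simp
  have fix_E: "\<sigma> g (E m v) = E m v" "E m (\<sigma> g v) = E m v"
    if "\<forall>g\<in>N m. \<sigma> g v = v" "g \<in> carrier G" for m g v
    using E that by simp_all
  have E_T: "T (E m v) = T v" if "linear_map T" "\<forall>g\<in>carrier G. T (\<sigma> g v) = T v" for T m v
    using E that by simp
  \<comment> \<open>\<open>E m (E m' v)\<close> is computed twice: \<open>E m\<close> is constant on
    the translates of \<open>v\<close> that \<open>E m'\<close> averages, and \<open>E m' v\<close>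
    is already invariant.\<close>
  have E_eq: "E m v = E m' v" if m: "\<forall>g\<in>N m. \<sigma> g v = v" and m': "\<forall>g\<in>N m'. \<sigma> g v = v" for m m' v
  proof -
    have "E m (E m' v) = E m v"
      using fix_E(2) [OF m] by (intro E_T lin_E) blast
    moreover have "E m (E m' v) = E m' v"
      using fix_E(1) [OF m'] by (intro E_fix) blast
    ultimately show ?thesis
      by simp
  qed
  obtain \<mu> where \<mu>: "\<And>v. \<forall>g\<in>N (\<mu> v). \<sigma> g v = v"
    using smooth by metis
  have \<mu>': "\<forall>g\<in>N m. \<sigma> g v = v" if "\<mu> v \<le> m" for m v
    using \<mu> [of v] N(4) [OF that] by blast
  define e where "e v = E (\<mu> v) v" for v
  have e: "e v = E m v" if "\<mu> v \<le> m" for m v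
    unfolding e_def by (rule E_eq [OF \<mu> \<mu>' [OF that]])
  have "averages \<sigma> (carrier G) e"
    unfolding averages_def
  proof (intro conjI allI ballI impI)
    show "linear_map e"
      unfolding linear_map_def
    proof (intro conjI allI ballI)
      show "e (v + w) = e v + e w" for v w
      proof -
        define m where "m = max (\<mu> v) (max (\<mu> w) (\<mu> (v + w)))"
        have "e (v + w) = E m (v + w)" "e v = E m v" "e w = E m w"
          by (rule e, simp add: m_def)+
        then show ?thesis
          using linear_map_add [OF lin_E] by simp
      qed
      show "e (scl r v) = scl r (e v)" if "r \<in> Z_inv p" for r v
      proof -
        define m where "m = max (\<mu> v) (\<mu> (scl r v))"
        have "e (scl r v) = E m (scl r v)" "e v = E m v"
          by (rule e, simp add: m_def)+
        then show ?thesis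
          using linear_map_scl [OF lin_E that] by simp
      qed
    qed
    show "\<sigma> h (e v) = e v" if "h \<in> carrier G" for h v
      unfolding e_def by (rule fix_E(1) [OF \<mu> that])
    show "e v = v" if "\<forall>h\<in>carrier G. \<sigma> h v = v" for v
      unfolding e_def by (rule E_fix [OF that])
    show "e (\<sigma> h v) = e v" if "h \<in> carrier G" for h v
    proof -
      define m where "m = max (\<mu> v) (\<mu> (\<sigma> h v))"
      have "e (\<sigma> h v) = E m (\<sigma> h v)" "e v = E m v"
        by (rule e, simp add: m_def)+
      moreover have "\<forall>g\<in>N m. \<sigma> g v = v"
        by (rule \<mu>') (simp add: m_def)
      ultimately show ?thesis
        using fix_E(2) that by simp
    qed
    show "T (e v) = T v" if "linear_map T" "\<forall>h\<in>carrier G. T (\<sigma> h v) = T v" for T v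
      unfolding e_def by (rule E_T [OF that])
  qed
  then show ?thesis
    by blast
qed

end

section \<open>The idempotents of lattices\<close>

lemma carrier_GL [simp]: "carrier GL = {g. invertible g}"
  and mult_GL [simp]: "x \<otimes>\<^bsub>GL\<^esub> y = x ** y"
  and one_GL [simp]: "\<one>\<^bsub>GL\<^esub> = mat 1"
  by (simp_all add: GL_def)

lemma group_GL: "group (GL :: ('k::nonarch_lc_field ^ 'n ^ 'n) monoid)"
proof (rule groupI)
  fix x y z :: "'k ^ 'n ^ 'n"
  assume "x \<in> carrier GL"
  then have x: "invertible x"
    by simp
  then show "\<exists>y\<in>carrier GL. y \<otimes>\<^bsub>GL\<^esub> x = \<one>\<^bsub>GL\<^esub>"
    using matrix_inv_props(2,3) by (intro bexI [of _ "matrix_inv x"]) simp_all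
  show "x \<otimes>\<^bsub>GL\<^esub> y \<in> carrier GL" if "y \<in> carrier GL"
    using x that by (simp add: invertible_mult)
  show "(x \<otimes>\<^bsub>GL\<^esub> y) \<otimes>\<^bsub>GL\<^esub> z = x \<otimes>\<^bsub>GL\<^esub> (y \<otimes>\<^bsub>GL\<^esub> z)"
    by (simp add: matrix_mul_assoc)
  show "\<one>\<^bsub>GL\<^esub> \<otimes>\<^bsub>GL\<^esub> x = x"
    by simp
next
  show "\<one>\<^bsub>GL\<^esub> \<in> carrier (GL :: ('k ^ 'n ^ 'n) monoid)"
    by (simp add: invertible_iff_ker)
qed

lemma inv_GL:
  fixes g :: "'k::nonarch_lc_field ^ 'n ^ 'n"
  assumes "invertible g"
  shows "inv\<^bsub>GL\<^esub> g = matrix_inv g"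
  by (rule group.inv_equality [OF group_GL]) (use assms matrix_inv_props [OF assms] in simp_all)

section \<open>The congruence filtration and its finite quotients\<close>

context uniformizer
begin

lemma subgroup_cong_group:
  fixes L :: "('k ^ 'n) set"
  assumes "is_lattice L" "m \<ge> 1"
  shows "subgroup (cong_group m L) GL"
proof (rule group.subgroupI [OF group_GL])
  show "cong_group m L \<subseteq> carrier GL"
    using cong_groupD(1) by auto
  show "cong_group m L \<noteq> {}"
    using mat_1_cong_group [OF lattice_omodule [OF assms(1)]] by blast
  show "inv\<^bsub>GL\<^esub> g \<in> cong_group m L" if "g \<in> cong_group m L" for g
    using cong_group_inv [OF assms that] by (simp add: inv_GL [OF cong_groupD(1) [OF that]])
  show "g \<otimes>\<^bsub>GL\<^esub> h \<in> cong_group m L" if "g \<in> cong_group m L" "h \<in> cong_group m L" for g h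
    using cong_group_mult [OF lattice_omodule [OF assms(1)] that] by simp
qed

text \<open>Elements of level \<open>n\<close> map \<open>L\<close> onto itself, so conjugation by
  them preserves the subgroup of level \<open>m\<close> as well.\<close>

lemma normal_cong_group:
  fixes L :: "('k ^ 'n) set"
  assumes "is_lattice L" "n \<ge> 1" "n \<le> m"
  shows "cong_group m L \<lhd> GL\<lparr>carrier := cong_group n L\<rparr>"
proof -
  have m: "m \<ge> 1"
    using assms by simp
  note H = subgroup_cong_group [OF assms(1,2)] and K = subgroup_cong_group [OF assms(1) m]
  interpret H: group "GL\<lparr>carrier := cong_group n L\<rparr>"
    by (rule group.subgroup_imp_group [OF group_GL H])
  show ?thesis
    unfolding H.normal_inv_iff
  proof (intro conjI ballI)
    show "subgroup (cong_group m L) (GL\<lparr>carrier := cong_group n L\<rparr>)"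
      by (rule group.subgroup_incl [OF group_GL K H cong_group_antimono [OF lattice_omodule [OF assms(1)] assms(3)]])
    fix g u assume "g \<in> carrier (GL\<lparr>carrier := cong_group n L\<rparr>)" and u: "u \<in> cong_group m L"
    then have g: "g \<in> cong_group n L"
      by simp
    have "g ** u ** matrix_inv g \<in> cong_group m L"
      using cong_group_conj [OF u cong_groupD(1) [OF g]] cong_group_image [OF assms(1,2) g] by simp
    then show "g \<otimes>\<^bsub>GL\<lparr>carrier := cong_group n L\<rparr>\<^esub> u \<otimes>\<^bsub>GL\<lparr>carrier := cong_group n L\<rparr>\<^esub>
        inv\<^bsub>GL\<lparr>carrier := cong_group n L\<rparr>\<^esub> g \<in> cong_group m L"
      using group.m_inv_consistent [OF group_GL H g] inv_GL [OF cong_groupD(1) [OF g]] by simp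
  qed
qed

text \<open>Write \<open>h = 1 + x\<close>. Then \<open>h ^ j\<close> is \<open>1 + j x\<close>
  modulo \<open>\<pi> ^ (2 m)\<close>, and \<open>2 m \<ge> m + 1\<close>; for \<open>j = p\<close>
  the linear term gains a factor \<open>\<pi>\<close> as well.\<close>

lemma cong_group_pow_residue_char:
  fixes L :: "('k ^ 'n) set"
  assumes "is_lattice L" "m \<ge> 1" "h \<in> cong_group m L" "absv (of_nat p :: 'k) \<le> absv \<pi>"
  shows "h [^]\<^bsub>GL\<^esub> p \<in> cong_group (Suc m) L"
proof -
  note L = lattice_omodule [OF assms(1)]
  note S = omodule_smult_set [OF L, of "\<pi> ^ Suc m"]
  note H = subgroup_cong_group [OF assms(1,2)]
  have hj: "h [^]\<^bsub>GL\<^esub> j \<in> cong_group m L" for j :: nat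
    by (induction j) (simp_all add: mat_1_cong_group [OF L] cong_group_mult [OF L _ assms(3)])
  have diff: "\<exists>w\<in>L. h *v v - v = \<pi> ^ m *s w" if "v \<in> L" for v
    using cong_groupD(2) [OF assms(3) that] by blast
  have approx: "(h [^]\<^bsub>GL\<^esub> j) *v v - v - of_nat j *s (h *v v - v) \<in> smult_set (\<pi> ^ Suc m) L"
    if "v \<in> L" for j :: nat and v
    using that
  proof (induction j arbitrary: v)
    case 0
    then show ?case
      using omodule_0 [OF S] by simp
  next
    case (Suc j)
    obtain w where w: "w \<in> L" "h *v v - v = \<pi> ^ m *s w"
      using diff [OF Suc.prems] by blast
    obtain x where x: "x \<in> L" "h *v w - w = \<pi> ^ m *s x"
      using diff [OF w(1)] by blast
    have hv: "h *v v \<in> L"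
      by (rule cong_group_stable [OF L assms(3) Suc.prems])
    have "h *v (h *v v - v) - (h *v v - v) = \<pi> ^ (m + m) *s x"
      unfolding w(2) mult_smult_minus_smult x(2) by (simp add: vector_smult_assoc power_add)
    also have "\<dots> \<in> smult_set (\<pi> ^ (m + m)) L"
      using x(1) by blast
    also have "\<dots> \<subseteq> smult_set (\<pi> ^ Suc m) L"
      using assms(2) by (intro smult_power_subset [OF L]) simp
    finally have "of_nat j *s (h *v (h *v v - v) - (h *v v - v)) \<in> smult_set (\<pi> ^ Suc m) L"
      by (intro omodule_smult [OF S] integers_of_nat)
    also have "of_nat j *s (h *v (h *v v - v) - (h *v v - v))
        = of_nat j *s (h *v (h *v v) - h *v v) - of_nat j *s (h *v v - v)"
      by (simp only: matrix_vector_mult_diff_distrib vector_ssub_ldistrib)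
    finally have "of_nat j *s (h *v (h *v v) - h *v v) - of_nat j *s (h *v v - v) \<in> smult_set (\<pi> ^ Suc m) L" .
    note mem = this
    have eq: "x - a + (a - b) = x - b" for x a b :: "'k ^ 'n"
      by simp
    from omodule_add [OF S Suc.IH [OF hv] mem]
    have "(h [^]\<^bsub>GL\<^esub> j) *v (h *v v) - h *v v - of_nat j *s (h *v v - v) \<in> smult_set (\<pi> ^ Suc m) L"
      unfolding eq .
    also have "(h [^]\<^bsub>GL\<^esub> j) *v (h *v v) - h *v v - of_nat j *s (h *v v - v)
        = (h [^]\<^bsub>GL\<^esub> Suc j) *v v - v - of_nat (Suc j) *s (h *v v - v)"
      by (simp add: matrix_vector_mul_assoc vector_sadd_rdistrib algebra_simps)
    finally show ?case .
  qed
  have "(h [^]\<^bsub>GL\<^esub> p) *v v - v \<in> smult_set (\<pi> ^ Suc m) L" if v: "v \<in> L" for v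
  proof -
    obtain w where w: "w \<in> L" "h *v v - v = \<pi> ^ m *s w"
      using diff [OF v] by blast
    have "of_nat p *s (h *v v - v) = (of_nat p * \<pi> ^ m) *s w"
      by (simp add: w(2) vector_smult_assoc)
    also have "\<dots> \<in> smult_set (of_nat p * \<pi> ^ m) L"
      using w(1) by blast
    also have "\<dots> \<subseteq> smult_set (\<pi> ^ Suc m) L"
      using assms(4) by (intro smult_set_subset [OF L]) (simp add: absv_mult mult_right_mono)
    finally have "of_nat p *s (h *v v - v) \<in> smult_set (\<pi> ^ Suc m) L" .
    from omodule_add [OF S approx [OF v, of p] this] show ?thesis
      by simp
  qed
  then show ?thesis
    using cong_groupD(1) [OF hj] by (simp add: cong_group_def)
qed

lemma cong_group_pow_residue_char_power:
  fixes L :: "('k ^ 'n) set"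
  assumes "is_lattice L" "m \<ge> 1" "h \<in> cong_group m L" "absv (of_nat p :: 'k) \<le> absv \<pi>"
  shows "h [^]\<^bsub>GL\<^esub> (p ^ k) \<in> cong_group (m + k) L"
proof (induction k)
  case 0
  then show ?case
    using assms(3) cong_groupD(1) [OF assms(3)] monoid.nat_pow_eone [OF group.is_monoid [OF group_GL]]
    by simp
next
  case (Suc k)
  have "h [^]\<^bsub>GL\<^esub> (p ^ Suc k) = (h [^]\<^bsub>GL\<^esub> (p ^ k)) [^]\<^bsub>GL\<^esub> p"
    using cong_groupD(1) [OF assms(3)]
    by (subst monoid.nat_pow_pow [OF group.is_monoid [OF group_GL]]) (simp_all add: mult.commute)
  also have "\<dots> \<in> cong_group (Suc (m + k)) L"
    using assms(2) by (intro cong_group_pow_residue_char [OF assms(1) _ Suc.IH assms(4)]) simp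
  finally show ?case
    by simp
qed

lemma finite_image_if_determined:
  assumes "finite (f ` A)" "\<And>x y. x \<in> A \<Longrightarrow> y \<in> A \<Longrightarrow> f x = f y \<Longrightarrow> c x = c y"
  shows "finite (c ` A)"
proof -
  define r where "r y = (SOME x. x \<in> A \<and> f x = y)" for y
  have "c x = c (r (f x))" if "x \<in> A" for x
  proof -
    have "\<exists>x'. x' \<in> A \<and> f x' = f x"
      using that by blast
    then have "r (f x) \<in> A \<and> f (r (f x)) = f x"
      unfolding r_def by (rule someI_ex)
    then show ?thesis
      using assms(2) that by metis
  qed
  then have "c ` A \<subseteq> (\<lambda>y. c (r y)) ` (f ` A)"
    by blast
  then show ?thesis
    by (rule finite_subset [OF _ finite_imageI [OF assms(1)]])
qed

text \<open>A coset is determined by the residues modulo \<open>\<pi> ^ m\<close> of the images of a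
  basis of \<open>L\<close>, and \<open>L\<close> has finitely many residues.\<close>

lemma finite_cong_group_quotient:
  fixes L :: "('k ^ 'n) set"
  assumes "is_lattice L" "n \<ge> 1" "n \<le> m"
  shows "finite (carrier (GL\<lparr>carrier := cong_group n L\<rparr> Mod cong_group m L))"
proof -
  note L = lattice_omodule [OF assms(1)]
  let ?H = "cong_group n L" and ?K = "cong_group m L"
  let ?G = "GL\<lparr>carrier := cong_group n L\<rparr>"
  have m: "m \<ge> 1"
    using assms by simp
  interpret H: group ?G
    by (rule group.subgroup_imp_group [OF group_GL subgroup_cong_group [OF assms(1,2)]])
  interpret K: normal ?K ?G
    by (rule normal_cong_group [OF assms])
  obtain g :: "'k ^ 'n ^ 'n" where g: "invertible g" "L = (\<lambda>v. g *v v) ` standard_lattice"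
    using assms(1) is_lattice_iff by blast
  obtain R where R: "finite R" "\<And>v. v \<in> L \<Longrightarrow> \<exists>r\<in>R. v - r \<in> smult_set (\<pi> ^ m) L"
    using finite_lattice_residues [OF assms(1), of m] by metis
  then obtain r where r: "\<And>v. v \<in> L \<Longrightarrow> r v \<in> R \<and> v - r v \<in> smult_set (\<pi> ^ m) L"
    by metis
  define f where "f h = (\<lambda>j. r (h *v column j g))" for h :: "'k ^ 'n ^ 'n"
  have col: "column j g \<in> L" for j
    unfolding g(2) by (metis axis_standard imageI mult_axis)
  have "f ` ?H \<subseteq> UNIV \<rightarrow>\<^sub>E R"
    using r cong_group_stable [OF L _ col] by (auto simp: f_def)
  then have "finite (f ` ?H)"
    by (rule finite_subset) (simp add: finite_PiE R(1))
  then have "finite ((\<lambda>h. ?K #>\<^bsub>?G\<^esub> h) ` ?H)"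
  proof (rule finite_image_if_determined)
    fix h h' assume h: "h \<in> ?H" "h' \<in> ?H" and eq: "f h = f h'"
    have d: "h *v v - h' *v v \<in> smult_set (\<pi> ^ m) L" if v: "v \<in> L" for v
    proof -
      have c: "h *v column j g - h' *v column j g \<in> smult_set (\<pi> ^ m) L" for j
      proof -
        have "h *v column j g - r (h *v column j g) \<in> smult_set (\<pi> ^ m) L"
          "h' *v column j g - r (h *v column j g) \<in> smult_set (\<pi> ^ m) L"
          using r [OF cong_group_stable [OF L h(1) col]] r [OF cong_group_stable [OF L h(2) col]]
            fun_cong [OF eq, of j] unfolding f_def by metis+
        from omodule_diff [OF omodule_smult_set [OF L] this] show ?thesis
          by simp
      qed
      obtain w where w: "w \<in> standard_lattice" "v = g *v w"
        using v g(2) by blast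
      have "h *v v - h' *v v = (\<Sum>j\<in>UNIV. w $ j *s (h *v column j g - h' *v column j g))"
        unfolding w(2) matrix_mult_sum [of g]
        by (simp add: vec.linear_sum [OF matrix_vector_mul_linear_gen] vector_scalar_commute
            vector_ssub_ldistrib sum_subtractf)
      also have "\<dots> \<in> smult_set (\<pi> ^ m) L"
        using w(1) by (intro omodule_sum omodule_smult omodule_smult_set L c) (simp add: standard_lattice_def)
      finally show ?thesis .
    qed
    \<comment> \<open>\<open>?q - 1\<close> is \<open>h' - h\<close> composed with
      \<open>matrix_inv h\<close>; the latter preserves \<open>L\<close> and the former maps
      \<open>L\<close> into \<open>\<pi> ^ m\<close> times \<open>L\<close>.\<close>
    let ?q = "h' ** matrix_inv h"
    note inv = matrix_inv_props [OF cong_groupD(1) [OF h(1)]]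
    have "?q \<in> ?K"
    proof -
      have "?q *v v - v \<in> smult_set (\<pi> ^ m) L" if "v \<in> L" for v
      proof -
        have "matrix_inv h *v v \<in> L"
          by (rule cong_group_stable [OF L cong_group_inv [OF assms(1,2) h(1)] that])
        from omodule_minus [OF omodule_smult_set [OF L] d [OF this]] show ?thesis
          by (simp add: inv matrix_vector_mul_assoc [symmetric])
      qed
      then show ?thesis
        using invertible_mult [OF cong_groupD(1) [OF h(2)] inv(3)] by (simp add: cong_group_def)
    qed
    moreover have "h' = ?q ** h"
      by (simp add: inv(2) flip: matrix_mul_assoc)
    ultimately have "h' \<in> ?K #>\<^bsub>?G\<^esub> h"
      by (auto simp: r_coset_def)
    then show "?K #>\<^bsub>?G\<^esub> h = ?K #>\<^bsub>?G\<^esub> h'"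
      using h(1) K.subgroup_axioms by (intro H.repr_independence) simp_all
  qed
  then show ?thesis
    by (simp add: FactGroup_def RCOSETS_def UNION_singleton_eq_range)
qed

text \<open>Every \<open>p\<close>-th power deepens the level by one, so each coset has trivial
  \<open>p ^ (m - n)\<close>-th power.\<close>

lemma card_cong_group_quotient:
  fixes L :: "('k ^ 'n) set"
  assumes "is_lattice L" "n \<ge> 1" "n \<le> m" "residue_char TYPE('k) p"
  shows "\<exists>M. card (carrier (GL\<lparr>carrier := cong_group n L\<rparr> Mod cong_group m L)) dvd p ^ M"
proof -
  let ?G = "GL\<lparr>carrier := cong_group n L\<rparr>"
  interpret H: group ?G
    by (rule group.subgroup_imp_group [OF group_GL subgroup_cong_group [OF assms(1,2)]])
  interpret K: normal "cong_group m L" ?G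
    by (rule normal_cong_group [OF assms(1-3)])
  interpret Q: group "?G Mod cong_group m L"
    by (rule K.factorgroup_is_group)
  note p = residue_char_props [OF assms(4)]
  have "\<exists>M. order (?G Mod cong_group m L) dvd p ^ M"
  proof (rule Q.order_dvd_power [OF finite_cong_group_quotient [OF assms(1-3)] p(1)])
    fix C assume "C \<in> carrier (?G Mod cong_group m L)"
    then obtain h where h: "h \<in> cong_group n L" "C = cong_group m L #>\<^bsub>?G\<^esub> h"
      by (auto simp: FactGroup_def RCOSETS_def)
    have "h [^]\<^bsub>GL\<^esub> (p ^ (m - n)) \<in> cong_group (n + (m - n)) L"
      by (rule cong_group_pow_residue_char_power [OF assms(1,2) h(1) p(2)])
    then have *: "h [^]\<^bsub>?G\<^esub> (p ^ (m - n)) \<in> cong_group m L"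
      using assms(3) monoid.nat_pow_consistent [OF group.is_monoid [OF group_GL]] by (metis le_add_diff_inverse)
    have "C [^]\<^bsub>?G Mod cong_group m L\<^esub> (p ^ (m - n)) = cong_group m L #>\<^bsub>?G\<^esub> (h [^]\<^bsub>?G\<^esub> (p ^ (m - n)))"
      unfolding h(2) using h(1)
      by (subst hom_nat_pow [OF K.r_coset_hom_Mod _ H.is_group Q.is_group]) simp_all
    also have "\<dots> = cong_group m L"
      using * K.subgroup_axioms K.subset by (intro H.coset_join2) auto
    finally show "C [^]\<^bsub>?G Mod cong_group m L\<^esub> (p ^ (m - n)) = \<one>\<^bsub>?G Mod cong_group m L\<^esub>"
      by simp
  qed
  then show ?thesis
    by (simp add: order_def)
qed

text \<open>Comparing \<open>L\<close> with the standard lattice in both directions costs a fixed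
  number \<open>s\<close> of factors \<open>\<pi>\<close>. So deep congruence subgroups are small in
  the topology of matrix entries.\<close>

lemma cong_group_entries:
  fixes L :: "('k ^ 'n) set"
  assumes "is_lattice L"
  shows "\<exists>s. \<forall>m\<ge>s. \<forall>g\<in>cong_group m L. \<forall>i j. dist (g $ i $ j) (mat 1 $ i $ j) \<le> absv \<pi> ^ (m - s)"
proof -
  obtain a where a: "smult_set (\<pi> ^ a) standard_lattice \<subseteq> L"
    using lattice_absorbs_lattice [OF assms lattice_standard] by blast
  obtain b where b: "smult_set (\<pi> ^ b) L \<subseteq> standard_lattice"
    using lattice_absorbs_lattice [OF lattice_standard assms] by blast
  have "dist (g $ i $ j) (mat 1 $ i $ j) \<le> absv \<pi> ^ (m - (a + b))"
    if m: "a + b \<le> m" and g: "g \<in> cong_group m L" for m g i j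
  proof -
    have "\<pi> ^ a *s axis j 1 \<in> L"
      using a axis_standard by blast
    then obtain w where w: "w \<in> L" "g *v (\<pi> ^ a *s axis j 1) - \<pi> ^ a *s axis j 1 = \<pi> ^ m *s w"
      using cong_groupD(2) [OF g] by blast
    have "\<pi> ^ b *s w \<in> standard_lattice"
      using w(1) b by blast
    then have wi: "absv \<pi> ^ b * absv (w $ i) \<le> 1"
      by (simp add: standard_lattice_def integers_def absv_mult absv_power)
    have "\<pi> ^ a *s (g *v axis j 1 - axis j 1) = \<pi> ^ m *s w"
      using w(2) by (simp only: mult_smult_minus_smult)
    then have "\<pi> ^ a * (g $ i $ j - mat 1 $ i $ j) = \<pi> ^ m * w $ i"
      unfolding mult_axis vec_eq_iff by (auto simp: column_def axis_def mat_def right_diff_distrib dest!: spec [of _ i] split: if_splits)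
    then have "absv \<pi> ^ a * absv (g $ i $ j - mat 1 $ i $ j) = absv \<pi> ^ m * absv (w $ i)"
      by (metis absv_mult absv_power)
    also have "absv \<pi> ^ m = absv \<pi> ^ a * (absv \<pi> ^ (m - (a + b)) * absv \<pi> ^ b)"
      using m by (simp flip: power_add)
    also have "absv \<pi> ^ a * (absv \<pi> ^ (m - (a + b)) * absv \<pi> ^ b) * absv (w $ i)
        = absv \<pi> ^ a * (absv \<pi> ^ (m - (a + b)) * (absv \<pi> ^ b * absv (w $ i)))"
      by simp
    also have "\<dots> \<le> absv \<pi> ^ a * (absv \<pi> ^ (m - (a + b)) * 1)"
      by (intro mult_left_mono wi) simp_all
    finally show ?thesis
      by (simp add: dist_absv)
  qed
  then show ?thesis
    by blast
qed

end

locale smooth_setting = uniformizer \<pi> + smooth_representation p scl \<rho>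
  for \<pi> :: "'k::nonarch_lc_field" and p :: nat and scl :: "rat \<Rightarrow> 'v::ab_group_add \<Rightarrow> 'v"
    and \<rho> :: "'k ^ 'n ^ 'n \<Rightarrow> 'v \<Rightarrow> 'v" +
  fixes n :: nat
  assumes residue: "residue_char TYPE('k) p" and n_gt_1: "n > 1"
begin

lemma linear_rho: "invertible g \<Longrightarrow> linear_map (\<rho> g)"
  by (simp add: linear_map_def rep_add rep_scl)

lemma rho_inverse:
  assumes "invertible g"
  shows "\<rho> (matrix_inv g) (\<rho> g v) = v" "\<rho> g (\<rho> (matrix_inv g) v) = v"
proof -
  note inv = matrix_inv_props [OF assms]
  show "\<rho> (matrix_inv g) (\<rho> g v) = v"
    using rep_mult [OF inv(3) assms] by (simp add: inv(2) rep_one)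
  show "\<rho> g (\<rho> (matrix_inv g) v) = v"
    using rep_mult [OF assms inv(3)] by (simp add: inv(1) rep_one)
qed

text \<open>The bridge from topological smoothness to algebra: a neighbourhood of the identity
  contains a congruence subgroup. The distance of matrices is bounded by the sum over all entries,
  whence the constant \<open>N\<close>.\<close>

lemma ex_cong_group_fixing:
  fixes L :: "('k ^ 'n) set"
  assumes "is_lattice L"
  shows "\<exists>m. \<forall>g\<in>cong_group m L. \<rho> g v = v"
proof -
  obtain S where S: "open S" "{g. invertible g \<and> \<rho> g v = v} = {g. invertible g} \<inter> S"
    using smooth [of v] unfolding openin_open by blast
  have "invertible (mat 1 :: 'k ^ 'n ^ 'n)"
    by (simp add: invertible_iff_ker)
  then have "mat 1 \<in> S"
    using S(2) rep_one by blast
  then obtain \<epsilon> where \<epsilon>: "\<epsilon> > 0" "\<And>g. dist g (mat 1) < \<epsilon> \<Longrightarrow> g \<in> S"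
    using S(1) unfolding open_dist by blast
  obtain s where s: "\<And>m g i j. s \<le> m \<Longrightarrow> g \<in> cong_group m L \<Longrightarrow>
      dist (g $ i $ j) (mat 1 $ i $ j) \<le> absv \<pi> ^ (m - s)"
    using cong_group_entries [OF assms] by metis
  define N where "N = real CARD('n) * real CARD('n)"
  have N: "N > 0"
    by (simp add: N_def)
  obtain t where t: "absv \<pi> ^ t < \<epsilon> / N"
    using real_arch_pow_inv [of "\<epsilon> / N" "absv \<pi>"] \<epsilon>(1) N absv_pi_lt_1 by auto
  have "\<rho> g v = v" if g: "g \<in> cong_group (s + t) L" for g
  proof -
    have "dist g (mat 1) \<le> (\<Sum>i\<in>UNIV. dist (g $ i) (mat 1 $ i))"
      unfolding dist_vec_def [of g] by (rule L2_set_le_sum) simp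
    also have "\<dots> \<le> (\<Sum>i\<in>UNIV. \<Sum>j\<in>UNIV. dist (g $ i $ j) (mat 1 $ i $ j))"
      by (intro sum_mono) (simp add: dist_vec_def L2_set_le_sum)
    also have "\<dots> \<le> (\<Sum>i\<in>(UNIV :: 'n set). \<Sum>j\<in>(UNIV :: 'n set). absv \<pi> ^ t)"
      using s [OF _ g] by (intro sum_mono) simp
    also have "\<dots> = N * absv \<pi> ^ t"
      by (simp add: N_def)
    also have "\<dots> < \<epsilon>"
      using t N by (simp add: field_simps)
    finally have "g \<in> S"
      by (rule \<epsilon>(2))
    then show ?thesis
      using S(2) cong_groupD(1) [OF g] by blast
  qed
  then show ?thesis
    by blast
qed

text \<open>The choice depends on \<open>L\<close> only through its congruence subgroup, so
  homothetic lattices receive literally the same map.\<close>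

definition E :: "('k ^ 'n) set \<Rightarrow> 'v \<Rightarrow> 'v"
  where "E L = (SOME e. averages \<rho> (cong_group n L) e)"

lemma averages_E:
  fixes L :: "('k ^ 'n) set"
  assumes "is_lattice L"
  shows "averages \<rho> (cong_group n L) (E L)"
proof -
  note L = lattice_omodule [OF assms]
  let ?G = "GL\<lparr>carrier := cong_group n L\<rparr>"
  have n: "n \<ge> 1"
    using n_gt_1 by simp
  have "\<exists>e. averages \<rho> (carrier ?G) e"
  proof (rule ex_averages [where N = "\<lambda>m. cong_group (n + m) L"])
    show "cong_group (n + m) L \<lhd> ?G" for m
      by (rule normal_cong_group [OF assms n]) simp
    show "finite (carrier (?G Mod cong_group (n + m) L))" for m
      by (rule finite_cong_group_quotient [OF assms n]) simp
    show "1 / of_nat (card (carrier (?G Mod cong_group (n + m) L))) \<in> Z_inv p" for m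
      using card_cong_group_quotient [OF assms n le_add1 residue] residue_char_props(1) [OF residue]
        Z_inv_inverse by blast
    show "cong_group (n + m') L \<subseteq> cong_group (n + m) L" if "m \<le> m'" for m m'
      using that by (intro cong_group_antimono [OF L]) simp
    show "\<exists>m. \<forall>g\<in>cong_group (n + m) L. \<rho> g v = v" for v
    proof -
      obtain m where "\<forall>g\<in>cong_group m L. \<rho> g v = v"
        using ex_cong_group_fixing [OF assms] by blast
      then have "\<forall>g\<in>cong_group (n + m) L. \<rho> g v = v"
        using cong_group_antimono [OF L, of m "n + m"] by auto
      then show ?thesis
        by blast
    qed
    have inv: "invertible g" if "g \<in> carrier ?G" for g
      by (rule cong_groupD(1) [of g n L]) (use that in simp)
    show "linear_map (\<rho> g)" if "g \<in> carrier ?G" for g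
      by (rule linear_rho [OF inv [OF that]])
    show "\<rho> (g \<otimes>\<^bsub>?G\<^esub> h) v = \<rho> g (\<rho> h v)" if "g \<in> carrier ?G" "h \<in> carrier ?G" for g h v
      using rep_mult [OF inv inv] that by simp
  qed
  then show ?thesis
    unfolding E_def by (simp add: someI_ex)
qed

context
  fixes L :: "('k ^ 'n) set"
  assumes L: "is_lattice L"
begin

lemma linear_E: "linear_map (E L)"
  by (rule averages_E [OF L, unfolded averages_def, THEN conjunct1])

lemma rho_E: "h \<in> cong_group n L \<Longrightarrow> \<rho> h (E L v) = E L v"
  by (rule averages_E [OF L, unfolded averages_def, THEN conjunct2, THEN conjunct1, rule_format])

lemma E_fixed: "(\<And>h. h \<in> cong_group n L \<Longrightarrow> \<rho> h v = v) \<Longrightarrow> E L v = v"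
  by (rule averages_E [OF L, unfolded averages_def, THEN conjunct2, THEN conjunct2, THEN conjunct1, rule_format])

lemma E_rho: "h \<in> cong_group n L \<Longrightarrow> E L (\<rho> h v) = E L v"
  by (rule averages_E [OF L, unfolded averages_def, THEN conjunct2, THEN conjunct2, THEN conjunct2, THEN conjunct1,
    rule_format])

lemma linear_map_E: "linear_map T \<Longrightarrow> (\<And>h. h \<in> cong_group n L \<Longrightarrow> T (\<rho> h v) = T v) \<Longrightarrow> T (E L v) = T v"
  by (rule averages_E [OF L, unfolded averages_def, THEN conjunct2, THEN conjunct2, THEN conjunct2, THEN conjunct2,
    rule_format])

lemma E_idem: "E L (E L v) = E L v"
  by (rule E_fixed) (rule rho_E)

lemma E_eq_iff: "E L v = v \<longleftrightarrow> (\<forall>h\<in>cong_group n L. \<rho> h v = v)"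
proof
  assume "E L v = v"
  then show "\<forall>h\<in>cong_group n L. \<rho> h v = v"
    using rho_E [of _ v] by simp
next
  assume "\<forall>h\<in>cong_group n L. \<rho> h v = v"
  then show "E L v = v"
    by (intro E_fixed) simp
qed

end

lemma E_smult_set: "c \<noteq> 0 \<Longrightarrow> E (smult_set c L) = E L"
  by (simp add: E_def cong_group_smult_set)

text \<open>\<open>g\<close> normalizes the group of \<open>L\<close>. The conjugate
  \<open>T\<close> of \<open>E L\<close> by \<open>g\<close> is therefore constant on translates, so
  \<open>T (E L v) = T v\<close>, while \<open>\<rho> g (E L v)\<close> is already fixed by
  \<open>E L\<close>; the claim is the comparison of the two.\<close>

lemma rho_E_commute:
  assumes L: "is_lattice L" and g: "invertible g" "(\<lambda>v. g *v v) ` L = L"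
  shows "\<rho> g (E L v) = E L (\<rho> g v)"
proof -
  note inv = matrix_inv_props [OF g(1)]
  define T where "T w = \<rho> (matrix_inv g) (E L (\<rho> g w))" for w
  have "linear_map T"
    unfolding T_def
    by (rule linear_map_comp [OF linear_rho [OF inv(3)] linear_map_comp [OF linear_E [OF L] linear_rho [OF g(1)]]])
  moreover have "T (\<rho> h v) = T v" if h: "h \<in> cong_group n L" for h
  proof -
    note hi = cong_groupD(1) [OF h]
    have c: "g ** h ** matrix_inv g \<in> cong_group n L"
      using cong_group_conj [OF h g(1)] g(2) by simp
    have "\<rho> g (\<rho> h v) = \<rho> (g ** h ** matrix_inv g ** g) v"
      using rep_mult [OF g(1) hi] by (simp add: inv(2) flip: matrix_mul_assoc)
    also have "\<dots> = \<rho> (g ** h ** matrix_inv g) (\<rho> g v)"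
      by (rule rep_mult [OF cong_groupD(1) [OF c] g(1)])
    finally show ?thesis
      by (simp add: T_def E_rho [OF L c])
  qed
  ultimately have "T (E L v) = T v"
    by (rule linear_map_E [OF L])
  moreover have "E L (\<rho> g (E L v)) = \<rho> g (E L v)"
  proof (rule E_fixed [OF L])
    fix h assume h: "h \<in> cong_group n L"
    note hi = cong_groupD(1) [OF h]
    have "(\<lambda>v. matrix_inv g *v v) ` ((\<lambda>v. g *v v) ` L) = L"
      by (simp add: image_image inv)
    then have gL: "(\<lambda>v. matrix_inv g *v v) ` L = L"
      by (simp add: g(2))
    have c: "matrix_inv g ** h ** g \<in> cong_group n L"
      using cong_group_conj [OF h inv(3)] by (simp add: gL matrix_inv_matrix_inv [OF g(1)])
    have "\<rho> h (\<rho> g (E L v)) = \<rho> (g ** (matrix_inv g ** h ** g)) (E L v)"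
      using rep_mult [OF hi g(1)] by (simp add: matrix_mul_assoc inv(1))
    also have "\<dots> = \<rho> g (E L v)"
      using rep_mult [OF g(1) cong_groupD(1) [OF c]] by (simp add: rho_E [OF L c])
    finally show "\<rho> h (\<rho> g (E L v)) = \<rho> g (E L v)" .
  qed
  ultimately have "\<rho> (matrix_inv g) (\<rho> g (E L v)) = \<rho> (matrix_inv g) (E L (\<rho> g v))"
    by (simp add: T_def)
  then show ?thesis
    by (metis g(1) rho_inverse(2))
qed

text \<open>As \<open>n > 1\<close>, the group of \<open>M\<close> preserves \<open>L\<close>, so
  its elements commute with \<open>E L\<close>. Then \<open>E M (E L (E M v))\<close> reduces to
  each of the two products.\<close>

lemma E_commute:
  assumes L: "is_lattice L" and M: "is_lattice M" and adj: "smult_set \<pi> L \<subseteq> M" "smult_set \<pi> M \<subseteq> L"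
  shows "E L (E M v) = E M (E L v)"
proof -
  have comm: "\<rho> h (E L w) = E L (\<rho> h w)" if h: "h \<in> cong_group n M" for h w
    using n_gt_1 by (intro rho_E_commute [OF L cong_groupD(1) [OF h]] cong_group_image_adjacent [OF L M adj _ h]) simp
  have "E M (E L (E M v)) = E M (E L v)"
  proof (rule linear_map_E [OF M linear_map_comp [OF linear_E [OF M] linear_E [OF L]]])
    fix h assume h: "h \<in> cong_group n M"
    show "E M (E L (\<rho> h v)) = E M (E L v)"
      by (simp add: E_rho [OF M h] flip: comm [OF h])
  qed
  moreover have "E M (E L (E M v)) = E L (E M v)"
  proof (rule E_fixed [OF M])
    fix h assume h: "h \<in> cong_group n M"
    show "\<rho> h (E L (E M v)) = E L (E M v)"
      by (simp add: comm [OF h] rho_E [OF M h])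
  qed
  ultimately show ?thesis
    by simp
qed

text \<open>In \<open>h = a ** b\<close> the factor \<open>b\<close> is absorbed by
  \<open>E M\<close> and \<open>a\<close> by \<open>E L\<close>, so \<open>E L\<close> is constant
  on the translates of \<open>E M v\<close> that \<open>E (msum L M)\<close> averages.\<close>

lemma E_msum:
  assumes L: "is_lattice L" and M: "is_lattice M" and sub: "smult_set \<pi> M \<subseteq> L"
  shows "E L (E (msum L M) (E M v)) = E L (E M v)"
proof (rule linear_map_E [OF lattice_msum [OF assms] linear_E [OF L]])
  fix h assume h: "h \<in> cong_group n (msum L M)"
  have "1 \<le> n"
    using n_gt_1 by simp
  from cong_group_msum [OF L lattice_omodule [OF M] sub h this]
  obtain a b where ab: "a \<in> cong_group n L" "b \<in> cong_group n M" "h = a ** b"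
    by blast
  have "\<rho> h (E M v) = \<rho> a (\<rho> b (E M v))"
    unfolding ab(3) by (rule rep_mult [OF cong_groupD(1) [OF ab(1)] cong_groupD(1) [OF ab(2)]])
  then show "E L (\<rho> h (E M v)) = E L (E M v)"
    by (simp add: rho_E [OF M ab(2)] E_rho [OF L ab(1)])
qed

end

section \<open>Vertices and simplices\<close>

lemma homothety_class_eq_iff:
  fixes L M :: "('k::nonarch_lc_field ^ 'n) set"
  shows "homothety_class L = homothety_class M \<longleftrightarrow> (\<exists>c. c \<noteq> 0 \<and> M = smult_set c L)"
proof
  assume "homothety_class L = homothety_class M"
  moreover have "M \<in> homothety_class M"
    unfolding homothety_class_def by (intro CollectI exI [of _ 1]) simp
  ultimately have "M \<in> homothety_class L"
    by simp
  then show "\<exists>c. c \<noteq> 0 \<and> M = smult_set c L"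
    unfolding homothety_class_def by blast
next
  assume "\<exists>c. c \<noteq> 0 \<and> M = smult_set c L"
  then obtain c where c: "c \<noteq> 0" "M = smult_set c L"
    by blast
  have "smult_set b L = smult_set (b / c) M" "smult_set b M = smult_set (b * c) L" for b
    using c by (simp_all add: smult_smult_set)
  then show "homothety_class L = homothety_class M"
    unfolding homothety_class_def using c(1)
    by (intro subset_antisym subsetI; clarify) (metis divide_eq_0_iff mult_eq_0_iff)+
qed

lemma finite_chain_enumerate:
  assumes "finite C" "card C = Suc k" "\<And>A B. A \<in> C \<Longrightarrow> B \<in> C \<Longrightarrow> A \<subseteq> B \<or> B \<subseteq> A"
  shows "\<exists>L. C = L ` {..k} \<and> (\<forall>i<k. L i \<subset> L (Suc i))"
  using assms
proof (induction k arbitrary: C)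
  case 0
  then obtain A where "C = {A}"
    by (auto simp: card_Suc_eq)
  then show ?case
    by (intro exI [of _ "\<lambda>_. A"]) simp
next
  case (Suc k)
  have "C \<noteq> {}"
    using Suc.prems(2) by auto
  then obtain A where A: "A \<in> C" "\<And>B. B \<in> C \<Longrightarrow> A \<subseteq> B \<Longrightarrow> A = B"
    using finite_has_maximal [OF Suc.prems(1)] by blast
  have top: "B \<subset> A" if "B \<in> C - {A}" for B
    using that A Suc.prems(3) by blast
  have "finite (C - {A})" "card (C - {A}) = Suc k"
    using Suc.prems(1,2) A(1) by simp_all
  from Suc.IH [OF this] obtain L where L: "C - {A} = L ` {..k}" "\<forall>i<k. L i \<subset> L (Suc i)"
    using Suc.prems(3) by (meson DiffD1)
  define L' where "L' i = (if i = Suc k then A else L i)" for i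
  have "L' ` {..Suc k} = insert A (L ` {..k})"
  proof -
    have "L' ` {..k} = L ` {..k}"
      by (rule image_cong) (simp_all add: L'_def)
    then show ?thesis
      by (simp add: atMost_Suc) (simp add: L'_def)
  qed
  also have "\<dots> = C"
    using L(1) A(1) by blast
  finally have "C = L' ` {..Suc k}"
    by simp
  moreover have "L' i \<subset> L' (Suc i)" if "i < Suc k" for i
  proof (cases "i = k")
    case True
    have "L k \<in> C - {A}"
      using L(1) by blast
    then show ?thesis
      using top True by (simp add: L'_def)
  next
    case False
    then show ?thesis
      using L(2) that by (simp add: L'_def)
  qed
  ultimately show ?case
    by blast
qed

section \<open>Simplices as unordered chains of lattices\<close>

context uniformizer
begin

text \<open>A simplex without numbering: the condition relating the last lattice to the first is
  asked of all pairs, which makes the passage to faces evident.\<close>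

definition lattice_chain :: "('k ^ 'n) set set \<Rightarrow> bool"
  where "lattice_chain C \<longleftrightarrow> finite C \<and> C \<noteq> {} \<and>
    (\<forall>L\<in>C. is_lattice L \<and> (\<forall>M\<in>C. (L \<subseteq> M \<or> M \<subseteq> L) \<and> smult_set \<pi> L \<subset> M))"

text \<open>Of two distinct homothetic lattices one lies in \<open>\<pi>\<close> times the other,
  which the strict inclusions in a chain exclude.\<close>

lemma lattice_chain_inj:
  assumes "lattice_chain C"
  shows "inj_on homothety_class C"
proof (rule inj_onI)
  fix L M assume LM: "L \<in> C" "M \<in> C" "homothety_class L = homothety_class M"
  then obtain c where c: "c \<noteq> 0" "M = smult_set c L"
    unfolding homothety_class_eq_iff by blast
  have L: "omodule L"
    using assms LM(1) lattice_omodule by (auto simp: lattice_chain_def)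
  have s: "smult_set \<pi> L \<subset> M" "smult_set \<pi> M \<subset> L"
    using assms LM(1,2) by (auto simp: lattice_chain_def)
  consider "M = L" | "M \<subseteq> smult_set \<pi> L" | "L \<subseteq> smult_set \<pi> M"
    using lattice_smult_mono [OF L c(1) one_neq_zero]
    unfolding c(2) smult_smult_set mult_1_right smult_set_1 by blast
  then show "L = M"
    using s by cases blast+
qed

lemma mem_simplices_iff:
  "\<tau> \<in> simplices \<pi> k \<longleftrightarrow> (\<exists>C. lattice_chain C \<and> card C = Suc k \<and> \<tau> = homothety_class ` C)"
proof
  assume "\<tau> \<in> simplices \<pi> k"
  then obtain L where \<tau>: "\<tau> = (\<lambda>i. homothety_class (L i)) ` {..k}"
    and L: "\<And>i. i \<le> k \<Longrightarrow> is_lattice (L i)" "smult_set \<pi> (L k) \<subset> L 0" "\<And>i. i < k \<Longrightarrow> L i \<subset> L (Suc i)"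
    unfolding simplices_def by blast
  have less: "L i \<subset> L j" if "i < j" "j \<le> k" for i j
    using that
  proof (induction j)
    case (Suc j)
    then have "L j \<subset> L (Suc j)"
      using L(3) by simp
    then show ?case
      using Suc by (cases "i = j") auto
  qed simp
  have le: "L i \<subseteq> L j" if "i \<le> j" "j \<le> k" for i j
    using less [of i j] that by (cases "i = j") auto
  have pi: "smult_set \<pi> (L i) \<subset> L j" if "i \<le> k" "j \<le> k" for i j
    using image_mono [OF le [OF that(1) order_refl], of "\<lambda>v. \<pi> *s v"] L(2) le [of 0 j] that(2) by blast
  have "inj_on L {..k}"
  proof (rule inj_onI)
    fix i j assume "i \<in> {..k}" "j \<in> {..k}" "L i = L j"
    then show "i = j"
      using less [of i j] less [of j i] by (cases i j rule: linorder_cases) auto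
  qed
  then have "card (L ` {..k}) = Suc k"
    by (simp add: card_image)
  moreover have "lattice_chain (L ` {..k})"
    unfolding lattice_chain_def
  proof (intro conjI ballI)
    fix A B assume "A \<in> L ` {..k}" "B \<in> L ` {..k}"
    then obtain i j where ij: "i \<le> k" "A = L i" "j \<le> k" "B = L j"
      by auto
    show "A \<subseteq> B \<or> B \<subseteq> A"
      using le [of i j] le [of j i] ij by (cases "i \<le> j") auto
    show "smult_set \<pi> A \<subset> B"
      using pi ij by simp
  qed (use L(1) in auto)
  ultimately show "\<exists>C. lattice_chain C \<and> card C = Suc k \<and> \<tau> = homothety_class ` C"
    using \<tau> by (intro exI [of _ "L ` {..k}"]) (simp add: image_image)
next
  assume "\<exists>C. lattice_chain C \<and> card C = Suc k \<and> \<tau> = homothety_class ` C"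
  then obtain C where C: "lattice_chain C" "card C = Suc k" "\<tau> = homothety_class ` C"
    by blast
  have "finite C" "\<And>A B. A \<in> C \<Longrightarrow> B \<in> C \<Longrightarrow> A \<subseteq> B \<or> B \<subseteq> A"
    using C(1) unfolding lattice_chain_def by blast+
  then obtain L where L: "C = L ` {..k}" "\<forall>i<k. L i \<subset> L (Suc i)"
    using finite_chain_enumerate [OF _ C(2)] by metis
  have LC: "L i \<in> C" if "i \<le> k" for i
    using L(1) that by blast
  have "\<forall>i\<le>k. is_lattice (L i)" "smult_set \<pi> (L k) \<subset> L 0"
    using C(1) LC by (simp_all add: lattice_chain_def)
  then show "\<tau> \<in> simplices \<pi> k"
    unfolding simplices_def using L C(3) by (intro CollectI exI [of _ L]) (simp add: image_image)
qed

lemma simplices_card: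
  assumes "\<tau> \<in> simplices \<pi> k"
  shows "finite \<tau>" "card \<tau> = Suc k"
proof -
  obtain C where C: "lattice_chain C" "card C = Suc k" "\<tau> = homothety_class ` C"
    using assms unfolding mem_simplices_iff by blast
  then show "finite \<tau>"
    by (simp add: lattice_chain_def)
  show "card \<tau> = Suc k"
    using C card_image [OF lattice_chain_inj [OF C(1)]] by simp
qed

lemma simplices_subset:
  assumes "\<tau> \<in> simplices \<pi> k" "\<sigma> \<subseteq> \<tau>" "card \<sigma> = Suc l"
  shows "\<sigma> \<in> simplices \<pi> l"
proof -
  obtain C where C: "lattice_chain C" "card C = Suc k" "\<tau> = homothety_class ` C"
    using assms(1) unfolding mem_simplices_iff by blast
  then obtain D where D: "D \<subseteq> C" "\<sigma> = homothety_class ` D"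
    using assms(2) by (meson subset_imageE)
  have "card D = Suc l"
    using assms(3) D card_image [OF inj_on_subset [OF lattice_chain_inj [OF C(1)] D(1)]] by simp
  moreover have "lattice_chain D"
    unfolding lattice_chain_def
  proof (intro conjI)
    show "finite D"
      using C(1) D(1) finite_subset by (auto simp: lattice_chain_def)
    show "D \<noteq> {}"
      using \<open>card D = Suc l\<close> by auto
    show "\<forall>L\<in>D. is_lattice L \<and> (\<forall>M\<in>D. (L \<subseteq> M \<or> M \<subseteq> L) \<and> smult_set \<pi> L \<subset> M)"
      using C(1) D(1) unfolding lattice_chain_def by blast
  qed
  ultimately show ?thesis
    unfolding mem_simplices_iff using D(2) by blast
qed

text \<open>A chain can be rotated: the lattices below a given member \<open>A\<close> come to lie
  above it when divided by \<open>\<pi>\<close>. Rescaling \<open>A\<close> to \<open>L\<close> then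
  places every other vertex between \<open>L\<close> and
  \<open>\<pi>\<^sup>-\<^sup>1 L\<close>.\<close>

lemma simplex_neighbour:
  assumes "\<tau> \<in> simplices \<pi> k" "homothety_class L \<in> \<tau>" "y \<in> \<tau>" "y \<noteq> homothety_class L"
  shows "\<exists>N. is_lattice N \<and> y = homothety_class N \<and> L \<subseteq> N \<and> smult_set \<pi> N \<subseteq> L"
proof -
  obtain C where C: "lattice_chain C" "\<tau> = homothety_class ` C"
    using assms(1) unfolding mem_simplices_iff by blast
  obtain A B where A: "A \<in> C" "homothety_class A = homothety_class L" and B: "B \<in> C" "y = homothety_class B"
    using assms(2,3) C(2) by (metis imageE)
  obtain c where c: "c \<noteq> 0" "L = smult_set c A"
    using A(2) unfolding homothety_class_eq_iff by blast
  have AB: "A \<subseteq> B \<or> B \<subseteq> A" "smult_set \<pi> A \<subseteq> B" "smult_set \<pi> B \<subseteq> A" "is_lattice B"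
    using C(1) A(1) B(1) unfolding lattice_chain_def by blast+
  from AB(1) show ?thesis
  proof
    assume "A \<subseteq> B"
    moreover have "smult_set \<pi> (smult_set c B) = smult_set c (smult_set \<pi> B)"
      by (simp add: smult_smult_set mult.commute)
    ultimately show ?thesis
      using AB(3) c B(2) lattice_smult_set [OF AB(4) c(1)] homothety_class_eq_iff [of B]
      by (intro exI [of _ "smult_set c B"]) (auto simp: smult_set_mono_iff)
  next
    assume BA: "B \<subseteq> A"
    define d where "d = c / \<pi>"
    have d: "d \<noteq> 0" "smult_set c X = smult_set d (smult_set \<pi> X)" "smult_set \<pi> (smult_set d X) = smult_set c X"
      for X :: "('k ^ 'a) set"
      using c(1) by (simp_all add: d_def smult_smult_set)
    have "L \<subseteq> smult_set d B"
      unfolding c(2) d(2) smult_set_mono_iff [OF d(1)] by (rule AB(2))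
    moreover have "smult_set \<pi> (smult_set d B) \<subseteq> L"
      unfolding c(2) d(3) smult_set_mono_iff [OF c(1)] by (rule BA)
    ultimately show ?thesis
      using B(2) lattice_smult_set [OF AB(4) d(1)] homothety_class_eq_iff [of B] d(1)
      by (intro exI [of _ "smult_set d B"]) auto
  qed
qed

text \<open>The default value makes \<open>nrm x\<close> a normalized lattice for every
  \<open>x\<close>, so that the idempotents are available without a vertex condition.\<close>

definition nrm :: "('k ^ 'n) set set \<Rightarrow> ('k ^ 'n) set"
  where "nrm x = (if \<exists>L. normalized L \<and> x = homothety_class L
    then SOME L. normalized L \<and> x = homothety_class L else standard_lattice)"

definition is_vertex :: "('k ^ 'n) set set \<Rightarrow> bool"
  where "is_vertex x \<longleftrightarrow> (\<exists>L. is_lattice L \<and> x = homothety_class L)"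

lemma normalized_standard: "normalized standard_lattice"
proof -
  have "(1 :: 'k ^ 'n) \<in> standard_lattice" "(1 :: 'k ^ 'n) \<notin> smult_set \<pi> standard_lattice"
    using one_less_inverse [of "absv \<pi>"] absv_pi_lt_1
    by (simp_all add: mem_smult_set standard_lattice_def integers_def absv_inverse)
  then show ?thesis
    unfolding normalized_def using lattice_standard by blast
qed

lemma normalized_nrm: "normalized (nrm x)"
proof (cases "\<exists>L. normalized L \<and> x = homothety_class L")
  case True
  from someI_ex [OF this] show ?thesis
    using True by (simp add: nrm_def)
next
  case False
  show ?thesis
    unfolding nrm_def if_not_P [OF False] by (rule normalized_standard)
qed

lemma lattice_nrm: "is_lattice (nrm x)"
  using normalized_nrm [of x] by (simp add: normalized_def)

lemma homothety_class_nrm: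
  assumes "is_vertex x"
  shows "homothety_class (nrm x) = x"
proof -
  obtain L where L: "is_lattice L" "x = homothety_class L"
    using assms by (auto simp: is_vertex_def)
  from ex_normalized [OF L(1)] obtain c where c: "c \<noteq> 0" "normalized (smult_set c L)"
    by blast
  have "x = homothety_class (smult_set c L)"
    unfolding L(2) homothety_class_eq_iff using c(1) by blast
  with c(2) have ex: "\<exists>L. normalized L \<and> x = homothety_class L"
    by (intro exI [of _ "smult_set c L"] conjI)
  have "nrm x = (SOME L. normalized L \<and> x = homothety_class L)"
    unfolding nrm_def by (rule if_P [OF ex])
  then show ?thesis
    using someI_ex [OF ex] by simp
qed

lemma nrm_homothety_class:
  assumes "normalized L"
  shows "nrm (homothety_class L) = L"
proof -
  have "is_vertex (homothety_class L)"
    using assms by (auto simp: is_vertex_def normalized_def)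
  from homothety_class_nrm [OF this, symmetric]
  obtain c where c: "c \<noteq> 0" "nrm (homothety_class L) = smult_set c L"
    unfolding homothety_class_eq_iff by blast
  then show ?thesis
    using normalized_unique [OF assms _ c(1)] normalized_nrm [of "homothety_class L"] by simp
qed

lemma vertex_of_simplex:
  assumes "\<tau> \<in> simplices \<pi> k" "x \<in> \<tau>"
  shows "is_vertex x"
proof -
  obtain C where C: "lattice_chain C" "\<tau> = homothety_class ` C"
    using assms(1) unfolding mem_simplices_iff by blast
  then obtain L where "L \<in> C" "x = homothety_class L"
    using assms(2) by blast
  then show ?thesis
    using C(1) by (auto simp: lattice_chain_def is_vertex_def)
qed

lemma normalized_upper:
  assumes "normalized L" "L \<subseteq> N" "N \<subseteq> standard_lattice" "is_lattice N"
  shows "normalized N"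
  unfolding normalized_def using assms(3,4)
proof (intro conjI)
  show "\<not> N \<subseteq> smult_set \<pi> standard_lattice"
    using assms(1) order_trans [OF assms(2)] by (auto simp only: normalized_def)
qed

text \<open>
  The lattice \<open>N\<close> of the class \<open>y\<close> with \<open>L \<subseteq> N \<subseteq> \<pi>\<^sup>-\<^sup>1 L\<close> is normalized unless it is not
  contained in the standard lattice; then \<open>\<pi> N \<subseteq> L\<close> is.
\<close>

lemma simplex_above_minimal:
  assumes \<tau>: "\<tau> \<in> simplices \<pi> k" and xy: "x \<in> \<tau>" "y \<in> \<tau>" "y \<noteq> x" and min: "\<not> nrm y \<subseteq> nrm x"
  shows "nrm x \<subseteq> nrm y" "smult_set \<pi> (nrm y) \<subseteq> nrm x"
proof -
  note cx = homothety_class_nrm [OF vertex_of_simplex [OF \<tau> xy(1)]]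
  obtain N where N: "is_lattice N" "y = homothety_class N" "nrm x \<subseteq> N" "smult_set \<pi> N \<subseteq> nrm x"
    using simplex_neighbour [OF \<tau>, of "nrm x" y] xy cx by auto
  have x: "nrm x \<subseteq> standard_lattice" "\<not> nrm x \<subseteq> smult_set \<pi> standard_lattice"
    using normalized_nrm [of x] by (simp_all add: normalized_def)
  have "N \<subseteq> standard_lattice"
  proof (rule ccontr)
    assume no: "\<not> N \<subseteq> standard_lattice"
    have "normalized (smult_set \<pi> N)"
      unfolding normalized_def
    proof (intro conjI)
      show "is_lattice (smult_set \<pi> N)"
        using N(1) by (rule lattice_smult_set) simp
      show "smult_set \<pi> N \<subseteq> standard_lattice"
        using N(4) x(1) by (rule order_trans)
      show "\<not> smult_set \<pi> N \<subseteq> smult_set \<pi> standard_lattice"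
        using no by (simp only: smult_set_mono_iff [OF pi_nz] not_False_eq_True)
    qed
    moreover have "y = homothety_class (smult_set \<pi> N)"
      unfolding N(2) homothety_class_eq_iff by (intro exI [of _ \<pi>]) simp
    ultimately have "nrm y = smult_set \<pi> N"
      by (simp add: nrm_homothety_class)
    then show False
      using N(4) min by simp
  qed
  then have "nrm y = N"
    using normalized_upper [OF normalized_nrm N(3) _ N(1)] by (simp add: N(2) nrm_homothety_class)
  then show "nrm x \<subseteq> nrm y" "smult_set \<pi> (nrm y) \<subseteq> nrm x"
    using N(3,4) by simp_all
qed

text \<open>Some multiple \<open>N\<close> of \<open>nrm z\<close> satisfies
  \<open>nrm y \<subseteq> N\<close> and \<open>\<pi> N \<subseteq> nrm y\<close>. By discreteness
  \<open>N\<close> equals \<open>nrm z\<close>, or \<open>N\<close> lies in \<open>\<pi>\<close>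
  times \<open>nrm z\<close>, or \<open>nrm z\<close> lies in \<open>\<pi> N\<close>; each case
  gives an inclusion.\<close>

lemma simplex_comparable:
  assumes \<tau>: "\<tau> \<in> simplices \<pi> k" and yz: "y \<in> \<tau>" "z \<in> \<tau>"
    and L: "L \<subseteq> nrm y" "smult_set \<pi> (nrm z) \<subseteq> L"
  shows "nrm y \<subseteq> nrm z \<or> nrm z \<subseteq> nrm y"
proof (cases "z = y")
  case False
  note cy = homothety_class_nrm [OF vertex_of_simplex [OF \<tau> yz(1)]]
    and cz = homothety_class_nrm [OF vertex_of_simplex [OF \<tau> yz(2)]]
  obtain N where N: "is_lattice N" "z = homothety_class N" "nrm y \<subseteq> N" "smult_set \<pi> N \<subseteq> nrm y"
    using simplex_neighbour [OF \<tau>, of "nrm y" z] yz cy False by auto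
  obtain c where c: "c \<noteq> 0" "N = smult_set c (nrm z)"
    using cz N(2) homothety_class_eq_iff [of "nrm z" N] by auto
  consider "N = nrm z" | "N \<subseteq> smult_set \<pi> (nrm z)" | "nrm z \<subseteq> smult_set \<pi> N"
    using lattice_smult_mono [OF lattice_omodule [OF lattice_nrm] c(1) one_neq_zero]
    unfolding c(2) smult_smult_set mult_1_right smult_set_1 by blast
  then show ?thesis
  proof cases
    case 2
    then have "nrm y \<subseteq> smult_set \<pi> (nrm z)"
      using N(3) by blast
    then show ?thesis
      using smult_pi_subset [OF lattice_omodule [OF lattice_nrm [of z]]] by blast
  qed (use N(3,4) in blast)+
qed simp

end

section \<open>The building as an idempotent complex\<close>

context smooth_setting
begin

definition idem :: "('k ^ 'n) set set \<Rightarrow> 'v \<Rightarrow> 'v"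
  where "idem x = E (nrm x)"

definition below :: "('k ^ 'n) set set \<Rightarrow> ('k ^ 'n) set set \<Rightarrow> bool"
  where "below x y \<longleftrightarrow> nrm x \<subseteq> nrm y"

definition above :: "('k ^ 'n) set set set \<Rightarrow> ('k ^ 'n) set set \<Rightarrow> ('k ^ 'n) set set set"
  where "above T x = {y \<in> T. y \<noteq> x \<and> nrm x \<subseteq> nrm y \<and> smult_set \<pi> (nrm y) \<subseteq> nrm x}"

definition up_closed :: "('k ^ 'n) set set set \<Rightarrow> bool"
  where "up_closed T \<longleftrightarrow> finite T \<and> (\<forall>x\<in>T. is_vertex x) \<and>
    (\<forall>x\<in>T. \<forall>N. normalized N \<and> nrm x \<subseteq> N \<longrightarrow> homothety_class N \<in> T)"

lemma linear_idem: "linear_map (idem x)"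
  unfolding idem_def by (rule linear_E [OF lattice_nrm])

lemma idem_0: "idem x 0 = 0"
  by (rule linear_map_0 [OF linear_idem])

lemma idem_homothety_class:
  assumes "is_lattice L"
  shows "idem (homothety_class L) = E L"
proof -
  have "is_vertex (homothety_class L)"
    using assms by (auto simp: is_vertex_def)
  from homothety_class_nrm [OF this] obtain c where "c \<noteq> 0" "L = smult_set c (nrm (homothety_class L))"
    unfolding homothety_class_eq_iff by blast
  then show ?thesis
    unfolding idem_def using E_smult_set by metis
qed

text \<open>A normalized lattice is not contained in \<open>\<pi>\<close> times the standard
  lattice. This supplies the strictness demanded in \<open>lattice_chain\<close>.\<close>

lemma smult_pi_nrm_ne: "smult_set \<pi> (nrm x) \<noteq> nrm y"
proof
  assume eq: "smult_set \<pi> (nrm x) = nrm y"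
  have "nrm x \<subseteq> standard_lattice"
    using normalized_nrm [of x] by (simp add: normalized_def)
  then have "nrm y \<subseteq> smult_set \<pi> standard_lattice"
    unfolding eq [symmetric] by (rule image_mono)
  then show False
    using normalized_nrm [of y] by (simp add: normalized_def)
qed

text \<open>The inclusion passes through \<open>nrm x\<close>. Used in both orders it is the
  adjacency required by \<open>E_commute\<close>.\<close>

lemma above_adjacent:
  assumes "y \<in> insert x (above T x)" "z \<in> insert x (above T x)"
  shows "smult_set \<pi> (nrm y) \<subseteq> nrm z"
proof -
  have "smult_set \<pi> (nrm y) \<subseteq> nrm x"
    using assms(1) smult_pi_subset [OF lattice_omodule [OF lattice_nrm [of x]]] by (auto simp: above_def)
  moreover have "nrm x \<subseteq> nrm z"
    using assms(2) by (auto simp: above_def)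
  ultimately show ?thesis
    by (rule order_trans)
qed

text \<open>The sum contains \<open>nrm x\<close> and stays in the standard lattice, hence is
  normalized. \<open>M\<close> itself need not contain \<open>nrm x\<close>, which matters in
  \<open>idem_between\<close>.\<close>

lemma msum_above:
  assumes T: "up_closed T" and x: "x \<in> T"
    and L: "is_lattice L" "nrm x \<subseteq> L" "L \<subseteq> standard_lattice" "smult_set \<pi> L \<subseteq> nrm x"
    and M: "is_lattice M" "M \<subseteq> standard_lattice" "smult_set \<pi> M \<subseteq> nrm x" and ne: "\<not> msum L M \<subseteq> nrm x"
  shows "homothety_class (msum L M) \<in> above T x" "nrm (homothety_class (msum L M)) = msum L M"
    "is_lattice (msum L M)"
proof -
  note oL = lattice_omodule [OF L(1)] and oM = lattice_omodule [OF M(1)]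
    and ox = lattice_omodule [OF lattice_nrm [of x]]
  have xN: "nrm x \<subseteq> msum L M"
    using L(2) msum_upper(1) [OF oL oM] by (rule order_trans)
  have Ns: "msum L M \<subseteq> standard_lattice"
    by (intro msum_least omodule_standard L(3) M(2))
  show N: "is_lattice (msum L M)"
    using order_trans [OF M(3) L(2)] by (intro lattice_msum L(1) M(1))
  have norm: "normalized (msum L M)"
    by (rule normalized_upper [OF normalized_nrm xN Ns N])
  show nrm: "nrm (homothety_class (msum L M)) = msum L M"
    by (rule nrm_homothety_class [OF norm])
  have "smult_set \<pi> (msum L M) \<subseteq> nrm x"
  proof
    fix u assume "u \<in> smult_set \<pi> (msum L M)"
    then obtain v w where u: "u = \<pi> *s v + \<pi> *s w" "v \<in> L" "w \<in> M"
      unfolding msum_def by (auto simp: vector_add_ldistrib)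
    have "\<pi> *s v \<in> nrm x" "\<pi> *s w \<in> nrm x"
      using u L(4) M(3) by auto
    then show "u \<in> nrm x"
      unfolding u(1) by (rule omodule_add [OF ox])
  qed
  moreover have "homothety_class (msum L M) \<in> T"
    using T x norm xN unfolding up_closed_def by blast
  moreover have "homothety_class (msum L M) \<noteq> x"
    using nrm ne by auto
  ultimately show "homothety_class (msum L M) \<in> above T x"
    using xN by (simp add: above_def nrm)
qed

lemma idem_between:
  assumes T: "up_closed T" and xy: "x \<in> T" "y \<in> T" "\<not> below y x"
  shows "\<exists>z\<in>above T x. \<forall>v. idem x (idem y v) = idem x (idem z (idem y v))"
proof -
  let ?L = "nrm x" and ?M = "nrm y"
  note L = lattice_nrm [of x] and M = lattice_nrm [of y]
  have std: "?L \<subseteq> standard_lattice" "?M \<subseteq> standard_lattice"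
    using normalized_nrm [of x] normalized_nrm [of y] by (simp_all add: normalized_def)
  define P where "P j \<longleftrightarrow> smult_set (\<pi> ^ j) ?M \<subseteq> ?L" for j
  obtain m where m: "P m"
    unfolding P_def using lattice_absorbs_lattice [OF L M] by blast
  have nP: "\<not> P 0"
    using xy(3) by (simp add: P_def below_def)
  \<comment> \<open>The first scaling of \<open>nrm y\<close> that fits into \<open>nrm x\<close>;
    it is positive, and one factor less gives \<open>M'\<close>. Nonnegative powers keep
    \<open>M'\<close> inside the standard lattice, so the sum is again normalized.\<close>
  define j where "j = (LEAST j. P j)"
  have j: "P j"
    unfolding j_def by (rule LeastI [of P, OF m])
  with nP obtain i where i: "j = Suc i"
    by (cases j) auto
  have ni: "\<not> P i"
    using not_less_Least [of i P] i by (simp add: j_def)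
  define M' where "M' = smult_set (\<pi> ^ i) ?M"
  have M': "is_lattice M'" "smult_set \<pi> M' \<subseteq> ?L" "\<not> M' \<subseteq> ?L" "M' \<subseteq> standard_lattice"
  proof -
    show "is_lattice M'"
      unfolding M'_def by (rule lattice_smult_set [OF M]) simp
    show "smult_set \<pi> M' \<subseteq> ?L"
      using j by (simp add: M'_def P_def i smult_smult_set)
    show "\<not> M' \<subseteq> ?L"
      using ni by (simp add: M'_def P_def)
    show "M' \<subseteq> standard_lattice"
      unfolding M'_def using smult_power_subset_self [OF lattice_omodule [OF M]] std(2) by (rule order_trans)
  qed
  have ne: "\<not> msum ?L M' \<subseteq> ?L"
    using msum_upper(2) [OF lattice_omodule [OF L] lattice_omodule [OF M'(1)]] M'(3) by blast
  note N = msum_above [OF T xy(1) L order_refl std(1) smult_pi_subset [OF lattice_omodule [OF L]] M'(1,4,2) ne]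
  have EM: "E M' = E ?M"
    unfolding M'_def by (rule E_smult_set) simp
  have "E ?L (E (msum ?L M') (E M' v)) = E ?L (E M' v)" for v
    by (rule E_msum [OF L M'(1,2)])
  then show ?thesis
    using N(1) by (intro bexI [of _ "homothety_class (msum ?L M')"]) (simp_all add: idem_def N(2) EM)
qed

lemma idem_join:
  assumes T: "up_closed T" and x: "x \<in> T" and y: "y \<in> above T x" "y' \<in> above T x"
  shows "\<exists>z\<in>above T x. below y z \<and> below y' z \<and> (\<forall>v. idem z (idem y (idem y' v)) = idem y (idem y' v))"
proof -
  let ?L = "nrm y" and ?M = "nrm y'"
  note L = lattice_nrm [of y] and M = lattice_nrm [of y']
  have std: "?L \<subseteq> standard_lattice" "?M \<subseteq> standard_lattice"
    using normalized_nrm [of y] normalized_nrm [of y'] by (simp_all add: normalized_def)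
  have a: "nrm x \<subseteq> ?L" "smult_set \<pi> ?L \<subseteq> nrm x" "smult_set \<pi> ?M \<subseteq> nrm x"
    using y by (simp_all add: above_def)
  have up: "?L \<subseteq> msum ?L ?M" "?M \<subseteq> msum ?L ?M"
    by (rule msum_upper [OF lattice_omodule [OF L] lattice_omodule [OF M]])+
  have ne: "\<not> msum ?L ?M \<subseteq> nrm x"
  proof
    assume "msum ?L ?M \<subseteq> nrm x"
    then have "?L = nrm x"
      using up(1) a(1) by blast
    then have "homothety_class ?L = homothety_class (nrm x)"
      by simp
    moreover have "is_vertex x" "is_vertex y" "y \<noteq> x"
      using T x y(1) by (auto simp: up_closed_def above_def)
    ultimately show False
      by (simp add: homothety_class_nrm)
  qed
  note N = msum_above [OF T x L a(1) std(1) a(2) M std(2) a(3) ne]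
  let ?z = "homothety_class (msum ?L ?M)"
  have adj: "smult_set \<pi> (nrm ?z) \<subseteq> ?L" "smult_set \<pi> ?L \<subseteq> nrm ?z"
    using above_adjacent [of ?z x T y] above_adjacent [of y x T ?z] N(1) y(1) by simp_all
  \<comment> \<open>\<open>E_msum\<close> has the idempotent of the sum in the middle; it can be
    moved past \<open>E ?L\<close> because the sum is adjacent to \<open>?L\<close>.\<close>
  have "E (msum ?L ?M) (E ?L (E ?M v)) = E ?L (E ?M v)" for v
  proof -
    have "E (msum ?L ?M) (E ?L (E ?M v)) = E ?L (E (msum ?L ?M) (E ?M v))"
      by (rule E_commute [OF N(3) L]) (use adj in \<open>simp_all add: N(2)\<close>)
    also have "\<dots> = E ?L (E ?M v)"
      by (rule E_msum [OF L M order_trans [OF a(3,1)]])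
    finally show ?thesis .
  qed
  then show ?thesis
    using N(1) up by (intro bexI [of _ ?z]) (simp_all add: idem_def below_def N(2))
qed

text \<open>Minimality of \<open>x\<close> in a simplex turns its cyclic order into a chain of
  lattices above \<open>nrm x\<close>. Conversely, a chain in \<open>above T x\<close> together with
  \<open>x\<close> is a simplex, since all pairs are adjacent.\<close>

lemma idempotent_complex_building:
  assumes T: "up_closed T" and lab: "labelling \<pi> lab"
  shows "idempotent_complex lab T below (above T) (\<lambda>\<tau>. \<exists>k. \<tau> \<in> simplices \<pi> k) idem"
proof
  have vertex: "is_vertex x" if "x \<in> T" for x
    using T that by (simp add: up_closed_def)
  have eq: "x = y" if "x \<in> T" "y \<in> T" "nrm x = nrm y" for x y
    by (rule homothety_class_nrm [OF vertex [OF that(1)], unfolded that(3)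
          homothety_class_nrm [OF vertex [OF that(2)]], symmetric])
  show "finite T"
    using T by (simp add: up_closed_def)
  show "below x x" "below x y \<Longrightarrow> below y z \<Longrightarrow> below x z" for x y z
    by (auto simp: below_def)
  show "x = y" if "x \<in> T" "y \<in> T" "below x y" "below y x" for x y
    using that eq by (auto simp: below_def)
  show "\<exists>k. \<tau> \<in> simplices \<pi> k" if s: "\<exists>k. \<sigma> \<in> simplices \<pi> k" and t: "\<tau> \<subseteq> \<sigma>" "\<tau> \<noteq> {}" for \<sigma> \<tau>
  proof -
    obtain k where k: "\<sigma> \<in> simplices \<pi> k"
      using s by blast
    have "finite \<tau>"
      using finite_subset [OF t(1) simplices_card(1) [OF k]] .
    then have "card \<tau> = Suc (card \<tau> - 1)"
      using t(2) by (simp add: card_gt_0_iff)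
    from simplices_subset [OF k t(1) this] show ?thesis
      by blast
  qed
  show "inj_on lab \<sigma>" if "\<exists>k. \<sigma> \<in> simplices \<pi> k" for \<sigma>
    using that lab by (auto simp: labelling_def)
  show "above T x \<subseteq> T" for x
    by (auto simp: above_def)
  show "below x y \<and> y \<noteq> x" if "y \<in> above T x" for x y
    using that by (auto simp: above_def below_def)
  show "\<sigma> - {x} \<subseteq> above T x"
    if s: "\<exists>k. \<sigma> \<in> simplices \<pi> k" and \<sigma>: "\<sigma> \<subseteq> T" "x \<in> \<sigma>" and min: "\<forall>y\<in>\<sigma>. below y x \<longrightarrow> y = x" for \<sigma> x
  proof
    fix y assume y: "y \<in> \<sigma> - {x}"
    obtain k where k: "\<sigma> \<in> simplices \<pi> k"
      using s by blast
    have "\<not> nrm y \<subseteq> nrm x"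
      using min y by (auto simp: below_def)
    from simplex_above_minimal [OF k \<sigma>(2) _ _ this] show "y \<in> above T x"
      using y \<sigma>(1) by (auto simp: above_def)
  qed
  show "\<forall>y\<in>\<sigma> - {x}. \<forall>z\<in>\<sigma> - {x}. below y z \<or> below z y"
    if s: "\<exists>k. \<sigma> \<in> simplices \<pi> k" and \<sigma>: "\<sigma> \<subseteq> T" "x \<in> \<sigma>" and min: "\<forall>y\<in>\<sigma>. below y x \<longrightarrow> y = x" for \<sigma> x
  proof (intro ballI)
    fix y z assume yz: "y \<in> \<sigma> - {x}" "z \<in> \<sigma> - {x}"
    obtain k where k: "\<sigma> \<in> simplices \<pi> k"
      using s by blast
    have n: "\<not> nrm y \<subseteq> nrm x" "\<not> nrm z \<subseteq> nrm x"
      using min yz by (auto simp: below_def)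
    have "nrm x \<subseteq> nrm y" "smult_set \<pi> (nrm z) \<subseteq> nrm x"
      using simplex_above_minimal(1) [OF k \<sigma>(2) _ _ n(1)] simplex_above_minimal(2) [OF k \<sigma>(2) _ _ n(2)] yz
      by auto
    from simplex_comparable [OF k _ _ this] show "below y z \<or> below z y"
      using yz by (auto simp: below_def)
  qed
  show "\<exists>k. insert x \<rho> \<in> simplices \<pi> k"
    if x: "x \<in> T" and \<rho>: "\<rho> \<subseteq> above T x" and ch: "\<forall>y\<in>\<rho>. \<forall>z\<in>\<rho>. below y z \<or> below z y" for x \<rho>
  proof -
    have \<rho>T: "insert x \<rho> \<subseteq> T"
      using x \<rho> by (auto simp: above_def)
    have fin: "finite (insert x \<rho>)"
      using \<rho>T \<open>finite T\<close> by (rule finite_subset)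
    have cmp: "nrm y \<subseteq> nrm z \<or> nrm z \<subseteq> nrm y" if "y \<in> insert x \<rho>" "z \<in> insert x \<rho>" for y z
    proof (cases "y = x \<or> z = x")
      case True
      then show ?thesis
        using that \<rho> by (auto simp: above_def)
    next
      case False
      then show ?thesis
        using that ch by (auto simp: below_def)
    qed
    have adj: "smult_set \<pi> (nrm y) \<subset> nrm z" if "y \<in> insert x \<rho>" "z \<in> insert x \<rho>" for y z
      using above_adjacent [of y x T z] that \<rho> smult_pi_nrm_ne [of y z] by blast
    have "lattice_chain (nrm ` insert x \<rho>)"
      unfolding lattice_chain_def using fin cmp adj lattice_nrm by (auto simp del: image_insert)
    moreover have "homothety_class ` nrm ` insert x \<rho> = insert x \<rho>"
    proof -
      have "homothety_class (nrm y) = y" if "y \<in> insert x \<rho>" for y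
        using that \<rho>T by (intro homothety_class_nrm vertex) blast
      then show ?thesis
        unfolding image_image by simp
    qed
    moreover have "card (nrm ` insert x \<rho>) = Suc (card (nrm ` insert x \<rho>) - 1)"
      using fin by (simp add: card_gt_0_iff del: image_insert)
    ultimately show ?thesis
      unfolding mem_simplices_iff by metis
  qed
  show "idem y (v + w) = idem y v + idem y w" for y v w
    by (rule linear_map_add [OF linear_idem])
  show "idem y (idem y v) = idem y v" for y v
    unfolding idem_def by (rule E_idem [OF lattice_nrm])
  show "idem y (idem z v) = idem z (idem y v)"
    if "y \<in> insert x (above T x)" "z \<in> insert x (above T x)" for x y z v
    unfolding idem_def by (intro E_commute lattice_nrm above_adjacent [OF that] above_adjacent [OF that(2,1)])
  show "\<exists>z\<in>above T x. \<forall>v. idem x (idem y v) = idem x (idem z (idem y v))"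
    if "x \<in> T" "y \<in> T" "\<not> below y x" for x y
    by (rule idem_between [OF T that])
  show "\<exists>z\<in>above T x. below y z \<and> below y' z \<and> (\<forall>v. idem z (idem y (idem y' v)) = idem y (idem y' v))"
    if "x \<in> T" "y \<in> above T x" "y' \<in> above T x" for x y y'
    by (rule idem_join [OF T that])
qed

text \<open>It suffices to add all normalized lattices above the given ones, by transitivity of
  inclusion. There are finitely many, as all lie between some \<open>nrm x\<close> and the standard
  lattice.\<close>

lemma ex_up_closed:
  assumes "finite S" "\<And>x. x \<in> S \<Longrightarrow> is_vertex x"
  shows "\<exists>T. up_closed T \<and> S \<subseteq> T"
proof -
  define F where "F = (\<Union>x\<in>S. {N. normalized N \<and> nrm x \<subseteq> N})"
  have "finite F"
    unfolding F_def
  proof (rule finite_UN_I [OF assms(1)])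
    fix x show "finite {N. normalized N \<and> nrm x \<subseteq> N}"
      by (rule finite_subset [OF _ finite_lattices_between [OF lattice_nrm [of x] lattice_standard]])
        (auto simp: normalized_def)
  qed
  then have "finite (homothety_class ` F)"
    by (rule finite_imageI)
  moreover have "is_vertex (homothety_class N)" if "N \<in> F" for N
    using that by (auto simp: F_def is_vertex_def normalized_def)
  moreover have "homothety_class N' \<in> homothety_class ` F"
    if N: "N \<in> F" and N': "normalized N'" "nrm (homothety_class N) \<subseteq> N'" for N N'
  proof -
    have "nrm (homothety_class N) = N"
      using N by (intro nrm_homothety_class) (auto simp: F_def)
    then have "N' \<in> F"
      using N N' by (auto simp: F_def)
    then show ?thesis
      by (rule imageI)
  qed
  ultimately have "up_closed (homothety_class ` F)"
    by (auto simp: up_closed_def)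
  moreover have "x \<in> homothety_class ` F" if "x \<in> S" for x
  proof -
    have "nrm x \<in> F"
      using that normalized_nrm by (auto simp: F_def)
    then have "homothety_class (nrm x) \<in> homothety_class ` F"
      by (rule imageI)
    then show ?thesis
      by (simp add: homothety_class_nrm assms(2) that)
  qed
  ultimately show ?thesis
    by blast
qed

end

section \<open>The chain complex\<close>

context smooth_setting
begin

text \<open>The columns of a matrix are the images of the axes. Integrality of \<open>g\<close> and
  of its inverse follows because both lie in the congruence subgroup.\<close>

lemma principal_congruence_eq: "principal_congruence \<pi> n = cong_group n (standard_lattice :: ('k ^ 'n) set)"
proof
  show "principal_congruence \<pi> n \<subseteq> cong_group n (standard_lattice :: ('k ^ 'n) set)"
  proof
    fix g :: "'k ^ 'n ^ 'n" assume "g \<in> principal_congruence \<pi> n"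
    then have g: "invertible g" "\<And>i j. \<exists>c\<in>integers. (g - mat 1) $ i $ j = \<pi> ^ n * c"
      unfolding principal_congruence_def by blast+
    have "absv ((g - mat 1) $ i $ j) \<le> absv \<pi> ^ n" for i j
      using g(2) [of i j] dvd_integers [of "\<pi> ^ n" "(g - mat 1) $ i $ j"] by (simp add: absv_power)
    then show "g \<in> cong_group n standard_lattice"
      by (rule cong_group_standardI [OF g(1)])
  qed
  show "cong_group n (standard_lattice :: ('k ^ 'n) set) \<subseteq> principal_congruence \<pi> n"
  proof
    fix g :: "'k ^ 'n ^ 'n" assume g: "g \<in> cong_group n standard_lattice"
    have int: "h $ i $ j \<in> integers" if "h \<in> cong_group n standard_lattice" for h :: "'k ^ 'n ^ 'n" and i j
      using cong_group_stable [OF omodule_standard that axis_standard [of j]]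
      by (simp add: mult_axis standard_lattice_def column_def)
    have "matrix_inv g \<in> cong_group n standard_lattice"
      using n_gt_1 by (intro cong_group_inv [OF lattice_standard _ g]) simp
    moreover have "\<exists>c\<in>integers. (g - mat 1) $ i $ j = \<pi> ^ n * c" for i j
    proof -
      obtain w where w: "w \<in> standard_lattice" "g *v axis j 1 - axis j 1 = \<pi> ^ n *s w"
        using cong_groupD(2) [OF g axis_standard [of j]] by blast
      have "(g - mat 1) $ i $ j = (g *v axis j 1 - axis j 1) $ i"
        by (simp only: mult_axis) (simp add: column_def axis_def mat_def)
      also have "\<dots> = \<pi> ^ n * w $ i"
        by (simp add: w(2))
      finally show ?thesis
        using w(1) by (auto simp: standard_lattice_def)
    qed
    ultimately show "g \<in> principal_congruence \<pi> n"
      unfolding principal_congruence_def using int g cong_groupD(1) [OF g] by simp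
  qed
qed

lemma translate_homothety_class:
  fixes g :: "'k ^ 'n ^ 'n"
  shows "translate g (homothety_class L) = homothety_class ((\<lambda>v. g *v v) ` L)"
  unfolding translate_def homothety_class_def image_mult_smult_set [symmetric] by blast

text \<open>All matrices carrying the standard vertex to the class of \<open>L\<close> give the same
  conjugate, because they carry the standard lattice to a multiple of \<open>L\<close>.\<close>

lemma vertex_group_eq:
  fixes L :: "('k ^ 'n) set"
  assumes L: "is_lattice L"
  shows "vertex_group \<pi> n (homothety_class L) = cong_group n L"
proof
  show "vertex_group \<pi> n (homothety_class L) \<subseteq> cong_group n L"
  proof
    fix h assume "h \<in> vertex_group \<pi> n (homothety_class L)"
    then obtain g u where g: "h = g ** u ** matrix_inv g" "invertible g"
      "homothety_class L = translate g (homothety_class standard_lattice)" "u \<in> cong_group n standard_lattice"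
      unfolding vertex_group_def principal_congruence_eq by blast
    from g(3) obtain c where c: "c \<noteq> 0" "(\<lambda>v. g *v v) ` standard_lattice = smult_set c L"
      unfolding translate_homothety_class homothety_class_eq_iff by blast
    have "h \<in> cong_group n ((\<lambda>v. g *v v) ` standard_lattice)"
      unfolding g(1) by (rule cong_group_conj [OF g(4,2)])
    then show "h \<in> cong_group n L"
      unfolding c(2) cong_group_smult_set [OF c(1)] .
  qed
  show "cong_group n L \<subseteq> vertex_group \<pi> n (homothety_class L)"
  proof
    fix h assume h: "h \<in> cong_group n L"
    obtain g :: "'k ^ 'n ^ 'n" where g: "invertible g" "L = (\<lambda>v. g *v v) ` standard_lattice"
      using L is_lattice_iff by blast
    note inv = matrix_inv_props [OF g(1)]
    define u where "u = matrix_inv g ** h ** g"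
    have "(\<lambda>v. matrix_inv g *v v) ` L = standard_lattice"
      by (simp add: g(2) image_image inv)
    then have u: "u \<in> principal_congruence \<pi> n"
      unfolding principal_congruence_eq u_def using cong_group_conj [OF h inv(3)] by (simp add: matrix_inv_matrix_inv [OF g(1)])
    have "g ** u ** matrix_inv g = (g ** matrix_inv g) ** h ** (g ** matrix_inv g)"
      by (simp add: u_def matrix_mul_assoc)
    then have "h = g ** u ** matrix_inv g"
      by (simp add: inv(1))
    moreover have "homothety_class L = translate g (homothety_class standard_lattice)"
      by (simp add: translate_homothety_class g(2))
    ultimately show "h \<in> vertex_group \<pi> n (homothety_class L)"
      unfolding vertex_group_def using g(1) u by blast
  qed
qed

lemma rho_generate:
  assumes "S \<subseteq> carrier GL" "\<And>g. g \<in> S \<Longrightarrow> \<rho> g v = v" "g \<in> generate GL S"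
  shows "\<rho> g v = v"
proof -
  have "invertible g \<and> \<rho> g v = v"
    using assms(3)
  proof (induction g rule: generate.induct)
    case one
    then show ?case
      by (simp add: rep_one invertible_iff_ker)
  next
    case (incl h)
    then show ?case
      using assms(1,2) by auto
  next
    case (inv h)
    then have h: "invertible h" "\<rho> h v = v"
      using assms(1,2) by auto
    then show ?case
      using matrix_inv_props(3) [OF h(1)] rho_inverse(1) [OF h(1), of v] by (simp add: inv_GL)
  next
    case (eng g h)
    then show ?case
      by (simp add: invertible_mult rep_mult)
  qed
  then show ?thesis
    by simp
qed

text \<open>A generated group fixes a vector as soon as its generators do, and for one vertex this
  means being fixed by the averaging idempotent. From here on the groups of simplices no longer
  appear.\<close>

lemma mem_fixed_vectors_iff:
  assumes "\<tau> \<in> simplices \<pi> k"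
  shows "v \<in> fixed_vectors \<rho> (simplex_group \<pi> n \<tau>) \<longleftrightarrow> (\<forall>x\<in>\<tau>. idem x v = v)"
proof -
  have vg: "vertex_group \<pi> n x = cong_group n (nrm x)" if "x \<in> \<tau>" for x
    using vertex_group_eq [OF lattice_nrm [of x]] homothety_class_nrm [OF vertex_of_simplex [OF assms that]]
    by simp
  have idem: "idem x v = v \<longleftrightarrow> (\<forall>g\<in>vertex_group \<pi> n x. \<rho> g v = v)" if "x \<in> \<tau>" for x
    unfolding idem_def vg [OF that] by (rule E_eq_iff [OF lattice_nrm])
  let ?S = "\<Union>x\<in>\<tau>. vertex_group \<pi> n x"
  have S: "?S \<subseteq> carrier GL"
    using vg cong_groupD(1) by fastforce
  have "v \<in> fixed_vectors \<rho> (simplex_group \<pi> n \<tau>) \<longleftrightarrow> (\<forall>g\<in>?S. \<rho> g v = v)"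
  proof
    assume "v \<in> fixed_vectors \<rho> (simplex_group \<pi> n \<tau>)"
    then show "\<forall>g\<in>?S. \<rho> g v = v"
      unfolding fixed_vectors_def simplex_group_def using generate.incl [of _ ?S GL] by simp
  next
    assume *: "\<forall>g\<in>?S. \<rho> g v = v"
    show "v \<in> fixed_vectors \<rho> (simplex_group \<pi> n \<tau>)"
      unfolding fixed_vectors_def simplex_group_def
    proof (intro CollectI ballI)
      fix g assume "g \<in> generate GL ?S"
      from rho_generate [OF S _ this] show "\<rho> g v = v"
        using * by blast
    qed
  qed
  then show ?thesis
    by (simp add: idem)
qed

text \<open>Outside the simplices \<open>c\<close> is 0, which every \<open>idem x\<close> fixes; so
  the condition can be stated for all sets at once.\<close>

lemma coeff_chains_iff:
  "c \<in> coeff_chains \<pi> n \<rho> k \<longleftrightarrow> finite {\<tau>. c \<tau> \<noteq> 0} \<and> (\<forall>\<tau>. c \<tau> \<noteq> 0 \<longrightarrow> \<tau> \<in> simplices \<pi> k) \<and>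
    (\<forall>\<tau>. \<forall>x\<in>\<tau>. idem x (c \<tau>) = c \<tau>)"
proof -
  have "(\<forall>\<tau>\<in>simplices \<pi> k. c \<tau> \<in> fixed_vectors \<rho> (simplex_group \<pi> n \<tau>)) \<longleftrightarrow>
      (\<forall>\<tau>. \<forall>x\<in>\<tau>. idem x (c \<tau>) = c \<tau>)" if "\<forall>\<tau>. \<tau> \<notin> simplices \<pi> k \<longrightarrow> c \<tau> = 0"
  proof
    assume *: "\<forall>\<tau>\<in>simplices \<pi> k. c \<tau> \<in> fixed_vectors \<rho> (simplex_group \<pi> n \<tau>)"
    show "\<forall>\<tau>. \<forall>x\<in>\<tau>. idem x (c \<tau>) = c \<tau>"
    proof (intro allI)
      fix \<tau>
      show "\<forall>x\<in>\<tau>. idem x (c \<tau>) = c \<tau>"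
        using * that mem_fixed_vectors_iff [of \<tau> k "c \<tau>"] by (cases "\<tau> \<in> simplices \<pi> k") (simp_all add: idem_0)
    qed
  qed (simp add: mem_fixed_vectors_iff)
  then show ?thesis
    unfolding coeff_chains_def by blast
qed

lemma scl_incidence: "scl (of_int ((- 1) ^ m)) v = signed m v"
  by (cases "even m") (simp_all add: signed_def scl_one scl_minus_1)

section \<open>Boundary and augmentation as one differential; exactness\<close>

context
  fixes lab :: "('k ^ 'n) set set \<Rightarrow> nat"
  assumes lab: "labelling \<pi> lab"
begin

lemma inj_on_simplex: "\<tau> \<in> simplices \<pi> k \<Longrightarrow> inj_on lab \<tau>"
  using lab by (simp add: labelling_def)

lemma simplices_insertD:
  assumes "insert y \<tau> \<in> simplices \<pi> (Suc k)" "y \<notin> \<tau>"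
  shows "\<tau> \<in> simplices \<pi> k"
proof (rule simplices_subset [OF assms(1)])
  have "finite \<tau>"
    using simplices_card(1) [OF assms(1)] by simp
  then show "card \<tau> = Suc k"
    using simplices_card(2) [OF assms(1)] assms(2) by simp
qed blast

text \<open>A simplex one dimension up that contains \<open>\<tau>\<close> arises by adding a unique
  vertex, which converts the sum over simplices into one over vertices. Where \<open>\<tau>\<close>
  is not a simplex, \<open>bd\<close> vanishes by itself, since faces of simplices are
  simplices.\<close>

lemma boundary_eq_bd:
  assumes T: "finite T" and c: "\<And>\<tau>. c \<tau> \<noteq> 0 \<Longrightarrow> \<tau> \<in> simplices \<pi> (Suc k) \<and> \<tau> \<subseteq> T"
  shows "boundary \<pi> lab scl k c = bd lab T c"
proof
  fix \<tau>
  show "boundary \<pi> lab scl k c \<tau> = bd lab T c \<tau>"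
  proof (cases "\<tau> \<in> simplices \<pi> k")
    case False
    have "c (insert y \<tau>) = 0" if "y \<in> T - \<tau>" for y
      using c [of "insert y \<tau>"] simplices_insertD [of y \<tau> k] that False by blast
    then show ?thesis
      using False by (simp add: boundary_def bd_def)
  next
    case True
    define Y where "Y = {y \<in> T - \<tau>. c (insert y \<tau>) \<noteq> 0}"
    have "{\<tau>'. \<tau>' \<in> simplices \<pi> (Suc k) \<and> \<tau> \<subseteq> \<tau>' \<and> c \<tau>' \<noteq> 0} = (\<lambda>y. insert y \<tau>) ` Y"
    proof (intro subset_antisym subsetI)
      fix \<tau>' assume "\<tau>' \<in> {\<tau>'. \<tau>' \<in> simplices \<pi> (Suc k) \<and> \<tau> \<subseteq> \<tau>' \<and> c \<tau>' \<noteq> 0}"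
      then have \<tau>': "\<tau>' \<in> simplices \<pi> (Suc k)" "\<tau> \<subseteq> \<tau>'" "c \<tau>' \<noteq> 0"
        by auto
      have "card (\<tau>' - \<tau>) = 1"
        using simplices_card [OF \<tau>'(1)] simplices_card [OF True] \<tau>'(2) by (simp add: card_Diff_subset)
      then obtain y where "\<tau>' - \<tau> = {y}"
        by (auto simp: card_1_singleton_iff)
      then have "\<tau>' = insert y \<tau>" "y \<in> T - \<tau>"
        using \<tau>'(2) c [OF \<tau>'(3)] by blast+
      then show "\<tau>' \<in> (\<lambda>y. insert y \<tau>) ` Y"
        using \<tau>'(3) by (simp add: Y_def)
    next
      fix \<tau>' assume "\<tau>' \<in> (\<lambda>y. insert y \<tau>) ` Y"
      then obtain y where "\<tau>' = insert y \<tau>" "c \<tau>' \<noteq> 0"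
        by (auto simp: Y_def)
      then show "\<tau>' \<in> {\<tau>'. \<tau>' \<in> simplices \<pi> (Suc k) \<and> \<tau> \<subseteq> \<tau>' \<and> c \<tau>' \<noteq> 0}"
        using c [of \<tau>'] by blast
    qed
    moreover have "inj_on (\<lambda>y. insert y \<tau>) Y"
      by (rule inj_onI) (auto simp: Y_def)
    ultimately have "boundary \<pi> lab scl k c \<tau>
        = (\<Sum>y\<in>Y. scl (of_int (incidence lab (insert y \<tau>) \<tau>)) (c (insert y \<tau>)))"
      using True by (simp add: boundary_def sum.reindex)
    also have "\<dots> = (\<Sum>y\<in>Y. signed (label_pos lab y \<tau>) (c (insert y \<tau>)))"
    proof (rule sum.cong [OF refl])
      fix y assume "y \<in> Y"
      then have "insert y \<tau> - \<tau> = {y}"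
        by (auto simp: Y_def)
      \<comment> \<open>\<open>incidence\<close> counts in the larger simplex and
        \<open>label_pos\<close> in the smaller one; they agree because \<open>y\<close> does not
        precede itself.\<close>
      moreover have "{z \<in> insert y \<tau>. lab z < lab y} = {z \<in> \<tau>. lab z < lab y}"
        by auto
      ultimately have "incidence lab (insert y \<tau>) \<tau> = (- 1) ^ label_pos lab y \<tau>"
        by (simp add: incidence_def label_pos_def)
      then show "scl (of_int (incidence lab (insert y \<tau>) \<tau>)) (c (insert y \<tau>))
          = signed (label_pos lab y \<tau>) (c (insert y \<tau>))"
        by (simp only: scl_incidence)
    qed
    also have "\<dots> = bd lab T c \<tau>"
      unfolding bd_def Y_def by (rule sum.mono_neutral_left) (use T in auto)
    finally show ?thesis .
  qed
qed

text \<open>Removing the only vertex of a 0-simplex leaves the empty set, so the differential of a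
  0-chain is concentrated there.\<close>

lemma augmentation_eq_bd:
  assumes T: "finite T" and c: "\<And>\<tau>. c \<tau> \<noteq> 0 \<Longrightarrow> \<tau> \<in> simplices \<pi> 0 \<and> \<tau> \<subseteq> T"
  shows "bd lab T c = (\<lambda>\<tau>. if \<tau> = {} then augmentation \<pi> c else 0)"
proof
  fix \<tau>
  show "bd lab T c \<tau> = (if \<tau> = {} then augmentation \<pi> c else 0)"
  proof (cases "\<tau> = {}")
    case True
    have "{\<tau>. \<tau> \<in> simplices \<pi> 0 \<and> c \<tau> \<noteq> 0} = (\<lambda>y. {y}) ` {y \<in> T. c {y} \<noteq> 0}"
    proof (intro subset_antisym subsetI)
      fix \<tau> assume "\<tau> \<in> {\<tau>. \<tau> \<in> simplices \<pi> 0 \<and> c \<tau> \<noteq> 0}"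
      then have \<tau>: "\<tau> \<in> simplices \<pi> 0" "c \<tau> \<noteq> 0"
        by auto
      then obtain y where "\<tau> = {y}"
        using simplices_card(2) [OF \<tau>(1)] by (auto simp: card_1_singleton_iff)
      then show "\<tau> \<in> (\<lambda>y. {y}) ` {y \<in> T. c {y} \<noteq> 0}"
        using \<tau>(2) c [OF \<tau>(2)] by auto
    next
      fix \<tau> assume "\<tau> \<in> (\<lambda>y. {y}) ` {y \<in> T. c {y} \<noteq> 0}"
      then show "\<tau> \<in> {\<tau>. \<tau> \<in> simplices \<pi> 0 \<and> c \<tau> \<noteq> 0}"
        using c [of \<tau>] by auto
    qed
    then have "augmentation \<pi> c = (\<Sum>y\<in>{y \<in> T. c {y} \<noteq> 0}. c {y})"
      by (simp add: augmentation_def sum.reindex)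
    also have "\<dots> = (\<Sum>y\<in>T. c {y})"
      by (rule sum.mono_neutral_left) (use T in auto)
    finally show ?thesis
      using True by (simp add: bd_def)
  next
    case False
    have "c (insert y \<tau>) = 0" if "y \<in> T - \<tau>" for y
    proof (rule ccontr)
      assume "c (insert y \<tau>) \<noteq> 0"
      from c [OF this] have "insert y \<tau> \<in> simplices \<pi> 0"
        by simp
      from simplices_card [OF this] show False
        using that False by simp
    qed
    then show ?thesis
      using False by (simp add: bd_def)
  qed
qed

lemma support_up_closed:
  assumes "c \<in> coeff_chains \<pi> n \<rho> k"
  shows "\<exists>T. up_closed T \<and> (\<forall>\<tau>. c \<tau> \<noteq> 0 \<longrightarrow> \<tau> \<in> simplices \<pi> k \<and> \<tau> \<subseteq> T)"
proof -
  have c: "finite {\<tau>. c \<tau> \<noteq> 0}" "\<And>\<tau>. c \<tau> \<noteq> 0 \<Longrightarrow> \<tau> \<in> simplices \<pi> k"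
    using assms by (auto simp: coeff_chains_iff)
  have "finite (\<Union>{\<tau>. c \<tau> \<noteq> 0})"
    using c(1) simplices_card(1) [OF c(2)] by blast
  moreover have "is_vertex x" if "x \<in> \<Union>{\<tau>. c \<tau> \<noteq> 0}" for x
    using that vertex_of_simplex c(2) by blast
  ultimately obtain T where "up_closed T" "\<Union>{\<tau>. c \<tau> \<noteq> 0} \<subseteq> T"
    using ex_up_closed by metis
  then show ?thesis
    using c(2) by blast
qed

lemma up_closed_finite: "up_closed T \<Longrightarrow> finite T"
  by (simp add: up_closed_def)

lemma ex_primitive:
  assumes T: "up_closed T" and c: "c \<in> coeff_chains \<pi> n \<rho> k" "\<And>\<tau>. c \<tau> \<noteq> 0 \<Longrightarrow> \<tau> \<subseteq> T"
    and cycle: "bd lab T c = (\<lambda>_. 0)"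
  shows "\<exists>b\<in>coeff_chains \<pi> n \<rho> (Suc k). boundary \<pi> lab scl k b = c"
proof -
  interpret C: idempotent_complex lab T below "above T" "\<lambda>\<tau>. \<exists>k. \<tau> \<in> simplices \<pi> k" idem
    by (rule idempotent_complex_building [OF T lab])
  have c': "\<And>\<tau>. c \<tau> \<noteq> 0 \<Longrightarrow> \<tau> \<in> simplices \<pi> k" "\<And>\<tau> x. x \<in> \<tau> \<Longrightarrow> idem x (c \<tau>) = c \<tau>"
    using c(1) by (auto simp: coeff_chains_iff)
  have "c {} = 0"
    using c'(1) [of "{}"] simplices_card(2) [of "{}" k] by auto
  then have "C.chains_on T c"
    using c(2) c' unfolding C.chains_on_def by blast
  then obtain b where b: "C.chains_on T b" "bd lab T b = c"
    using C.acyclic [OF order_refl C.up_T _ cycle] by blast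
  \<comment> \<open>\<open>acyclic\<close> returns a chain of mixed dimension. Only its part with
    \<open>Suc (Suc k)\<close> vertices can contribute to \<open>c\<close>, so the rest is cut
    off.\<close>
  define b' where "b' \<tau> = (if card \<tau> = Suc (Suc k) then b \<tau> else 0)" for \<tau>
  have b'_spx: "\<tau> \<in> simplices \<pi> (Suc k) \<and> \<tau> \<subseteq> T" if "b' \<tau> \<noteq> 0" for \<tau>
  proof -
    have *: "card \<tau> = Suc (Suc k)" "b \<tau> \<noteq> 0"
      using that by (auto simp: b'_def split: if_splits)
    then obtain l where l: "\<tau> \<in> simplices \<pi> l" "\<tau> \<subseteq> T"
      using b(1) unfolding C.chains_on_def by blast
    then show ?thesis
      using simplices_card(2) [OF l(1)] *(1) by simp
  qed
  have "b' \<in> coeff_chains \<pi> n \<rho> (Suc k)"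
    unfolding coeff_chains_iff
  proof (intro conjI)
    show "finite {\<tau>. b' \<tau> \<noteq> 0}"
      using b'_spx by (intro finite_subset [OF _ finite_Pow_iff [THEN iffD2, OF C.finite_T]]) blast
    show "\<forall>\<tau>. b' \<tau> \<noteq> 0 \<longrightarrow> \<tau> \<in> simplices \<pi> (Suc k)"
      using b'_spx by blast
    show "\<forall>\<tau>. \<forall>x\<in>\<tau>. idem x (b' \<tau>) = b' \<tau>"
      using b(1) unfolding C.chains_on_def b'_def by (simp add: idem_0)
  qed
  moreover have "boundary \<pi> lab scl k b' = c"
  proof
    fix \<tau>
    have "boundary \<pi> lab scl k b' \<tau> = bd lab T b' \<tau>"
      by (rule fun_cong [OF boundary_eq_bd]) (fact C.finite_T, rule b'_spx)
    also have "\<dots> = c \<tau>"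
    proof (cases "finite \<tau> \<and> card \<tau> = Suc k")
      case True
      have "bd lab T b' \<tau> = bd lab T b \<tau>"
        unfolding bd_def by (rule sum.cong) (use True in \<open>auto simp: b'_def\<close>)
      then show ?thesis
        by (simp add: b(2))
    next
      case False
      then have "c \<tau> = 0"
        using c'(1) [of \<tau>] simplices_card [of \<tau> k] by blast
      moreover have "b' (insert y \<tau>) = 0" if "y \<in> T - \<tau>" for y
        using False that by (cases "finite \<tau>") (auto simp: b'_def)
      ultimately show ?thesis
        by (simp add: bd_def)
    qed
    finally show "boundary \<pi> lab scl k b' \<tau> = c \<tau>" .
  qed
  ultimately show ?thesis
    by blast
qed

text \<open>The second claim keeps the vertex set \<open>T\<close> explicit, because the same
  identity is read as a vanishing boundary in positive degrees and as a vanishing augmentation in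
  degree 0.\<close>

lemma boundary_coeff_chains:
  assumes "b \<in> coeff_chains \<pi> n \<rho> (Suc k)"
  shows "boundary \<pi> lab scl k b \<in> coeff_chains \<pi> n \<rho> k"
    "\<exists>T. finite T \<and> (\<forall>\<tau>. boundary \<pi> lab scl k b \<tau> \<noteq> 0 \<longrightarrow> \<tau> \<subseteq> T) \<and>
      bd lab T (boundary \<pi> lab scl k b) = (\<lambda>_. 0)"
proof -
  obtain T where T: "up_closed T" "\<And>\<tau>. b \<tau> \<noteq> 0 \<Longrightarrow> \<tau> \<in> simplices \<pi> (Suc k) \<and> \<tau> \<subseteq> T"
    using support_up_closed [OF assms] by blast
  note fin = up_closed_finite [OF T(1)]
  have eq: "boundary \<pi> lab scl k b = bd lab T b"
    by (rule boundary_eq_bd [OF fin T(2)])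
  have supp: "\<tau> \<subseteq> T \<and> \<tau> \<in> simplices \<pi> k" if ne: "bd lab T b \<tau> \<noteq> 0" for \<tau>
  proof -
    obtain y where y: "y \<in> T - \<tau>" "b (insert y \<tau>) \<noteq> 0"
      using ne unfolding bd_def by (elim sum.not_neutral_contains_not_neutral) auto
    then show ?thesis
      using T(2) [OF y(2)] simplices_insertD [of y \<tau> k] by blast
  qed
  show "boundary \<pi> lab scl k b \<in> coeff_chains \<pi> n \<rho> k"
    unfolding eq coeff_chains_iff
  proof (intro conjI allI ballI impI)
    show "finite {\<tau>. bd lab T b \<tau> \<noteq> 0}"
      using supp by (intro finite_subset [OF _ finite_Pow_iff [THEN iffD2, OF fin]]) blast
    show "\<tau> \<in> simplices \<pi> k" if "bd lab T b \<tau> \<noteq> 0" for \<tau>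
      using supp [OF that] by simp
    show "idem x (bd lab T b \<tau>) = bd lab T b \<tau>" if x: "x \<in> \<tau>" for \<tau> x
    proof -
      have minus: "idem x (- v) = - idem x v" for v
        using linear_map_add [OF linear_idem, of x v "- v"] by (simp add: idem_0 eq_neg_iff_add_eq_0 add.commute)
      have "idem x (b (insert y \<tau>)) = b (insert y \<tau>)" for y
        using assms x by (simp add: coeff_chains_iff)
      then have "idem x (signed m (b (insert y \<tau>))) = signed m (b (insert y \<tau>))" for m y
        by (simp add: signed_def minus)
      then show ?thesis
        by (simp add: bd_def linear_map_sum [OF linear_idem])
    qed
  qed
  have "bd lab T (bd lab T b) \<tau> = 0" for \<tau>
  proof (rule bd_bd [OF fin])
    fix \<tau> assume "b \<tau> \<noteq> 0"
    from T(2) [OF this] show "\<tau> \<subseteq> T \<and> inj_on lab \<tau>"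
      using inj_on_simplex by blast
  qed
  then have "bd lab T (boundary \<pi> lab scl k b) = (\<lambda>_. 0)"
    unfolding eq by (rule ext)
  then show "\<exists>T. finite T \<and> (\<forall>\<tau>. boundary \<pi> lab scl k b \<tau> \<noteq> 0 \<longrightarrow> \<tau> \<subseteq> T) \<and>
      bd lab T (boundary \<pi> lab scl k b) = (\<lambda>_. 0)"
    using fin supp unfolding eq by blast
qed

lemma exact_at_0:
  "{c \<in> coeff_chains \<pi> n \<rho> 0. augmentation \<pi> c = 0} = boundary \<pi> lab scl 0 ` coeff_chains \<pi> n \<rho> (Suc 0)"
proof (intro subset_antisym subsetI)
  fix c assume "c \<in> {c \<in> coeff_chains \<pi> n \<rho> 0. augmentation \<pi> c = 0}"
  then have c: "c \<in> coeff_chains \<pi> n \<rho> 0" "augmentation \<pi> c = 0"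
    by auto
  obtain T where T: "up_closed T" "\<And>\<tau>. c \<tau> \<noteq> 0 \<Longrightarrow> \<tau> \<in> simplices \<pi> 0 \<and> \<tau> \<subseteq> T"
    using support_up_closed [OF c(1)] by blast
  have "bd lab T c = (\<lambda>\<tau>. if \<tau> = {} then augmentation \<pi> c else 0)"
    by (rule augmentation_eq_bd [OF up_closed_finite [OF T(1)] T(2)])
  then have "bd lab T c = (\<lambda>_. 0)"
    using c(2) by (simp add: fun_eq_iff)
  from ex_primitive [OF T(1) c(1) _ this] show "c \<in> boundary \<pi> lab scl 0 ` coeff_chains \<pi> n \<rho> (Suc 0)"
    using T(2) by blast
next
  fix c assume "c \<in> boundary \<pi> lab scl 0 ` coeff_chains \<pi> n \<rho> (Suc 0)"
  then obtain b where b: "b \<in> coeff_chains \<pi> n \<rho> (Suc 0)" "c = boundary \<pi> lab scl 0 b"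
    by blast
  from boundary_coeff_chains [OF b(1)] obtain T where c: "c \<in> coeff_chains \<pi> n \<rho> 0"
    and T: "finite T" "\<And>\<tau>. c \<tau> \<noteq> 0 \<Longrightarrow> \<tau> \<subseteq> T" "bd lab T c = (\<lambda>_. 0)"
    unfolding b(2) by blast
  have "bd lab T c = (\<lambda>\<tau>. if \<tau> = {} then augmentation \<pi> c else 0)"
    using c T(2) by (intro augmentation_eq_bd [OF T(1)]) (simp add: coeff_chains_iff)
  from fun_cong [OF this, of "{}"] have "augmentation \<pi> c = 0"
    by (simp add: T(3))
  then show "c \<in> {c \<in> coeff_chains \<pi> n \<rho> 0. augmentation \<pi> c = 0}"
    using c by simp
qed

lemma exact_at_Suc:
  "{c \<in> coeff_chains \<pi> n \<rho> (Suc k). boundary \<pi> lab scl k c = (\<lambda>_. 0)}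
    = boundary \<pi> lab scl (Suc k) ` coeff_chains \<pi> n \<rho> (Suc (Suc k))"
proof (intro subset_antisym subsetI)
  fix c assume "c \<in> {c \<in> coeff_chains \<pi> n \<rho> (Suc k). boundary \<pi> lab scl k c = (\<lambda>_. 0)}"
  then have c: "c \<in> coeff_chains \<pi> n \<rho> (Suc k)" "boundary \<pi> lab scl k c = (\<lambda>_. 0)"
    by auto
  obtain T where T: "up_closed T" "\<And>\<tau>. c \<tau> \<noteq> 0 \<Longrightarrow> \<tau> \<in> simplices \<pi> (Suc k) \<and> \<tau> \<subseteq> T"
    using support_up_closed [OF c(1)] by blast
  have "boundary \<pi> lab scl k c = bd lab T c"
    by (rule boundary_eq_bd [OF up_closed_finite [OF T(1)] T(2)])
  then have "bd lab T c = (\<lambda>_. 0)"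
    using c(2) by simp
  from ex_primitive [OF T(1) c(1) _ this]
  show "c \<in> boundary \<pi> lab scl (Suc k) ` coeff_chains \<pi> n \<rho> (Suc (Suc k))"
    using T(2) by blast
next
  fix c assume "c \<in> boundary \<pi> lab scl (Suc k) ` coeff_chains \<pi> n \<rho> (Suc (Suc k))"
  then obtain b where b: "b \<in> coeff_chains \<pi> n \<rho> (Suc (Suc k))" "c = boundary \<pi> lab scl (Suc k) b"
    by blast
  from boundary_coeff_chains [OF b(1)] obtain T where c: "c \<in> coeff_chains \<pi> n \<rho> (Suc k)"
    and T: "finite T" "\<And>\<tau>. c \<tau> \<noteq> 0 \<Longrightarrow> \<tau> \<subseteq> T" "bd lab T c = (\<lambda>_. 0)"
    unfolding b(2) by blast
  have "boundary \<pi> lab scl k c = bd lab T c"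
    using c T(2) by (intro boundary_eq_bd [OF T(1)]) (simp add: coeff_chains_iff)
  then show "c \<in> {c \<in> coeff_chains \<pi> n \<rho> (Suc k). boundary \<pi> lab scl k c = (\<lambda>_. 0)}"
    using c T(3) by simp
qed

end

section \<open>Surjectivity of the augmentation\<close>

lemma augmentation_add:
  assumes "finite {\<tau>. c \<tau> \<noteq> 0}" "finite {\<tau>. d \<tau> \<noteq> 0}"
  shows "augmentation \<pi> (\<lambda>\<tau>. c \<tau> + d \<tau>) = augmentation \<pi> c + augmentation \<pi> d"
proof -
  let ?A = "simplices \<pi> 0 \<inter> ({\<tau>. c \<tau> \<noteq> 0} \<union> {\<tau>. d \<tau> \<noteq> 0})"
  have A: "finite ?A"
    using assms by simp
  have "augmentation \<pi> f = (\<Sum>\<tau>\<in>?A. f \<tau>)" if "\<And>\<tau>. f \<tau> \<noteq> 0 \<Longrightarrow> c \<tau> \<noteq> 0 \<or> d \<tau> \<noteq> 0" for f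
    unfolding augmentation_def by (rule sum.mono_neutral_left [OF A]) (use that in auto)
  from this [of "\<lambda>\<tau>. c \<tau> + d \<tau>"] this [of c] this [of d] show ?thesis
    by (simp add: sum.distrib) fastforce
qed

lemma augmentation_scl:
  assumes "finite {\<tau>. c \<tau> \<noteq> 0}" "r \<in> Z_inv p"
  shows "augmentation \<pi> (\<lambda>\<tau>. scl r (c \<tau>)) = scl r (augmentation \<pi> c)"
proof -
  have "augmentation \<pi> (\<lambda>\<tau>. scl r (c \<tau>)) = (\<Sum>\<tau> | \<tau> \<in> simplices \<pi> 0 \<and> c \<tau> \<noteq> 0. scl r (c \<tau>))"
    unfolding augmentation_def
    by (rule sum.mono_neutral_left) (use assms in \<open>auto simp: scl_zero_right intro: finite_subset\<close>)
  then show ?thesis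
    by (simp add: augmentation_def scl_sum assms(2))
qed

text \<open>
  The vectors all of whose translates lie in the image of the augmentation form a
  subrepresentation.
\<close>

lemma surj_augmentation:
  assumes gen: "generated_by p scl \<rho> (fixed_vectors \<rho> (principal_congruence \<pi> n))"
  shows "augmentation \<pi> ` coeff_chains \<pi> n \<rho> 0 = UNIV"
proof -
  let ?R = "augmentation \<pi> ` coeff_chains \<pi> n \<rho> 0"
  have R_E: "v \<in> ?R" if L: "is_lattice L" and v: "E L v = v" for L v
  proof -
    let ?x = "homothety_class L"
    define c where "c = (\<lambda>\<tau>. if \<tau> = {?x} then v else 0)"
    \<comment> \<open>\<open>lattice_chain\<close> asks for strict inclusions, also between a
      lattice and its own multiple by \<open>\<pi>\<close>.\<close>
    have pi_ne: "smult_set \<pi> L \<noteq> L"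
    proof
      assume eq: "smult_set \<pi> L = L"
      obtain d where d: "d \<noteq> 0" "normalized (smult_set d L)"
        using ex_normalized [OF L] by blast
      have "smult_set d L = smult_set \<pi> (smult_set d L)"
        by (subst (1) eq [symmetric]) (simp add: smult_smult_set mult.commute)
      then show False
        using d(2) image_mono [of "smult_set d L" standard_lattice "\<lambda>v. \<pi> *s v"] by (auto simp only: normalized_def)
    qed
    have "lattice_chain {L}"
      using L pi_ne smult_pi_subset [OF lattice_omodule [OF L]] by (auto simp: lattice_chain_def)
    then have x: "{?x} \<in> simplices \<pi> 0"
      unfolding mem_simplices_iff by (intro exI [of _ "{L}"]) simp
    have "{\<tau>. c \<tau> \<noteq> 0} \<subseteq> {{?x}}"
      by (auto simp: c_def)
    then have "finite {\<tau>. c \<tau> \<noteq> 0}"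
      by (rule finite_subset) simp
    then have c: "c \<in> coeff_chains \<pi> n \<rho> 0"
      unfolding coeff_chains_iff using x v by (auto simp: c_def idem_0 idem_homothety_class [OF L])
    have "augmentation \<pi> c = (\<Sum>\<tau>\<in>{{?x}}. c \<tau>)"
      unfolding augmentation_def by (rule sum.mono_neutral_left) (use x in \<open>auto simp: c_def\<close>)
    then have "v = augmentation \<pi> c"
      by (simp add: c_def)
    then show ?thesis
      using c by (rule image_eqI)
  qed
  have R_0: "0 \<in> ?R"
    by (rule R_E [OF lattice_standard]) (rule linear_map_0 [OF linear_E [OF lattice_standard]])
  have R_add: "v + w \<in> ?R" if vw: "v \<in> ?R" "w \<in> ?R" for v w
  proof -
    obtain c d where c: "c \<in> coeff_chains \<pi> n \<rho> 0" "v = augmentation \<pi> c"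
      and d: "d \<in> coeff_chains \<pi> n \<rho> 0" "w = augmentation \<pi> d"
      using vw by blast
    have fin: "finite {\<tau>. c \<tau> \<noteq> 0}" "finite {\<tau>. d \<tau> \<noteq> 0}"
      using c(1) d(1) by (simp_all add: coeff_chains_iff)
    have "(\<lambda>\<tau>. c \<tau> + d \<tau>) \<in> coeff_chains \<pi> n \<rho> 0"
      unfolding coeff_chains_iff
    proof (intro conjI allI ballI impI)
      show "finite {\<tau>. c \<tau> + d \<tau> \<noteq> 0}"
        by (rule finite_subset [OF _ finite_UnI [OF fin]]) auto
      show "\<tau> \<in> simplices \<pi> 0" if "c \<tau> + d \<tau> \<noteq> 0" for \<tau>
      proof -
        have "c \<tau> \<noteq> 0 \<or> d \<tau> \<noteq> 0"
          using that by auto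
        then show ?thesis
          using c(1) d(1) by (auto simp: coeff_chains_iff)
      qed
      show "idem x (c \<tau> + d \<tau>) = c \<tau> + d \<tau>" if "x \<in> \<tau>" for \<tau> x
        using c(1) d(1) that by (simp add: coeff_chains_iff linear_map_add [OF linear_idem])
    qed
    moreover have "v + w = augmentation \<pi> (\<lambda>\<tau>. c \<tau> + d \<tau>)"
      by (simp add: augmentation_add [OF fin] c(2) d(2))
    ultimately show ?thesis
      by blast
  qed
  have R_scl: "scl r v \<in> ?R" if r: "r \<in> Z_inv p" and v: "v \<in> ?R" for r v
  proof -
    obtain c where c: "c \<in> coeff_chains \<pi> n \<rho> 0" "v = augmentation \<pi> c"
      using v by blast
    have fin: "finite {\<tau>. c \<tau> \<noteq> 0}"
      using c(1) by (simp add: coeff_chains_iff)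
    have ne: "c \<tau> \<noteq> 0" if "scl r (c \<tau>) \<noteq> 0" for \<tau>
      using that scl_zero_right [OF r] by auto
    have "(\<lambda>\<tau>. scl r (c \<tau>)) \<in> coeff_chains \<pi> n \<rho> 0"
      unfolding coeff_chains_iff
    proof (intro conjI allI ballI impI)
      show "finite {\<tau>. scl r (c \<tau>) \<noteq> 0}"
        by (rule finite_subset [OF _ fin]) (use ne in blast)
      show "\<tau> \<in> simplices \<pi> 0" if "scl r (c \<tau>) \<noteq> 0" for \<tau>
        using c(1) ne [OF that] by (simp add: coeff_chains_iff)
      show "idem x (scl r (c \<tau>)) = scl r (c \<tau>)" if "x \<in> \<tau>" for \<tau> x
        using c(1) that by (simp add: coeff_chains_iff linear_map_scl [OF linear_idem r])
    qed
    moreover have "scl r v = augmentation \<pi> (\<lambda>\<tau>. scl r (c \<tau>))"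
      by (simp add: augmentation_scl [OF fin r] c(2))
    ultimately show ?thesis
      by blast
  qed
  define W where "W = {v. \<forall>g. invertible g \<longrightarrow> \<rho> g v \<in> ?R}"
  have "subrepresentation p scl \<rho> W"
    unfolding subrepresentation_def
  proof (intro conjI ballI allI impI)
    show "0 \<in> W"
      using R_0 linear_map_0 [OF linear_rho] by (simp add: W_def)
    show "v + w \<in> W" if "v \<in> W" "w \<in> W" for v w
      using that R_add by (simp add: W_def rep_add)
    show "scl r v \<in> W" if "r \<in> Z_inv p" "v \<in> W" for r v
      using that R_scl by (simp add: W_def rep_scl)
    show "\<rho> h v \<in> W" if h: "invertible h" and v: "v \<in> W" for h v
    proof -
      have "\<rho> g (\<rho> h v) \<in> ?R" if "invertible g" for g
        using v invertible_mult [OF that h] by (simp add: W_def rep_mult [OF that h, symmetric])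
      then show ?thesis
        by (simp add: W_def)
    qed
  qed
  moreover have "fixed_vectors \<rho> (principal_congruence \<pi> n) \<subseteq> W"
  proof
    fix v assume v: "v \<in> fixed_vectors \<rho> (principal_congruence \<pi> n)"
    have "\<rho> g v \<in> ?R" if g: "invertible g" for g
    proof -
      note inv = matrix_inv_props [OF g]
      let ?L = "(\<lambda>v. g *v v) ` standard_lattice"
      have L: "is_lattice ?L"
        by (rule lattice_image_mult [OF lattice_standard g])
      \<comment> \<open>The conjugate by \<open>g\<close> of the standard congruence subgroup fixes
        \<open>\<rho> g v\<close>, and this conjugate is the group of \<open>?L\<close>.\<close>
      have "E ?L (\<rho> g v) = \<rho> g v"
      proof (rule E_fixed [OF L])
        fix h assume h: "h \<in> cong_group n ?L"
        have "matrix_inv g ** h ** g \<in> cong_group n standard_lattice"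
          using cong_group_conj [OF h inv(3)] by (simp add: matrix_inv_matrix_inv [OF g] image_image inv)
        then have u: "\<rho> (matrix_inv g ** h ** g) v = v" "invertible (matrix_inv g ** h ** g)"
          using v cong_groupD(1) by (auto simp: fixed_vectors_def principal_congruence_eq)
        have "\<rho> h (\<rho> g v) = \<rho> (h ** g) v"
          by (rule rep_mult [OF cong_groupD(1) [OF h] g, symmetric])
        also have "h ** g = g ** (matrix_inv g ** h ** g)"
          by (simp add: matrix_mul_assoc inv(1))
        also have "\<rho> (g ** (matrix_inv g ** h ** g)) v = \<rho> g v"
          by (simp add: rep_mult [OF g u(2)] u(1))
        finally show "\<rho> h (\<rho> g v) = \<rho> g v" .
      qed
      then show ?thesis
        by (rule R_E [OF L])
    qed
    then show "v \<in> W"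
      by (simp add: W_def)
  qed
  ultimately have W: "W = UNIV"
    using gen unfolding generated_by_def by blast
  have "v \<in> ?R" for v
  proof -
    have "invertible (mat 1 :: 'k ^ 'n ^ 'n)"
      by (simp add: invertible_iff_ker)
    moreover have "v \<in> W"
      by (simp add: W)
    ultimately show ?thesis
      unfolding W_def using rep_one by fastforce
  qed
  then show ?thesis
    by blast
qed

end

theorem theorem3p2:
  fixes \<pi> :: "'k::nonarch_lc_field"
    and lab :: "('k ^ 'n) set set \<Rightarrow> nat"
    and scl :: "rat \<Rightarrow> 'v::ab_group_add \<Rightarrow> 'v"
    and \<rho> :: "'k ^ 'n ^ 'n \<Rightarrow> 'v \<Rightarrow> 'v"
    and p d n :: nat
  assumes "residue_char TYPE('k) p"
    and "prime_element \<pi>"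
    and "CARD('n) = d + 1" and "d \<ge> 1"
    and "n > 1"
    and "labelling \<pi> lab"
    and "smooth_representation p scl \<rho>"
    and "generated_by p scl \<rho> (fixed_vectors \<rho> (principal_congruence \<pi> n))"
  shows "augmentation \<pi> ` coeff_chains \<pi> n \<rho> 0 = UNIV \<and>
    {c \<in> coeff_chains \<pi> n \<rho> 0. augmentation \<pi> c = 0} = boundary \<pi> lab scl 0 ` coeff_chains \<pi> n \<rho> 1 \<and>
    (\<forall>k. {c \<in> coeff_chains \<pi> n \<rho> (k + 1). boundary \<pi> lab scl k c = (\<lambda>_. 0)} =
         boundary \<pi> lab scl (k + 1) ` coeff_chains \<pi> n \<rho> (k + 2))"
proof -
  interpret smooth_setting \<pi> p scl \<rho> n
    by (intro smooth_setting.intro uniformizer.intro smooth_setting_axioms.intro assms)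
  show ?thesis
    using surj_augmentation [OF assms(8)] exact_at_0 [OF assms(6)] exact_at_Suc [OF assms(6)] by simp
qed

end
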